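(* Let $G$ be a finite-dimensional Lie group and let $S$ be its canonical spray, i.e. the spray on $G$ whose geodesics are the curves $t\mapsto g\exp(tX)$ with $g\in G$, $X\in\mathfrak g$. Then $S$ is left invariant projectively Finsler metrizable (there is a left-invariant Finsler metric on $G$ whose geodesics are projectively equivalent to those of $S$) if and only if $S$ is left invariant Riemann metrizable (there is a left-invariant Riemannian metric on $G$ whose geodesics coincide with those of $S$).
   Context: Spray: let $M$ be a smooth finite-dimensional manifold, $J=dx^i\otimes\frac{\partial}{\partial y^i}$ the vertical endomorphism of $TTM$ and $C=y^i\frac{\partial}{\partial y^i}$ the Liouville vector field, in induced coordinates $(x^i,y^i)$ on $TM$. A spray is a smooth vector field $S$ on $TM\setminus\{0\}$ with $JS=C$ and $[C,S]=S$; locally $S=y^i\frac{\partial}{\partial x^i}+f^i(x,y)\frac{\partial}{\partial y^i}$ with $f^i$ positively homogeneous of degree $2$ in $y$. Geodesics of $S$ are the curves $\gamma$ with $\ddot x^i=f^i(x,\dot x)$. Metrics: a Finsler metric on $M$ is given by an energy function $E:TM\to\mathbb R$, smooth on $TM\setminus\{0\}$, positively homogeneous of degree $2$ in $y$, with $\big(\frac{\partial^2E}{\partial y^i\partial y^j}\big)$ positive definite on $TM\setminus\{0\}$ (no reversibility is assumed). It is a Riemannian metric if $E$ is quadratic in $y$. Its geodesics are the solutions of the Euler-Lagrange equations of $E$ (equivalently, the geodesics of the spray determined by $E$). Two families of curves are projectively equivalent if they coincide up to orientation preserving reparameterization of the curves. Left invariance: with $\lambda_g(\hat g)=g\hat g$,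 a metric on $G$ with energy function $E:TG\to\mathbb R$ is left-invariant if $E\circ(\lambda_g)_*=E$ for all $g\in G$. $\mathfrak g=T_eG$ is the Lie algebra of $G$. *)

theory Defs
  imports "HOL-Analysis.Analysis" "HOL-Algebra.Group"
begin

section \<open>Smooth manifolds\<close>

text \<open>Directional form of \<open>C\<^sup>k\<close>; on an open set of a finite-dimensional space this is the usual
  notion. It is only ever used for open \<open>S\<close>.\<close>

primrec Ck_on :: "nat \<Rightarrow> 'a::real_normed_vector set \<Rightarrow> ('a \<Rightarrow> 'b::real_normed_vector) \<Rightarrow> bool" where
  "Ck_on 0 S f \<longleftrightarrow> continuous_on S f"
| "Ck_on (Suc k) S f \<longleftrightarrow>
     (\<forall>x\<in>S. f differentiable (at x)) \<and> (\<forall>v. Ck_on k S (\<lambda>x. frechet_derivative f (at x) v))"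

definition smooth_on :: "'a::real_normed_vector set \<Rightarrow> ('a \<Rightarrow> 'b::real_normed_vector) \<Rightarrow> bool" where
  "smooth_on S f \<longleftrightarrow> (\<forall>k. Ck_on k S f)"

text \<open>A chart is a pair of its domain and its coordinate map. The coordinate map is a total HOL
  function, whose values outside the domain are irrelevant.\<close>

type_synonym ('p, 'e) chart = "'p set \<times> ('p \<Rightarrow> 'e)"
type_synonym ('p, 'e) atlas = "('p, 'e) chart set"

definition chart_inv :: "('p, 'e) chart \<Rightarrow> 'e \<Rightarrow> 'p" where
  "chart_inv c = inv_into (fst c) (snd c)"

definition chart_image :: "('p, 'e) chart \<Rightarrow> 'e set" where
  "chart_image c = snd c ` fst c"

definition charts_at :: "('p, 'e) atlas \<Rightarrow> 'p \<Rightarrow> ('p, 'e) chart set" where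
  "charts_at A p = {c \<in> A. p \<in> fst c}"

definition points :: "('p, 'e) atlas \<Rightarrow> 'p set" where
  "points A = (\<Union>c\<in>A. fst c)"

locale smooth_manifold =
  fixes X :: "'p topology" and A :: "('p, 'e::euclidean_space) atlas"
  assumes hausdorff: "Hausdorff_space X"
    and second_countable: "second_countable X"
    and covering: "points A = topspace X"
    and chart_domain: "c \<in> A \<Longrightarrow> openin X (fst c)"
    and chart_image_open: "c \<in> A \<Longrightarrow> open (chart_image c)"
    and chart_homeomorphic:
      "c \<in> A \<Longrightarrow> homeomorphic_map (subtopology X (fst c)) (top_of_set (chart_image c)) (snd c)"
    and compatible:
      "c \<in> A \<Longrightarrow> d \<in> A \<Longrightarrow> smooth_on (snd c ` (fst c \<inter> fst d)) (snd d \<circ> chart_inv c)"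

definition smooth_map ::
    "'p topology \<Rightarrow> ('p, 'e::real_normed_vector) atlas \<Rightarrow>
     'q topology \<Rightarrow> ('q, 'f::real_normed_vector) atlas \<Rightarrow> ('p \<Rightarrow> 'q) \<Rightarrow> bool" where
  "smooth_map X A Y B f \<longleftrightarrow> continuous_map X Y f \<and>
     (\<forall>c\<in>A. \<forall>d\<in>B. smooth_on (snd c ` {p \<in> fst c. f p \<in> fst d}) (snd d \<circ> f \<circ> chart_inv c))"

definition prod_atlas :: "('p, 'e) atlas \<Rightarrow> ('q, 'f) atlas \<Rightarrow> ('p \<times> 'q, 'e \<times> 'f) atlas" where
  "prod_atlas A B = (\<lambda>(c, d). (fst c \<times> fst d, map_prod (snd c) (snd d))) ` (A \<times> B)"


section \<open>Tangent vectors and vector fields\<close>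

text \<open>A tangent vector at \<open>p\<close> is the family of its coordinate vectors in the charts around \<open>p\<close>,
  which transform into each other by the Jacobians of the coordinate changes. The family is \<open>0\<close> at
  all other charts, so that equality of tangent vectors is equality of functions.\<close>

type_synonym ('p, 'e) tvec = "('p, 'e) chart \<Rightarrow> 'e"

definition tangent_space :: "('p, 'e::real_normed_vector) atlas \<Rightarrow> 'p \<Rightarrow> ('p, 'e) tvec set" where
  "tangent_space A p = {v.
     (\<forall>c\<in>charts_at A p. \<forall>d\<in>charts_at A p.
        v d = frechet_derivative (snd d \<circ> chart_inv c) (at (snd c p)) (v c)) \<and>
     (\<forall>c. c \<notin> charts_at A p \<longrightarrow> v c = 0)}"

definition zero_tvec :: "('p, 'e::zero) tvec" where
  "zero_tvec = (\<lambda>c. 0)"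

definition scale_tvec :: "real \<Rightarrow> ('p, 'e::real_vector) tvec \<Rightarrow> ('p, 'e) tvec" where
  "scale_tvec t v = (\<lambda>c. t *\<^sub>R v c)"

definition tangent_bundle :: "('p, 'e::real_normed_vector) atlas \<Rightarrow> ('p \<times> ('p, 'e) tvec) set" where
  "tangent_bundle A = (SIGMA p:points A. tangent_space A p)"

definition slit_tangent_bundle ::
    "('p, 'e::real_normed_vector) atlas \<Rightarrow> ('p \<times> ('p, 'e) tvec) set" where
  "slit_tangent_bundle A = {(p, v) \<in> tangent_bundle A. v \<noteq> zero_tvec}"

text \<open>The induced coordinates \<open>(x, y)\<close> on the tangent bundle, and their restriction to the slit
  tangent bundle.\<close>

definition tangent_chart ::
    "('p, 'e::real_normed_vector) atlas \<Rightarrow> ('p, 'e) chart \<Rightarrow> ('p \<times> ('p, 'e) tvec, 'e \<times> 'e) chart" where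
  "tangent_chart A c = ({(p, v) \<in> tangent_bundle A. p \<in> fst c}, \<lambda>(p, v). (snd c p, v c))"

definition slit_chart ::
    "('p, 'e::real_normed_vector) atlas \<Rightarrow> ('p, 'e) chart \<Rightarrow> ('p \<times> ('p, 'e) tvec, 'e \<times> 'e) chart" where
  "slit_chart A c = ({(p, v) \<in> slit_tangent_bundle A. p \<in> fst c}, \<lambda>(p, v). (snd c p, v c))"

definition slit_atlas ::
    "('p, 'e::real_normed_vector) atlas \<Rightarrow> ('p \<times> ('p, 'e) tvec, 'e \<times> 'e) atlas" where
  "slit_atlas A = slit_chart A ` A"

text \<open>The differential of \<open>f\<close> at \<open>p\<close>. On tangent vectors of a manifold the choice of the chart
  around \<open>p\<close> is immaterial.\<close>

definition differential ::
    "('p, 'e::real_normed_vector) atlas \<Rightarrow> ('q, 'f::real_normed_vector) atlas \<Rightarrow>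
     ('p \<Rightarrow> 'q) \<Rightarrow> 'p \<Rightarrow> ('p, 'e) tvec \<Rightarrow> ('q, 'f) tvec" where
  "differential A B f p v = (\<lambda>d.
     if d \<in> charts_at B (f p)
     then (let c = (SOME c. c \<in> charts_at A p)
           in frechet_derivative (snd d \<circ> f \<circ> chart_inv c) (at (snd c p)) (v c))
     else 0)"

type_synonym ('p, 'e) vfield = "'p \<Rightarrow> ('p, 'e) tvec"

definition smooth_vector_field :: "('p, 'e::real_normed_vector) atlas \<Rightarrow> ('p, 'e) vfield \<Rightarrow> bool" where
  "smooth_vector_field A V \<longleftrightarrow> (\<forall>p\<in>points A. V p \<in> tangent_space A p) \<and>
     (\<forall>c\<in>A. smooth_on (chart_image c) (\<lambda>x. V (chart_inv c x) c))"

text \<open>In coordinates, \<open>[V, W]\<^sup>i = V\<^sup>j \<partial>\<^sub>j W\<^sup>i - W\<^sup>j \<partial>\<^sub>j V\<^sup>i\<close>.\<close>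

definition lie_bracket ::
    "('p, 'e::real_normed_vector) atlas \<Rightarrow> ('p, 'e) vfield \<Rightarrow> ('p, 'e) vfield \<Rightarrow> ('p, 'e) vfield" where
  "lie_bracket A V W p = (\<lambda>c.
     if c \<in> charts_at A p
     then frechet_derivative (\<lambda>x. W (chart_inv c x) c) (at (snd c p)) (V p c)
        - frechet_derivative (\<lambda>x. V (chart_inv c x) c) (at (snd c p)) (W p c)
     else 0)"


section \<open>Curves\<close>

definition open_interval :: "real set \<Rightarrow> bool" where
  "open_interval I \<longleftrightarrow> open I \<and> is_interval I \<and> I \<noteq> {}"

definition smooth_curve ::
    "'p topology \<Rightarrow> ('p, 'e::real_normed_vector) atlas \<Rightarrow> real set \<Rightarrow> (real \<Rightarrow> 'p) \<Rightarrow> bool" where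
  "smooth_curve X A I \<gamma> \<longleftrightarrow> smooth_map (top_of_set I) {(I, id)} X A \<gamma>"

definition velocity ::
    "('p, 'e::real_normed_vector) atlas \<Rightarrow> (real \<Rightarrow> 'p) \<Rightarrow> real \<Rightarrow> ('p, 'e) tvec" where
  "velocity A \<gamma> t = (\<lambda>c.
     if c \<in> charts_at A (\<gamma> t) then vector_derivative (snd c \<circ> \<gamma>) (at t) else 0)"

text \<open>A parameterized curve is a pair of its open interval of definition and a map whose values
  outside that interval are irrelevant.\<close>

type_synonym 'p curve = "real set \<times> (real \<Rightarrow> 'p)"

text \<open>Sprays and energy functions are only smooth off the zero section, so geodesics are
  regular curves.\<close>

definition regular_curves :: "'p topology \<Rightarrow> ('p, 'e::real_normed_vector) atlas \<Rightarrow> 'p curve set" where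
  "regular_curves X A = {(I, \<gamma>). open_interval I \<and> smooth_curve X A I \<gamma> \<and>
     (\<forall>t\<in>I. velocity A \<gamma> t \<noteq> zero_tvec)}"

definition orientation_preserving_reparameterization ::
    "real set \<Rightarrow> real set \<Rightarrow> (real \<Rightarrow> real) \<Rightarrow> bool" where
  "orientation_preserving_reparameterization J I \<theta> \<longleftrightarrow>
     bij_betw \<theta> J I \<and> smooth_on J \<theta> \<and> (\<forall>t\<in>J. deriv \<theta> t > 0)"

definition contained_up_to_reparameterization :: "'p curve set \<Rightarrow> 'p curve set \<Rightarrow> bool" where
  "contained_up_to_reparameterization F F' \<longleftrightarrow>
     (\<forall>(I, \<gamma>)\<in>F. \<exists>J \<theta>. open_interval J \<and> orientation_preserving_reparameterization J I \<theta> \<and>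
        (J, \<gamma> \<circ> \<theta>) \<in> F')"

definition projectively_equivalent :: "'p curve set \<Rightarrow> 'p curve set \<Rightarrow> bool" where
  "projectively_equivalent F F' \<longleftrightarrow>
     contained_up_to_reparameterization F F' \<and> contained_up_to_reparameterization F' F"


section \<open>Sprays\<close>

text \<open>With respect to the chart of \<open>TM\<close> induced by a chart of \<open>M\<close>, a tangent vector of \<open>TM\<close> is a
  pair \<open>(a, b)\<close>, standing for \<open>a\<^sup>i \<partial>/\<partial>x\<^sup>i + b\<^sup>i \<partial>/\<partial>y\<^sup>i\<close>.\<close>

definition vertical_endomorphism ::
    "('p, 'e::real_normed_vector) atlas \<Rightarrow> 'p \<times> ('p, 'e) tvec \<Rightarrow>
     ('p \<times> ('p, 'e) tvec, 'e \<times> 'e) tvec \<Rightarrow> ('p \<times> ('p, 'e) tvec, 'e \<times> 'e) tvec" where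
  "vertical_endomorphism A z w =
     (\<lambda>c. if c \<in> charts_at (slit_atlas A) z then (0, fst (w c)) else 0)"

definition liouville ::
    "('p, 'e::real_normed_vector) atlas \<Rightarrow> ('p \<times> ('p, 'e) tvec, 'e \<times> 'e) vfield" where
  "liouville A z = (\<lambda>c. if c \<in> charts_at (slit_atlas A) z then (0, snd (snd c z)) else 0)"

definition spray ::
    "('p, 'e::real_normed_vector) atlas \<Rightarrow> ('p \<times> ('p, 'e) tvec, 'e \<times> 'e) vfield \<Rightarrow> bool" where
  "spray A S \<longleftrightarrow> smooth_vector_field (slit_atlas A) S \<and>
     (\<forall>z\<in>slit_tangent_bundle A. vertical_endomorphism A z (S z) = liouville A z) \<and>
     (\<forall>z\<in>slit_tangent_bundle A. lie_bracket (slit_atlas A) (liouville A) S z = S z)"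

text \<open>The curves with \<open>x'' = f(x, x')\<close>, where \<open>f\<close> is the \<open>\<partial>/\<partial>y\<close>-component of \<open>S\<close>.\<close>

definition spray_geodesics ::
    "'p topology \<Rightarrow> ('p, 'e::real_normed_vector) atlas \<Rightarrow>
     ('p \<times> ('p, 'e) tvec, 'e \<times> 'e) vfield \<Rightarrow> 'p curve set" where
  "spray_geodesics X A S = {(I, \<gamma>) \<in> regular_curves X A.
     \<forall>t\<in>I. \<forall>c\<in>charts_at A (\<gamma> t).
       vector_derivative (\<lambda>s. vector_derivative (snd c \<circ> \<gamma>) (at s)) (at t)
         = snd (S (\<gamma> t, velocity A \<gamma> t) (slit_chart A c))}"


section \<open>Finsler and Riemannian metrics\<close>

text \<open>The coordinate expression \<open>E(x, y)\<close> of a function on \<open>TM\<close>, and the partial derivatives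
  \<open>\<partial>/\<partial>x\<^sup>i\<close> and \<open>\<partial>/\<partial>y\<^sup>i\<close> of a function of \<open>(x, y)\<close>, indexed by the basis vectors \<open>i \<in> Basis\<close>.\<close>

definition coord_expr ::
    "('p, 'e::real_normed_vector) atlas \<Rightarrow> ('p \<times> ('p, 'e) tvec \<Rightarrow> real) \<Rightarrow> ('p, 'e) chart \<Rightarrow>
     'e \<times> 'e \<Rightarrow> real" where
  "coord_expr A E c = E \<circ> chart_inv (tangent_chart A c)"

definition partial_x :: "'e::real_normed_vector \<Rightarrow> ('e \<times> 'e \<Rightarrow> real) \<Rightarrow> 'e \<times> 'e \<Rightarrow> real" where
  "partial_x i L z = frechet_derivative L (at z) (i, 0)"

definition partial_y :: "'e::real_normed_vector \<Rightarrow> ('e \<times> 'e \<Rightarrow> real) \<Rightarrow> 'e \<times> 'e \<Rightarrow> real" where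
  "partial_y i L z = frechet_derivative L (at z) (0, i)"

definition finsler_metric ::
    "('p, 'e::euclidean_space) atlas \<Rightarrow> ('p \<times> ('p, 'e) tvec \<Rightarrow> real) \<Rightarrow> bool" where
  "finsler_metric A E \<longleftrightarrow>
     (\<forall>c\<in>A. smooth_on (chart_image (slit_chart A c)) (coord_expr A E c)) \<and>
     (\<forall>(p, v)\<in>tangent_bundle A. \<forall>t>0. E (p, scale_tvec t v) = t\<^sup>2 * E (p, v)) \<and>
     (\<forall>c\<in>A. \<forall>z\<in>chart_image (slit_chart A c). \<forall>w. w \<noteq> 0 \<longrightarrow>
        (\<Sum>i\<in>Basis. \<Sum>j\<in>Basis.
           partial_y i (partial_y j (coord_expr A E c)) z * (w \<bullet> i) * (w \<bullet> j)) > 0)"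

definition riemannian_metric ::
    "('p, 'e::euclidean_space) atlas \<Rightarrow> ('p \<times> ('p, 'e) tvec \<Rightarrow> real) \<Rightarrow> bool" where
  "riemannian_metric A E \<longleftrightarrow> finsler_metric A E \<and>
     (\<forall>c\<in>A. \<forall>x\<in>chart_image c. \<exists>b. bilinear b \<and> (\<forall>y. coord_expr A E c (x, y) = b y y))"

text \<open>The regular solutions of the Euler-Lagrange equations
  \<open>d/dt (\<partial>E/\<partial>y\<^sup>i (x, x')) = \<partial>E/\<partial>x\<^sup>i (x, x')\<close>.\<close>

definition metric_geodesics ::
    "'p topology \<Rightarrow> ('p, 'e::euclidean_space) atlas \<Rightarrow> ('p \<times> ('p, 'e) tvec \<Rightarrow> real) \<Rightarrow> 'p curve set" where
  "metric_geodesics X A E = {(I, \<gamma>) \<in> regular_curves X A.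
     \<forall>t\<in>I. \<forall>c\<in>charts_at A (\<gamma> t). \<forall>i\<in>Basis.
       let lift = (\<lambda>s. (snd c (\<gamma> s), vector_derivative (snd c \<circ> \<gamma>) (at s)))
       in ((\<lambda>s. partial_y i (coord_expr A E c) (lift s)) has_real_derivative
             partial_x i (coord_expr A E c) (lift t)) (at t)}"


section \<open>Lie groups\<close>

locale lie_group = group G + smooth_manifold X A
  for G :: "('g, 'b) monoid_scheme" (structure)
    and X :: "'g topology" and A :: "('g, 'e::euclidean_space) atlas" +
  assumes topspace_carrier: "topspace X = carrier G"
    and smooth_mult:
      "smooth_map (prod_topology X X) (prod_atlas A A) X A (\<lambda>(g, h). g \<otimes> h)"
    and smooth_inv: "smooth_map X A X A (\<lambda>g. inv g)"

definition one_parameter_subgroup ::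
    "('g, 'b) monoid_scheme \<Rightarrow> 'g topology \<Rightarrow> ('g, 'e::real_normed_vector) atlas \<Rightarrow> (real \<Rightarrow> 'g) \<Rightarrow> bool" where
  "one_parameter_subgroup G X A \<phi> \<longleftrightarrow>
     smooth_curve X A UNIV \<phi> \<and> (\<forall>s t. \<phi> (s + t) = \<phi> s \<otimes>\<^bsub>G\<^esub> \<phi> t)"

text \<open>The Lie algebra is the tangent space at \<open>\<one>\<close>, and \<open>exp v\<close> is the value at \<open>1\<close> of the
  one-parameter subgroup with initial velocity \<open>v\<close>.\<close>

definition lie_exp ::
    "('g, 'b) monoid_scheme \<Rightarrow> 'g topology \<Rightarrow> ('g, 'e::real_normed_vector) atlas \<Rightarrow> ('g, 'e) tvec \<Rightarrow> 'g" where
  "lie_exp G X A v = (THE \<phi>. one_parameter_subgroup G X A \<phi> \<and> velocity A \<phi> 0 = v) 1"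

definition canonical_spray ::
    "('g, 'b) monoid_scheme \<Rightarrow> 'g topology \<Rightarrow> ('g, 'e::real_normed_vector) atlas \<Rightarrow>
     ('g \<times> ('g, 'e) tvec, 'e \<times> 'e) vfield \<Rightarrow> bool" where
  "canonical_spray G X A S \<longleftrightarrow> spray A S \<and>
     spray_geodesics X A S = {(I, \<gamma>). open_interval I \<and>
       (\<exists>g\<in>carrier G. \<exists>v\<in>tangent_space A \<one>\<^bsub>G\<^esub>. v \<noteq> zero_tvec \<and>
          (\<forall>t\<in>I. \<gamma> t = g \<otimes>\<^bsub>G\<^esub> lie_exp G X A (scale_tvec t v)))}"

definition left_invariant ::
    "('g, 'b) monoid_scheme \<Rightarrow> ('g, 'e::real_normed_vector) atlas \<Rightarrow> ('g \<times> ('g, 'e) tvec \<Rightarrow> real) \<Rightarrow> bool" where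
  "left_invariant G A E \<longleftrightarrow> (\<forall>g\<in>carrier G. \<forall>(h, v)\<in>tangent_bundle A.
     E (g \<otimes>\<^bsub>G\<^esub> h, differential A A (\<lambda>k. g \<otimes>\<^bsub>G\<^esub> k) h v) = E (h, v))"

definition left_invariant_projectively_finsler_metrizable ::
    "('g, 'b) monoid_scheme \<Rightarrow> 'g topology \<Rightarrow> ('g, 'e::euclidean_space) atlas \<Rightarrow>
     ('g \<times> ('g, 'e) tvec, 'e \<times> 'e) vfield \<Rightarrow> bool" where
  "left_invariant_projectively_finsler_metrizable G X A S \<longleftrightarrow>
     (\<exists>E. finsler_metric A E \<and> left_invariant G A E \<and>
        projectively_equivalent (metric_geodesics X A E) (spray_geodesics X A S))"

definition left_invariant_riemann_metrizable ::
    "('g, 'b) monoid_scheme \<Rightarrow> 'g topology \<Rightarrow> ('g, 'e::euclidean_space) atlas \<Rightarrow>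
     ('g \<times> ('g, 'e) tvec, 'e \<times> 'e) vfield \<Rightarrow> bool" where
  "left_invariant_riemann_metrizable G X A S \<longleftrightarrow>
     (\<exists>E. riemannian_metric A E \<and> left_invariant G A E \<and>
        metric_geodesics X A E = spray_geodesics X A S)"

end

theory Submission
  imports Defs
begin

text \<open>Left translation turns a left-invariant energy into a function \<open>e\<close> on the Lie algebra and the
  velocity of a curve into a curve \<open>Y\<close> there. The geodesics of the canonical spray are the curves
  with constant \<open>Y\<close>, and the Euler-Lagrange equations become
  \<open>d/dt (de(Y) \<omega>(w)) = de(Y) (d\<omega>(w, \<gamma>'))\<close>, where \<open>\<omega>\<close> is the Maurer-Cartan form. If the geodesics of
  the spray are, up to reparameterization, extremals of \<open>e\<close>, then \<open>de(Y) (d\<omega>(w, Y)) = 0\<close>: \<open>e\<close> is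
  annihilated by the linear vector fields \<open>Y \<mapsto> d\<omega>(w, Y)\<close>, hence invariant under their flows. The
  group of linear isometries of \<open>e\<close> is bounded, so it preserves an inner product, whose
  left-invariant extension has the required geodesics.\<close>

section \<open>Smooth functions\<close>

lemma has_derivative_frechet:
  "f differentiable (at x) \<Longrightarrow> (f has_derivative frechet_derivative f (at x)) (at x)"
  by (simp add: frechet_derivative_works)

lemma Ck_on_cong:
  assumes "open S" "\<And>x. x \<in> S \<Longrightarrow> f x = g x" "Ck_on k S f"
  shows "Ck_on k S g"
  using assms(2,3)
proof (induction k arbitrary: f g)
  case 0
  then show ?case by (simp cong: continuous_on_cong)
next
  case (Suc k)
  have d: "g differentiable (at x)" if "x \<in> S" for x
  proof -
    have "(f has_derivative frechet_derivative f (at x)) (at x)"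
      using Suc.prems(2) that by (intro has_derivative_frechet) simp
    then have "(g has_derivative frechet_derivative f (at x)) (at x)"
      using assms(1) that Suc.prems(1) by (rule has_derivative_transform_within_open)
    then show ?thesis by (auto simp: differentiable_def)
  qed
  have e: "frechet_derivative f (at x) = frechet_derivative g (at x)" if "x \<in> S" for x
    using Suc.prems that assms(1) by (intro frechet_derivative_transform_within_open[of _ _ S]) auto
  have "Ck_on k S (\<lambda>x. frechet_derivative g (at x) v)" for v
    using Suc.IH[of "\<lambda>x. frechet_derivative f (at x) v"] Suc.prems e by auto
  then show ?case using d by simp
qed

lemma Ck_on_subset: "Ck_on k S f \<Longrightarrow> T \<subseteq> S \<Longrightarrow> Ck_on k T f"
  by (induction k arbitrary: f) (auto intro: continuous_on_subset)

lemma Ck_on_local: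
  assumes "\<And>x. x \<in> S \<Longrightarrow> \<exists>T. open T \<and> x \<in> T \<and> Ck_on k T f"
  shows "Ck_on k S f"
  using assms
proof (induction k arbitrary: f)
  case 0
  then have "isCont f x" if "x \<in> S" for x
    using that by (metis Ck_on.simps(1) continuous_on_eq_continuous_at)
  then show ?case by (simp add: continuous_at_imp_continuous_on)
next
  case (Suc k)
  have "f differentiable (at x)" if "x \<in> S" for x using Suc.prems[OF that] by auto
  moreover have "Ck_on k S (\<lambda>x. frechet_derivative f (at x) v)" for v
    by (rule Suc.IH) (metis Ck_on.simps(2) Suc.prems)
  ultimately show ?case by simp
qed

lemma Ck_on_SucD: "Ck_on (Suc k) S f \<Longrightarrow> Ck_on k S f"
proof (induction k arbitrary: f)
  case 0
  then show ?case
    by (simp add: continuous_at_imp_continuous_on differentiable_imp_continuous_within)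
next
  case (Suc k)
  then show ?case by (metis Ck_on.simps(2))
qed

lemma Ck_on_const: "Ck_on k S (\<lambda>x. c)"
  by (induction k arbitrary: c) simp_all

lemma Ck_on_add:
  assumes "open S" "Ck_on k S f" "Ck_on k S g"
  shows "Ck_on k S (\<lambda>x. f x + g x)"
  using assms(2,3)
proof (induction k arbitrary: f g)
  case 0
  then show ?case by (simp add: continuous_on_add)
next
  case (Suc k)
  have d: "((\<lambda>x. f x + g x) has_derivative
      (\<lambda>v. frechet_derivative f (at x) v + frechet_derivative g (at x) v)) (at x)"
    if "x \<in> S" for x
    using Suc.prems that by (intro has_derivative_add has_derivative_frechet) simp_all
  have "Ck_on k S (\<lambda>x. frechet_derivative (\<lambda>x. f x + g x) (at x) v)" for v
  proof (rule Ck_on_cong[OF assms(1)])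
    show "Ck_on k S (\<lambda>x. frechet_derivative f (at x) v + frechet_derivative g (at x) v)"
      using Suc by auto
    show "frechet_derivative f (at x) v + frechet_derivative g (at x) v
        = frechet_derivative (\<lambda>x. f x + g x) (at x) v" if "x \<in> S" for x
      using frechet_derivative_at[OF d[OF that]] by (rule fun_cong)
  qed
  then show ?case using Suc.prems by simp
qed

lemma Ck_on_linear:
  assumes "open S" "Ck_on k S f" "bounded_linear h"
  shows "Ck_on k S (\<lambda>x. h (f x))"
  using assms(2)
proof (induction k arbitrary: f)
  case 0
  then show ?case using assms(3) by (simp add: bounded_linear.continuous_on)
next
  case (Suc k)
  have d: "((\<lambda>x. h (f x)) has_derivative (\<lambda>v. h (frechet_derivative f (at x) v))) (at x)"
    if "x \<in> S" for x
    using Suc.prems that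
    by (intro bounded_linear.has_derivative[OF assms(3)] has_derivative_frechet) simp
  have "Ck_on k S (\<lambda>x. frechet_derivative (\<lambda>x. h (f x)) (at x) v)" for v
  proof (rule Ck_on_cong[OF assms(1)])
    show "Ck_on k S (\<lambda>x. h (frechet_derivative f (at x) v))"
      using Suc by auto
    show "h (frechet_derivative f (at x) v) = frechet_derivative (\<lambda>x. h (f x)) (at x) v"
      if "x \<in> S" for x
      using frechet_derivative_at[OF d[OF that]] by (rule fun_cong)
  qed
  moreover have "(\<lambda>x. h (f x)) differentiable (at x)" if "x \<in> S" for x
    using d[OF that] by (auto simp: differentiable_def)
  ultimately show ?case by simp
qed

lemma Ck_on_bilinear:
  assumes "open S" "Ck_on k S f" "Ck_on k S g" "bounded_bilinear p"
  shows "Ck_on k S (\<lambda>x. p (f x) (g x))"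
  using assms(2,3)
proof (induction k arbitrary: f g)
  case 0
  then show ?case using assms(4) by (simp add: bounded_bilinear.continuous_on)
next
  case (Suc k)
  have d: "((\<lambda>x. p (f x) (g x)) has_derivative
      (\<lambda>v. p (f x) (frechet_derivative g (at x) v) + p (frechet_derivative f (at x) v) (g x))) (at x)"
    if "x \<in> S" for x
    using Suc.prems that
    by (intro bounded_bilinear.FDERIV[OF assms(4)] has_derivative_frechet) simp_all
  have lower: "Ck_on k S f" "Ck_on k S g" using Suc.prems Ck_on_SucD by blast+
  have "Ck_on k S (\<lambda>x. frechet_derivative (\<lambda>x. p (f x) (g x)) (at x) v)" for v
  proof (rule Ck_on_cong[OF assms(1)])
    show "Ck_on k S (\<lambda>x. p (f x) (frechet_derivative g (at x) v)
        + p (frechet_derivative f (at x) v) (g x))"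
      using Suc.prems lower by (intro Ck_on_add[OF assms(1)] Suc.IH) auto
    show "p (f x) (frechet_derivative g (at x) v) + p (frechet_derivative f (at x) v) (g x)
        = frechet_derivative (\<lambda>x. p (f x) (g x)) (at x) v"
      if "x \<in> S" for x
      using frechet_derivative_at[OF d[OF that]] by (rule fun_cong)
  qed
  moreover have "(\<lambda>x. p (f x) (g x)) differentiable (at x)" if "x \<in> S" for x
    using d[OF that] by (auto simp: differentiable_def)
  ultimately show ?case by simp
qed

lemma Ck_on_sum:
  assumes "open S" "\<And>i. i \<in> I \<Longrightarrow> Ck_on k S (f i)"
  shows "Ck_on k S (\<lambda>x. \<Sum>i\<in>I. f i x)"
  using assms(2)
  by (induction I rule: infinite_finite_induct) (simp_all add: Ck_on_const Ck_on_add[OF assms(1)])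

lemma linear_expand_Basis:
  fixes h :: "'a::euclidean_space \<Rightarrow> 'b::real_vector"
  assumes "linear h"
  shows "h v = (\<Sum>i\<in>Basis. (v \<bullet> i) *\<^sub>R h i)"
proof -
  have "h v = h (\<Sum>i\<in>Basis. (v \<bullet> i) *\<^sub>R i)" by (simp add: euclidean_representation)
  then show ?thesis using assms by (simp add: linear_sum linear_scale)
qed

lemma Ck_on_compose:
  fixes g :: "'a::real_normed_vector \<Rightarrow> 'b::euclidean_space"
    and f :: "'b \<Rightarrow> 'c::real_normed_vector"
  assumes "open S" "open T" "Ck_on k T f" "Ck_on k S g" "g ` S \<subseteq> T"
  shows "Ck_on k S (\<lambda>x. f (g x))"
  using assms(3,4)
proof (induction k arbitrary: f)
  case 0
  then show ?case using assms(5) by (simp add: continuous_on_compose2)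
next
  case (Suc k)
  have fg: "f differentiable (at (g x))" "g differentiable (at x)" if "x \<in> S" for x
    using Suc.prems that assms(5) by auto
  then have d: "((\<lambda>x. f (g x)) has_derivative
      (\<lambda>v. frechet_derivative f (at (g x)) (frechet_derivative g (at x) v))) (at x)" if "x \<in> S" for x
    using that by (intro has_derivative_compose[of g _ x UNIV f] has_derivative_frechet) auto
  have lower: "Ck_on k S g" using Suc.prems Ck_on_SucD by blast
  have "Ck_on k S (\<lambda>x. frechet_derivative (\<lambda>x. f (g x)) (at x) v)" for v
  proof (rule Ck_on_cong[OF assms(1)])
    show "Ck_on k S (\<lambda>x. \<Sum>i\<in>Basis. (frechet_derivative g (at x) v \<bullet> i)
        *\<^sub>R frechet_derivative f (at (g x)) i)"
    proof (rule Ck_on_sum[OF assms(1)])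
      fix i :: 'b
      have "Ck_on k S (\<lambda>x. frechet_derivative g (at x) v \<bullet> i)"
        using Suc.prems by (intro Ck_on_linear[OF assms(1) _ bounded_linear_inner_left]) simp
      moreover have "Ck_on k S (\<lambda>x. frechet_derivative f (at (g x)) i)"
        using Suc.prems lower by (intro Suc.IH) simp_all
      ultimately show "Ck_on k S (\<lambda>x. (frechet_derivative g (at x) v \<bullet> i)
          *\<^sub>R frechet_derivative f (at (g x)) i)"
        by (rule Ck_on_bilinear[OF assms(1) _ _ bounded_bilinear_scaleR])
    qed
    show "(\<Sum>i\<in>Basis. (frechet_derivative g (at x) v \<bullet> i) *\<^sub>R frechet_derivative f (at (g x)) i)
        = frechet_derivative (\<lambda>x. f (g x)) (at x) v"
      if "x \<in> S" for x
    proof -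
      have "linear (frechet_derivative f (at (g x)))"
        using fg(1)[OF that] by (rule linear_frechet_derivative)
      from linear_expand_Basis[OF this, symmetric] show ?thesis
        using fun_cong[OF frechet_derivative_at[OF d[OF that]]] by (rule trans)
    qed
  qed
  moreover have "(\<lambda>x. f (g x)) differentiable (at x)" if "x \<in> S" for x
    using d[OF that] by (auto simp: differentiable_def)
  ultimately show ?case by simp
qed

lemma smooth_onD: "smooth_on S f \<Longrightarrow> x \<in> S \<Longrightarrow> f differentiable (at x)"
  unfolding smooth_on_def by (metis Ck_on.simps(2))

lemma smooth_on_has_derivative:
  "smooth_on S f \<Longrightarrow> x \<in> S \<Longrightarrow> (f has_derivative frechet_derivative f (at x)) (at x)"
  by (simp add: has_derivative_frechet smooth_onD)

lemma smooth_on_frechet: "smooth_on S f \<Longrightarrow> smooth_on S (\<lambda>x. frechet_derivative f (at x) v)"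
  unfolding smooth_on_def by (metis Ck_on.simps(2))

lemma smooth_on_cong:
  "open S \<Longrightarrow> (\<And>x. x \<in> S \<Longrightarrow> f x = g x) \<Longrightarrow> smooth_on S f \<Longrightarrow> smooth_on S g"
  unfolding smooth_on_def by (metis Ck_on_cong)

lemma smooth_on_subset: "smooth_on S f \<Longrightarrow> T \<subseteq> S \<Longrightarrow> smooth_on T f"
  unfolding smooth_on_def by (metis Ck_on_subset)

lemma smooth_on_local:
  "(\<And>x. x \<in> S \<Longrightarrow> \<exists>T. open T \<and> x \<in> T \<and> smooth_on T f) \<Longrightarrow> smooth_on S f"
  unfolding smooth_on_def by (metis Ck_on_local)

lemma smooth_on_const: "smooth_on S (\<lambda>x. c)"
  unfolding smooth_on_def by (metis Ck_on_const)

lemma smooth_on_add: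
  "open S \<Longrightarrow> smooth_on S f \<Longrightarrow> smooth_on S g \<Longrightarrow> smooth_on S (\<lambda>x. f x + g x)"
  unfolding smooth_on_def by (metis Ck_on_add)

lemma smooth_on_linear:
  "open S \<Longrightarrow> smooth_on S f \<Longrightarrow> bounded_linear h \<Longrightarrow> smooth_on S (\<lambda>x. h (f x))"
  unfolding smooth_on_def by (metis Ck_on_linear)

lemma smooth_on_bilinear:
  "open S \<Longrightarrow> smooth_on S f \<Longrightarrow> smooth_on S g \<Longrightarrow> bounded_bilinear p \<Longrightarrow>
    smooth_on S (\<lambda>x. p (f x) (g x))"
  unfolding smooth_on_def by (metis Ck_on_bilinear)

lemma smooth_on_sum:
  "open S \<Longrightarrow> (\<And>i. i \<in> I \<Longrightarrow> smooth_on S (f i)) \<Longrightarrow> smooth_on S (\<lambda>x. \<Sum>i\<in>I. f i x)"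
  unfolding smooth_on_def by (simp add: Ck_on_sum)

lemma smooth_on_compose:
  fixes g :: "'a::real_normed_vector \<Rightarrow> 'b::euclidean_space"
  shows "open S \<Longrightarrow> open T \<Longrightarrow> smooth_on T f \<Longrightarrow> smooth_on S g \<Longrightarrow> g ` S \<subseteq> T \<Longrightarrow>
    smooth_on S (\<lambda>x. f (g x))"
  unfolding smooth_on_def by (metis Ck_on_compose)

lemma smooth_on_id: "smooth_on S (\<lambda>x. x)"
proof -
  have "Ck_on k S (\<lambda>x. x)" for k
    by (cases k) (simp_all add: Ck_on_const frechet_derivative_ident)
  then show ?thesis by (simp add: smooth_on_def)
qed

lemma smooth_on_bounded_linear: "open S \<Longrightarrow> bounded_linear h \<Longrightarrow> smooth_on S h"
  using smooth_on_linear[of S "\<lambda>x. x" h] by (simp add: smooth_on_id)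

lemma smooth_on_Pair:
  assumes "open S" "smooth_on S f" "smooth_on S g"
  shows "smooth_on S (\<lambda>x. (f x, g x))"
proof -
  have "smooth_on S (\<lambda>x. (f x, 0) + (0, g x))"
    using assms
    by (intro smooth_on_add smooth_on_linear[of S f "\<lambda>a. (a, 0)"]
        smooth_on_linear[of S g "\<lambda>a. (0, a)"] bounded_linear_Pair
        bounded_linear_ident bounded_linear_zero)
  then show ?thesis by simp
qed

section \<open>Invariant inner products\<close>

lemma bilinear_expand_Basis:
  fixes b :: "'a::euclidean_space \<Rightarrow> 'a \<Rightarrow> real"
  assumes "bilinear b"
  shows "b x y = (\<Sum>i\<in>Basis. \<Sum>j\<in>Basis. (x \<bullet> i) * (y \<bullet> j) * b i j)"
proof -
  have "b x y = (\<Sum>i\<in>Basis. (x \<bullet> i) * b i y)"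
    using linear_expand_Basis[of "\<lambda>x. b x y" x] assms by (simp add: bilinear_def)
  also have "\<dots> = (\<Sum>i\<in>Basis. \<Sum>j\<in>Basis. (x \<bullet> i) * (y \<bullet> j) * b i j)"
    using linear_expand_Basis[of "b _" y] assms
    by (intro sum.cong refl) (simp add: bilinear_def sum_distrib_left mult.assoc)
  finally show ?thesis .
qed

definition form_sqnorm :: "('a::euclidean_space \<Rightarrow> 'a \<Rightarrow> real) \<Rightarrow> real" where
  "form_sqnorm b = (\<Sum>i\<in>Basis. \<Sum>j\<in>Basis. (b i j)\<^sup>2)"

lemma form_sqnorm_nonneg: "0 \<le> form_sqnorm b"
  unfolding form_sqnorm_def by (simp add: sum_nonneg)

lemma form_entry_le: "i \<in> Basis \<Longrightarrow> j \<in> Basis \<Longrightarrow> (b i j)\<^sup>2 \<le> form_sqnorm b"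
  unfolding form_sqnorm_def
  by (rule order_trans[OF member_le_sum[of j Basis "\<lambda>j. (b i j)\<^sup>2"]])
    (auto intro!: member_le_sum[of i Basis "\<lambda>i. \<Sum>j\<in>Basis. (b i j)\<^sup>2"] sum_nonneg)

lemma form_sqnorm_midpoint:
  "form_sqnorm (\<lambda>x y. (a x y + b x y) / 2)
    = form_sqnorm a / 2 + form_sqnorm b / 2 - form_sqnorm (\<lambda>x y. a x y - b x y) / 4"
proof -
  have "((r + s) / 2)\<^sup>2 = r\<^sup>2 / 2 + s\<^sup>2 / 2 - (r - s)\<^sup>2 / 4" for r s :: real
    by (simp add: power2_eq_square field_simps)
  then show ?thesis
    unfolding form_sqnorm_def
    by (simp add: sum.distrib sum_subtractf sum_divide_distrib)
qed

lemma form_sqnorm_pullback: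
  fixes b :: "'a::euclidean_space \<Rightarrow> 'a \<Rightarrow> real" and T :: "'a \<Rightarrow> 'a"
  assumes "bilinear b" "\<And>x. norm (T x) \<le> r * norm x"
  shows "form_sqnorm (\<lambda>x y. b (T x) (T y)) \<le> (real DIM('a))^6 * r^4 * form_sqnorm b"
proof -
  let ?s = "sqrt (form_sqnorm b)"
  let ?d = "real DIM('a)"
  have entry: "\<bar>b i j\<bar> \<le> ?s" if "i \<in> Basis" "j \<in> Basis" for i j
    using form_entry_le[OF that, of b] by (simp add: real_le_rsqrt)
  have r: "0 \<le> r"
  proof -
    obtain i :: 'a where "i \<in> Basis" using nonempty_Basis by blast
    then have "norm (T i) \<le> r" using assms(2)[of i] by simp
    then show ?thesis using norm_ge_zero order_trans by blast
  qed
  have "(b (T i) (T j))\<^sup>2 \<le> (?d * (?d * (r * r * ?s)))\<^sup>2" if ij: "i \<in> Basis" "j \<in> Basis" for i j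
  proof -
    have c: "\<bar>T i \<bullet> k\<bar> \<le> r" if "i \<in> Basis" "k \<in> Basis" for i k
      using assms(2)[of i] Basis_le_norm[OF that(2), of "T i"] that by simp
    have "\<bar>b (T i) (T j)\<bar> \<le> (\<Sum>k\<in>Basis. \<bar>\<Sum>l\<in>Basis. (T i \<bullet> k) * (T j \<bullet> l) * b k l\<bar>)"
      unfolding bilinear_expand_Basis[OF assms(1), of "T i" "T j"] by (rule sum_abs)
    also have "\<dots> \<le> (\<Sum>k\<in>(Basis::'a set). \<Sum>l\<in>(Basis::'a set). r * r * ?s)"
    proof (rule sum_mono)
      fix k :: 'a assume k: "k \<in> Basis"
      have "\<bar>\<Sum>l\<in>Basis. (T i \<bullet> k) * (T j \<bullet> l) * b k l\<bar> \<le> (\<Sum>l\<in>Basis. \<bar>(T i \<bullet> k) * (T j \<bullet> l) * b k l\<bar>)"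
        by (rule sum_abs)
      also have "\<dots> \<le> (\<Sum>l\<in>(Basis::'a set). r * r * ?s)"
        unfolding abs_mult using k ij r
        by (intro sum_mono mult_mono c entry) auto
      finally show "\<bar>\<Sum>l\<in>Basis. (T i \<bullet> k) * (T j \<bullet> l) * b k l\<bar> \<le> (\<Sum>l\<in>(Basis::'a set). r * r * ?s)" .
    qed
    also have "\<dots> = ?d * (?d * (r * r * ?s))" by simp
    finally show ?thesis by (rule abs_le_square_iff[THEN iffD1, OF order_trans[OF _ abs_ge_self]])
  qed
  then have "form_sqnorm (\<lambda>x y. b (T x) (T y)) \<le> (\<Sum>i\<in>(Basis::'a set). \<Sum>j\<in>(Basis::'a set). (?d * (?d * (r * r * ?s)))\<^sup>2)"
    unfolding form_sqnorm_def by (intro sum_mono) auto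
  also have "\<dots> = ?d^6 * r^4 * ?s\<^sup>2"
    by (simp add: power_mult_distrib power2_eq_square eval_nat_numeral)
  finally show ?thesis by (simp add: form_sqnorm_nonneg)
qed

text \<open>The invariant form is the minimiser, over all forms dominating \<open>e\<close>, of the supremum of the
  squared Hilbert-Schmidt norm over the orbit of the isometry group; that functional is uniformly
  convex, so minimising sequences converge and the minimiser is unique.\<close>

lemma invariant_inner_product:
  fixes e :: "'a::euclidean_space \<Rightarrow> real"
  assumes c: "0 < c" "\<And>x. c * (norm x)\<^sup>2 \<le> e x" and C: "\<And>x. e x \<le> C * (norm x)\<^sup>2"
  shows "\<exists>b :: 'a \<Rightarrow> 'a \<Rightarrow> real. bilinear b \<and> (\<forall>x y. b x y = b y x) \<and> (\<forall>x. x \<noteq> 0 \<longrightarrow> 0 < b x x) \<and>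
    (\<forall>T. linear T \<longrightarrow> (\<forall>x. e (T x) = e x) \<longrightarrow> (\<forall>x y. b (T x) (T y) = b x y))"
proof -
  define K where "K = {T. linear T \<and> (\<forall>x. e (T x) = e x)}"
  define r where "r = sqrt (C / c)"
  define \<kappa> where "\<kappa> = max 1 ((real DIM('a))^6 * r^4)"
  define N :: "('a \<Rightarrow> 'a \<Rightarrow> real) \<Rightarrow> real"
    where "N b = (SUP T\<in>K. form_sqnorm (\<lambda>x y. b (T x) (T y)))" for b
  define \<B> where "\<B> = {b. bilinear b \<and> (\<forall>x y. b x y = b y x) \<and> (\<forall>x. e x \<le> b x x)}"
  have \<kappa>: "0 < \<kappa>" by (simp add: \<kappa>_def)
  have idK: "(\<lambda>x. x) \<in> K" by (simp add: K_def linear_id[unfolded id_def])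
  have compK: "(\<lambda>x. T (U x)) \<in> K" if "T \<in> K" "U \<in> K" for T U
    using that linear_compose[of U T] by (auto simp: K_def o_def)
  have Kbound: "norm (T x) \<le> r * norm x" if "T \<in> K" for T x
  proof -
    have "c * (norm (T x))\<^sup>2 \<le> C * (norm x)\<^sup>2"
      using c(2)[of "T x"] C[of x] that by (simp add: K_def)
    then have "(norm (T x))\<^sup>2 \<le> (C / c) * (norm x)\<^sup>2"
      using c(1) by (simp add: field_simps)
    then have "norm (T x) \<le> r * sqrt ((norm x)\<^sup>2)"
      unfolding r_def real_sqrt_mult[symmetric] by (rule real_le_rsqrt)
    then show ?thesis by simp
  qed
  have pull: "form_sqnorm (\<lambda>x y. b (T x) (T y)) \<le> \<kappa> * form_sqnorm b" if "bilinear b" "T \<in> K" for b T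
  proof -
    have "form_sqnorm (\<lambda>x y. b (T x) (T y)) \<le> (real DIM('a))^6 * r^4 * form_sqnorm b"
      using form_sqnorm_pullback[OF that(1) Kbound[OF that(2)]] .
    also have "\<dots> \<le> \<kappa> * form_sqnorm b"
      unfolding \<kappa>_def by (intro mult_right_mono form_sqnorm_nonneg) simp
    finally show ?thesis .
  qed
  have bil_pull: "bilinear (\<lambda>x y. b (T x) (T y))" if "bilinear b" "T \<in> K" for b T
    using that linear_compose[of T "b _"] linear_compose[of T "\<lambda>x. b x _"]
    by (auto simp: bilinear_def K_def o_def)
  have invK: "\<exists>U\<in>K. \<forall>x. T (U x) = x" if T: "T \<in> K" for T
  proof -
    have "inj T"
    proof (rule linear_injective_0[THEN iffD2, rule_format])
      show "linear T" using T by (simp add: K_def)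
      fix x assume "T x = 0"
      moreover have "e (T x) = e x" using T by (simp add: K_def)
      ultimately have "c * (norm x)\<^sup>2 \<le> 0"
        using c(2)[of x] C[of "T x"] by simp
      then show "x = 0" using c(1) by (simp add: mult_le_0_iff)
    qed
    then obtain U where "linear U" "\<And>x. T (U x) = x"
      using linear_injective_isomorphism[of T] T by (auto simp: K_def)
    moreover from this have "U \<in> K" using T by (auto simp: K_def) metis
    ultimately show ?thesis by blast
  qed
  have pull_inv: "form_sqnorm b \<le> \<kappa> * form_sqnorm (\<lambda>x y. b (T x) (T y))"
    if b: "bilinear b" and T: "T \<in> K" for b T
  proof -
    obtain U where U: "U \<in> K" "\<And>x. T (U x) = x" using invK[OF T] by auto
    show ?thesis using pull[OF bil_pull[OF b T] U(1)] by (simp add: U(2))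
  qed
  have bdd: "bdd_above ((\<lambda>T. form_sqnorm (\<lambda>x y. b (T x) (T y))) ` K)" if "bilinear b" for b
    using pull[OF that] by (intro bdd_aboveI[of _ "\<kappa> * form_sqnorm b"]) auto
  have N_upper: "form_sqnorm (\<lambda>x y. b (T x) (T y)) \<le> N b" if "bilinear b" "T \<in> K" for b T
    unfolding N_def by (rule cSUP_upper[OF that(2) bdd[OF that(1)]])
  have N_least: "N b \<le> m" if "\<And>T. T \<in> K \<Longrightarrow> form_sqnorm (\<lambda>x y. b (T x) (T y)) \<le> m" for b m
    unfolding N_def using idK that by (intro cSUP_least) auto
  have N_nonneg: "0 \<le> N b" if "bilinear b" for b
    using N_upper[OF that idK] form_sqnorm_nonneg[of b] by simp
  have N_pull: "N (\<lambda>x y. b (T x) (T y)) \<le> N b" if "bilinear b" "T \<in> K" for b T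
    using N_upper[OF that(1) compK[OF that(2)]] by (rule N_least)
  define m where "m = Inf (N ` \<B>)"
  have m_le: "m \<le> N b" if "b \<in> \<B>" for b
    unfolding m_def using N_nonneg that
    by (intro cInf_lower bdd_belowI[of _ 0]) (auto simp: \<B>_def)
  have convex: "form_sqnorm (\<lambda>x y. a x y - b x y) \<le> 4 * \<kappa> * (N a / 2 + N b / 2 - m)"
    if "a \<in> \<B>" "b \<in> \<B>" for a b
  proof -
    have bil: "bilinear a" "bilinear b" using that by (auto simp: \<B>_def)
    have bil_m: "bilinear (\<lambda>x y. (a x y + b x y) / 2)" and bil_d: "bilinear (\<lambda>x y. a x y - b x y)"
      using bil by (auto simp: bilinear_def linear_iff algebra_simps add_divide_distrib)
    have "(\<lambda>x y. (a x y + b x y) / 2) \<in> \<B>"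
      using that bil_m by (auto simp: \<B>_def) (smt (verit) field_sum_of_halves)
    then have "m \<le> N (\<lambda>x y. (a x y + b x y) / 2)" by (rule m_le)
    also have "\<dots> \<le> N a / 2 + N b / 2 - form_sqnorm (\<lambda>x y. a x y - b x y) / (4 * \<kappa>)"
    proof (rule N_least)
      fix T assume T: "T \<in> K"
      have "form_sqnorm (\<lambda>x y. a x y - b x y) / \<kappa> \<le> form_sqnorm (\<lambda>x y. a (T x) (T y) - b (T x) (T y))"
        using pull_inv[OF bil_d T] \<kappa> by (simp add: field_simps)
      then show "form_sqnorm (\<lambda>x y. (a (T x) (T y) + b (T x) (T y)) / 2)
          \<le> N a / 2 + N b / 2 - form_sqnorm (\<lambda>x y. a x y - b x y) / (4 * \<kappa>)"
        unfolding form_sqnorm_midpoint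
        using N_upper[OF bil(1) T] N_upper[OF bil(2) T] by (simp add: field_simps)
    qed
    finally show ?thesis using \<kappa> by (simp add: field_simps)
  qed
  have "(\<lambda>x y. C * (x \<bullet> y)) \<in> \<B>"
    using C by (auto simp: \<B>_def bilinear_def linear_iff algebra_simps inner_commute
        power2_norm_eq_inner)
  then have "\<B> \<noteq> {}" by blast
  have "\<exists>b\<in>\<B>. N b < m + inverse (Suc k)" for k
  proof -
    have "Inf (N ` \<B>) < m + inverse (Suc k)" by (simp add: m_def)
    then show ?thesis using \<open>\<B> \<noteq> {}\<close> N_nonneg
      by (subst (asm) cInf_less_iff) (auto simp: \<B>_def intro!: bdd_belowI[of _ 0])
  qed
  then obtain B where B: "\<And>k. B k \<in> \<B>" "\<And>k. N (B k) < m + inverse (Suc k)" by metis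
  then have Bbil: "bilinear (B k)" for k by (auto simp: \<B>_def)
  have "convergent (\<lambda>k. B k i j)" if ij: "i \<in> Basis" "j \<in> Basis" for i j
  proof -
    have "Cauchy (\<lambda>k. B k i j)"
    proof (rule CauchyI)
      fix \<epsilon> :: real assume \<epsilon>: "0 < \<epsilon>"
      then have "0 < \<epsilon>\<^sup>2 / (4 * \<kappa>)" using \<kappa> by simp
      then obtain M where M: "inverse (real (Suc M)) < \<epsilon>\<^sup>2 / (4 * \<kappa>)"
        using reals_Archimedean by blast
      have "norm (B k i j - B l i j) < \<epsilon>" if "M \<le> k" "M \<le> l" for k l
      proof -
        have "inverse (real (Suc k)) \<le> inverse (real (Suc M))" "inverse (real (Suc l)) \<le> inverse (real (Suc M))"
          using that by (simp_all add: le_imp_inverse_le)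
        then have *: "N (B k) / 2 + N (B l) / 2 - m < \<epsilon>\<^sup>2 / (4 * \<kappa>)"
          using B(2)[of k] B(2)[of l] M by argo
        have "(B k i j - B l i j)\<^sup>2 \<le> form_sqnorm (\<lambda>x y. B k x y - B l x y)"
          using form_entry_le[OF ij, of "\<lambda>x y. B k x y - B l x y"] by simp
        also have "\<dots> \<le> 4 * \<kappa> * (N (B k) / 2 + N (B l) / 2 - m)" using convex B(1) by blast
        also have "\<dots> < \<epsilon>\<^sup>2" using * \<kappa> by (simp add: field_simps)
        finally have "(\<bar>B k i j - B l i j\<bar>)\<^sup>2 < \<epsilon>\<^sup>2" by simp
        from power2_less_imp_less[OF this] show ?thesis using \<epsilon> by simp
      qed
      then show "\<exists>M. \<forall>k\<ge>M. \<forall>l\<ge>M. norm (B k i j - B l i j) < \<epsilon>" by blast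
    qed
    then show ?thesis by (rule Cauchy_convergent)
  qed
  then obtain a where a: "\<And>i j. i \<in> Basis \<Longrightarrow> j \<in> Basis \<Longrightarrow> (\<lambda>k. B k i j) \<longlonglongrightarrow> a i j"
    unfolding convergent_def by metis
  define b where "b x y = (\<Sum>i\<in>Basis. \<Sum>j\<in>Basis. (x \<bullet> i) * (y \<bullet> j) * a i j)" for x y
  have lim: "(\<lambda>k. B k x y) \<longlonglongrightarrow> b x y" for x y
  proof -
    have "(\<lambda>k. \<Sum>i\<in>Basis. \<Sum>j\<in>Basis. (x \<bullet> i) * (y \<bullet> j) * B k i j) \<longlonglongrightarrow> b x y"
      unfolding b_def by (intro tendsto_intros a)
    moreover have "B k x y = (\<Sum>i\<in>Basis. \<Sum>j\<in>Basis. (x \<bullet> i) * (y \<bullet> j) * B k i j)" for k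
      by (rule bilinear_expand_Basis[OF Bbil])
    ultimately show ?thesis by presburger
  qed
  have bil: "bilinear b"
    unfolding bilinear_def linear_iff b_def
    by (simp add: inner_add_left algebra_simps sum.distrib sum_distrib_left)
  have sym: "b x y = b y x" for x y
    using lim[of x y] lim[of y x] B(1) by (intro LIMSEQ_unique) (auto simp: \<B>_def)
  have dom: "e x \<le> b x x" for x
    using lim[of x x] B(1) by (intro LIMSEQ_le_const) (auto simp: \<B>_def)
  have b: "b \<in> \<B>" using bil sym dom by (auto simp: \<B>_def)
  have "N b \<le> m"
  proof (rule N_least)
    fix T assume T: "T \<in> K"
    have "(\<lambda>k. form_sqnorm (\<lambda>x y. B k (T x) (T y))) \<longlonglongrightarrow> form_sqnorm (\<lambda>x y. b (T x) (T y))"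
      unfolding form_sqnorm_def by (intro tendsto_intros lim)
    moreover have "(\<lambda>k. m + inverse (real (Suc k))) \<longlonglongrightarrow> m + 0"
      by (intro tendsto_intros LIMSEQ_inverse_real_of_nat)
    moreover have "form_sqnorm (\<lambda>x y. B k (T x) (T y)) \<le> m + inverse (real (Suc k))" for k
      using N_upper[OF Bbil T, of k] B(2)[of k] by linarith
    ultimately show "form_sqnorm (\<lambda>x y. b (T x) (T y)) \<le> m"
      using LIMSEQ_le by fastforce
  qed
  show ?thesis
  proof (intro exI[of _ b] conjI allI impI)
    show "bilinear b" by (rule bil)
    show "b x y = b y x" for x y by (rule sym)
    show "0 < b x x" if "x \<noteq> 0" for x
    proof -
      have "0 < c * (norm x)\<^sup>2" using c(1) that by simp
      then show ?thesis using c(2)[of x] dom[of x] by linarith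
    qed
    fix T x y assume "linear T" "\<forall>x. e (T x) = e x"
    then have T: "T \<in> K" by (auto simp: K_def)
    have bT: "(\<lambda>x y. b (T x) (T y)) \<in> \<B>"
      using bil_pull[OF bil T] sym dom T by (auto simp: \<B>_def K_def) metis
    have "N (\<lambda>x y. b (T x) (T y)) \<le> m" using N_pull[OF bil T] \<open>N b \<le> m\<close> by simp
    then have "N b / 2 + N (\<lambda>x y. b (T x) (T y)) / 2 - m \<le> 0" using \<open>N b \<le> m\<close> by simp
    then have "form_sqnorm (\<lambda>x y. b x y - b (T x) (T y)) \<le> 0"
      by (intro order_trans[OF convex[OF b bT]] mult_nonneg_nonpos) (use \<kappa> in auto)
    then have "b i j = b (T i) (T j)" if "i \<in> Basis" "j \<in> Basis" for i j
      using order_trans[OF form_entry_le[OF that, of "\<lambda>x y. b x y - b (T x) (T y)"]] by fastforce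
    moreover have "b (T x) (T y) = (\<Sum>i\<in>Basis. \<Sum>j\<in>Basis. (x \<bullet> i) * (y \<bullet> j) * b (T i) (T j))"
      by (rule bilinear_expand_Basis[OF bil_pull[OF bil T]])
    moreover have "b x y = (\<Sum>i\<in>Basis. \<Sum>j\<in>Basis. (x \<bullet> i) * (y \<bullet> j) * b i j)"
      by (rule bilinear_expand_Basis[OF bil])
    ultimately show "b (T x) (T y) = b x y" by simp
  qed
qed

lemma linear_flow:
  fixes D :: "'a::euclidean_space \<Rightarrow> 'a"
  assumes D: "linear D"
  obtains T where "\<And>s. linear (T s)" "\<And>x. T (0::real) x = x"
    "\<And>s x. ((\<lambda>s. T s x) has_vector_derivative D (T s x)) (at s)"
proof -
  define T where "T s x = (\<Sum>n. (s ^ n / fact n) *\<^sub>R (D ^^ n) x)" for s x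
  have blD: "bounded_linear D" using D by (simp add: linear_conv_bounded_linear)
  obtain B where B: "0 < B" "\<And>x. norm (D x) \<le> B * norm x"
    using linear_bounded_pos[OF D] by blast
  have power_bound: "norm ((D ^^ n) x) \<le> B ^ n * norm x" for n x
  proof (induction n)
    case (Suc n)
    have "norm ((D ^^ Suc n) x) \<le> B * norm ((D ^^ n) x)" using B(2) by simp
    also have "\<dots> \<le> B * (B ^ n * norm x)" using Suc B(1) by (intro mult_left_mono) auto
    finally show ?case by (simp add: mult.assoc)
  qed simp
  have summable: "summable (\<lambda>n. (s ^ n / fact n) *\<^sub>R (D ^^ n) x)" for s x
  proof (rule summable_comparison_test')
    have "summable (\<lambda>n. inverse (fact n) * (\<bar>s\<bar> * B) ^ n)" by (rule summable_exp)
    from summable_mult2[OF this] show "summable (\<lambda>n. inverse (fact n) * (\<bar>s\<bar> * B) ^ n * norm x)" .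
    fix n :: nat
    have "norm ((s ^ n / fact n) *\<^sub>R (D ^^ n) x) = \<bar>s\<bar> ^ n / fact n * norm ((D ^^ n) x)"
      by (simp add: power_abs)
    also have "\<dots> \<le> \<bar>s\<bar> ^ n / fact n * (B ^ n * norm x)"
      by (intro mult_left_mono power_bound) simp
    also have "\<dots> = inverse (fact n) * (\<bar>s\<bar> * B) ^ n * norm x"
      by (simp add: power_mult_distrib field_simps)
    finally show "norm ((s ^ n / fact n) *\<^sub>R (D ^^ n) x) \<le> inverse (fact n) * (\<bar>s\<bar> * B) ^ n * norm x" .
  qed
  have linear_power: "linear (D ^^ n)" for n
  proof (induction n)
    case (Suc n)
    then show ?case using linear_compose[OF Suc D] by (simp add: o_def)
  qed (simp add: linear_id[unfolded id_def] id_def)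
  have "linear (T s)" for s
  proof (rule linearI)
    show "T s (x + y) = T s x + T s y" for x y
      unfolding T_def suminf_add[OF summable summable]
      by (simp add: linear_add[OF linear_power] scaleR_add_right)
    show "T s (q *\<^sub>R x) = q *\<^sub>R T s x" for q x
      unfolding T_def suminf_scaleR_right[OF summable]
      by (simp add: linear_scale[OF linear_power] mult.commute)
  qed
  moreover have "T 0 x = x" for x
  proof -
    have "T 0 x = (\<Sum>n\<in>{0}. ((0::real) ^ n / fact n) *\<^sub>R (D ^^ n) x)"
      unfolding T_def by (rule suminf_finite) auto
    then show ?thesis by simp
  qed
  moreover have "((\<lambda>s. T s x) has_vector_derivative D (T s x)) (at s)" for s x
    unfolding has_vector_derivative_def
  proof (subst has_derivative_componentwise_within, intro ballI)
    fix i :: 'a assume "i \<in> Basis"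
    define c where "c n = ((D ^^ n) x \<bullet> i) / fact n" for n
    have comp: "T s y \<bullet> i = (\<Sum>n. ((D ^^ n) y \<bullet> i) / fact n * s ^ n)" for s y
      unfolding T_def bounded_linear.suminf[OF bounded_linear_inner_left summable]
      by (simp add: mult.commute)
    have "summable (\<lambda>n. c n * y ^ n)" for y
      using bounded_linear.summable[OF bounded_linear_inner_left[of i] summable[of y x]]
      by (simp add: c_def mult.commute)
    from termdiffs_strong_converges_everywhere[OF this]
    have "((\<lambda>s. \<Sum>n. c n * s ^ n) has_field_derivative (\<Sum>n. diffs c n * s ^ n)) (at s)" .
    moreover have "diffs c n = ((D ^^ n) (D x) \<bullet> i) / fact n" for n
      unfolding diffs_def c_def funpow_Suc_right fact_Suc by simp
    moreover have "T s (D x) = D (T s x)"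
      unfolding T_def bounded_linear.suminf[OF blD summable]
      by (simp add: linear_scale[OF D] funpow_swap1)
    ultimately have "((\<lambda>s. T s x \<bullet> i) has_field_derivative D (T s x) \<bullet> i) (at s)"
      unfolding comp by (metis (no_types, lifting) c_def comp suminf_cong ext)
    then show "((\<lambda>s. T s x \<bullet> i) has_derivative (\<lambda>h. (h *\<^sub>R D (T s x)) \<bullet> i)) (at s)"
      unfolding has_field_derivative_def
      by (rule has_derivative_eq_rhs) (simp add: fun_eq_iff mult.commute)
  qed
  ultimately show thesis by (rule that)
qed

lemma infinitesimally_invariant_inner_product:
  fixes e :: "'a::euclidean_space \<Rightarrow> real"
  assumes c: "0 < c" "\<And>x. c * (norm x)\<^sup>2 \<le> e x" and C: "\<And>x. e x \<le> C * (norm x)\<^sup>2"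
    and e': "\<And>x. x \<noteq> 0 \<Longrightarrow> (e has_derivative e' x) (at x)"
  shows "\<exists>b :: 'a \<Rightarrow> 'a \<Rightarrow> real. bilinear b \<and> (\<forall>x y. b x y = b y x) \<and> (\<forall>x. x \<noteq> 0 \<longrightarrow> 0 < b x x) \<and>
    (\<forall>D. linear D \<longrightarrow> (\<forall>x. x \<noteq> 0 \<longrightarrow> e' x (D x) = 0) \<longrightarrow> (\<forall>x. b x (D x) = 0))"
proof -
  obtain b :: "'a \<Rightarrow> 'a \<Rightarrow> real" where b: "bilinear b" "\<And>x y. b x y = b y x" "\<And>x. x \<noteq> 0 \<Longrightarrow> 0 < b x x"
    and inv: "\<forall>T. linear T \<longrightarrow> (\<forall>x. e (T x) = e x) \<longrightarrow> (\<forall>x y. b (T x) (T y) = b x y)"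
    using invariant_inner_product[OF c C] by metis
  have e0: "(e has_derivative (\<lambda>h. 0)) (at 0)"
  proof -
    have "e 0 = 0" using c(2)[of 0] C[of 0] by simp
    have nonneg: "0 \<le> e h" for h
      using c(2)[of h] c(1) by (meson mult_nonneg_nonneg less_imp_le order_trans zero_le_power2)
    have "(\<lambda>h. e h / norm h) \<midarrow>0\<rightarrow> 0"
    proof (rule tendsto_sandwich[of "\<lambda>h. 0" _ _ "\<lambda>h. C * norm h"])
      show "\<forall>\<^sub>F h in at 0. 0 \<le> e h / norm h" by (simp add: nonneg)
      show "\<forall>\<^sub>F h in at 0. e h / norm h \<le> C * norm h"
      proof (rule always_eventually, rule allI)
        fix h
        show "e h / norm h \<le> C * norm h"
          using C[of h] by (cases "h = 0") (simp_all add: field_simps power2_eq_square)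
      qed
      show "((\<lambda>h. C * norm (h::'a)) \<longlongrightarrow> 0) (at 0)" by (auto intro!: tendsto_eq_intros)
    qed simp
    then show ?thesis
      unfolding has_derivative_at using \<open>e 0 = 0\<close> nonneg by (simp add: bounded_linear_zero)
  qed
  show ?thesis
  proof (intro exI[of _ b] conjI allI impI)
    show "bilinear b" by (fact b)
    show "b x y = b y x" for x y by (fact b)
    show "0 < b x x" if "x \<noteq> 0" for x using that by (fact b)
    fix D :: "'a \<Rightarrow> 'a" and x
    assume D: "linear D" and van0: "\<forall>x. x \<noteq> 0 \<longrightarrow> e' x (D x) = 0"
    have van: "e' x (D x) = 0" if "x \<noteq> 0" for x using van0 that by blast
    obtain T where T: "\<And>s. linear (T s)" "\<And>x. T (0::real) x = x"
      "\<And>s x. ((\<lambda>s. T s x) has_vector_derivative D (T s x)) (at s)"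
      using linear_flow[OF D] by blast
    have deriv0: "((\<lambda>s. e (T s y)) has_derivative (\<lambda>h. 0)) (at s)" for s y
    proof -
      have "(e has_derivative (if T s y = 0 then (\<lambda>h. 0) else e' (T s y))) (at (T s y))"
        using e0 e' by simp
      from has_derivative_compose[OF T(3)[unfolded has_vector_derivative_def] this]
      have "((\<lambda>s. e (T s y)) has_derivative
          (\<lambda>h. (if T s y = 0 then (\<lambda>h. 0) else e' (T s y)) (h *\<^sub>R D (T s y)))) (at s)" .
      moreover have "e' (T s y) (h *\<^sub>R D (T s y)) = 0" if "T s y \<noteq> 0" for h
        using linear_scale[OF has_derivative_linear[OF e'[OF that]]] van[OF that] by simp
      ultimately show ?thesis by (auto split: if_splits)
    qed
    have "e (T s y) = e y" for s y
      using has_derivative_zero_constant[of UNIV "\<lambda>s. e (T s y)"] deriv0 T(2) by (metis UNIV_I convex_UNIV)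
    then have "b (T s x) (T s x) = b x x" for s using inv T(1) by blast
    moreover have "((\<lambda>s. b (T s x) (T s x)) has_vector_derivative
        (b (T 0 x) (D (T 0 x)) + b (D (T 0 x)) (T 0 x))) (at 0)"
      using bounded_bilinear.has_vector_derivative[OF _ T(3) T(3)] b(1)
      by (simp add: bilinear_conv_bounded_bilinear)
    ultimately have "b x (D x) + b (D x) x = 0"
      using T(2) vector_derivative_at[of _ _ "0::real"] by (metis (no_types, lifting) ext vector_derivative_const_at)
    then show "b x (D x) = 0" using b(2)[of x "D x"] by simp
  qed
qed

section \<open>The Euler-Lagrange equations in a moving coframe\<close>

locale coframe =
  fixes U :: "'e::euclidean_space set" and N :: "'e \<times> 'e \<Rightarrow> 'e"
  assumes open_U: "open U"
    and differentiable_N: "x \<in> U \<Longrightarrow> N differentiable (at (x, y))"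
    and linear_N: "x \<in> U \<Longrightarrow> linear (\<lambda>y. N (x, y))"
begin

definition exterior :: "'e \<Rightarrow> 'e \<Rightarrow> 'e \<Rightarrow> 'e" where
  "exterior x w y = frechet_derivative N (at (x, y)) (w, 0) - frechet_derivative N (at (x, w)) (y, 0)"

lemma has_derivative_N:
  "x \<in> U \<Longrightarrow> (N has_derivative frechet_derivative N (at (x, y))) (at (x, y))"
  using differentiable_N by (rule has_derivative_frechet)

lemma linear_derivative_N: "x \<in> U \<Longrightarrow> linear (frechet_derivative N (at (x, y)))"
  using differentiable_N by (rule linear_frechet_derivative)

lemma derivative_N_vertical:
  assumes "x \<in> U"
  shows "frechet_derivative N (at (x, y)) (0, k) = N (x, k)"
proof -
  have "((\<lambda>y. (x, y)) has_derivative (\<lambda>k. (0, k))) (at y)"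
    by (intro has_derivative_Pair has_derivative_const has_derivative_ident)
  from has_derivative_compose[OF this has_derivative_N[OF assms]]
  have "((\<lambda>y. N (x, y)) has_derivative (\<lambda>k. frechet_derivative N (at (x, y)) (0, k))) (at y)" .
  moreover have "((\<lambda>y. N (x, y)) has_derivative (\<lambda>k. N (x, k))) (at y)"
    using linear_N[OF assms] by (simp add: linear_conv_bounded_linear bounded_linear_imp_has_derivative)
  ultimately show ?thesis by (metis has_derivative_unique)
qed

lemma has_derivative_N_horizontal:
  assumes "x \<in> U"
  shows "((\<lambda>x. N (x, w)) has_derivative (\<lambda>h. frechet_derivative N (at (x, w)) (h, 0))) (at x)"
proof -
  have "((\<lambda>x. (x, w)) has_derivative (\<lambda>h. (h, 0))) (at x)"
    by (intro has_derivative_Pair has_derivative_const has_derivative_ident)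
  from has_derivative_compose[OF this has_derivative_N[OF assms]] show ?thesis .
qed

lemma linear_derivative_N_horizontal:
  assumes "x \<in> U"
  shows "linear (\<lambda>w. frechet_derivative N (at (x, w)) (h, 0))"
proof (rule linearI)
  fix v w
  have "((\<lambda>x. N (x, v) + N (x, w)) has_derivative
      (\<lambda>h. frechet_derivative N (at (x, v)) (h, 0) + frechet_derivative N (at (x, w)) (h, 0))) (at x)"
    using assms by (intro has_derivative_add has_derivative_N_horizontal)
  then have "((\<lambda>x. N (x, v + w)) has_derivative
      (\<lambda>h. frechet_derivative N (at (x, v)) (h, 0) + frechet_derivative N (at (x, w)) (h, 0))) (at x)"
    using open_U assms
    by (rule has_derivative_transform_within_open) (simp add: linear_add[OF linear_N])
  from has_derivative_unique[OF this has_derivative_N_horizontal[OF assms]]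
  show "frechet_derivative N (at (x, v + w)) (h, 0)
      = frechet_derivative N (at (x, v)) (h, 0) + frechet_derivative N (at (x, w)) (h, 0)"
    by metis
next
  fix r w
  have "((\<lambda>x. r *\<^sub>R N (x, w)) has_derivative
      (\<lambda>h. r *\<^sub>R frechet_derivative N (at (x, w)) (h, 0))) (at x)"
    using assms by (intro has_derivative_scaleR_right has_derivative_N_horizontal)
  then have "((\<lambda>x. N (x, r *\<^sub>R w)) has_derivative
      (\<lambda>h. r *\<^sub>R frechet_derivative N (at (x, w)) (h, 0))) (at x)"
    using open_U assms
    by (rule has_derivative_transform_within_open) (simp add: linear_scale[OF linear_N])
  from has_derivative_unique[OF this has_derivative_N_horizontal[OF assms]]
  show "frechet_derivative N (at (x, r *\<^sub>R w)) (h, 0) = r *\<^sub>R frechet_derivative N (at (x, w)) (h, 0)"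
    by metis
qed

lemma linear_derivative_N_left: "x \<in> U \<Longrightarrow> linear (\<lambda>w. frechet_derivative N (at (x, y)) (w, 0))"
  using linear_compose[of "\<lambda>w. (w, 0)" "frechet_derivative N (at (x, y))"] linear_derivative_N
  by (auto simp: o_def linear_iff)

lemma linear_exterior_left: "x \<in> U \<Longrightarrow> linear (\<lambda>w. exterior x w y)"
  unfolding exterior_def
  by (intro linear_compose_sub linear_derivative_N_left linear_derivative_N_horizontal)

lemma linear_exterior_right: "x \<in> U \<Longrightarrow> linear (exterior x w)"
  unfolding exterior_def[abs_def]
  by (intro linear_compose_sub linear_derivative_N_left linear_derivative_N_horizontal)

lemma exterior_self: "exterior x y y = 0"
  by (simp add: exterior_def)

lemma euler_lagrange_iff:
  assumes e: "\<And>X. X \<noteq> 0 \<Longrightarrow> (e has_derivative e' X) (at X)"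
    and e': "\<And>X v. X \<noteq> 0 \<Longrightarrow> (\<lambda>X. e' X v) differentiable (at X)"
    and L: "\<And>x y. x \<in> U \<Longrightarrow> L (x, y) = e (N (x, y))"
    and I: "open I" "t \<in> I"
    and x: "\<And>s. s \<in> I \<Longrightarrow> x s \<in> U" "(x has_vector_derivative x' t) (at t)"
    and x': "(x' has_vector_derivative x'') (at t)"
    and nz: "\<And>s. s \<in> I \<Longrightarrow> N (x s, x' s) \<noteq> 0"
  shows "(\<forall>i\<in>Basis. ((\<lambda>s. partial_y i L (x s, x' s)) has_real_derivative
            partial_x i L (x t, x' t)) (at t)) \<longleftrightarrow>
         (\<forall>w. ((\<lambda>s. e' (N (x s, x' s)) (N (x t, w))) has_real_derivative
            e' (N (x t, x' t)) (exterior (x t) w (x' t))) (at t))"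
proof -
  let ?X = "\<lambda>s. N (x s, x' s)"
  define m where "m v = deriv (\<lambda>s. e' (?X s) v) t" for v
  have dL: "(L has_derivative (\<lambda>h. e' (N (x, y)) (frechet_derivative N (at (x, y)) h))) (at (x, y))"
    if "x \<in> U" "N (x, y) \<noteq> 0" for x y
  proof -
    have "((\<lambda>z. e (N z)) has_derivative (\<lambda>h. e' (N (x, y)) (frechet_derivative N (at (x, y)) h))) (at (x, y))"
      by (rule has_derivative_compose[OF has_derivative_N e]) (use that in auto)
    then show ?thesis
      by (rule has_derivative_transform_within_open[where s = "U \<times> UNIV"])
        (use that L open_U in \<open>auto intro: open_Times\<close>)
  qed
  have partial_x: "partial_x i L (x, y) = e' (N (x, y)) (frechet_derivative N (at (x, y)) (i, 0))"
    and partial_y: "partial_y i L (x, y) = e' (N (x, y)) (N (x, i))"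
    if "x \<in> U" "N (x, y) \<noteq> 0" for x y i
    unfolding partial_x_def partial_y_def frechet_derivative_at[OF dL[OF that], symmetric]
    using that(1) by (simp_all add: derivative_N_vertical)
  have lin_e': "linear (e' X)" if "X \<noteq> 0" for X
    using e[OF that] by (rule has_derivative_linear)
  have xt: "x t \<in> U" and nzt: "?X t \<noteq> 0" using x(1) nz I by auto
  have "((\<lambda>s. (x s, x' s)) has_derivative (\<lambda>r. (r *\<^sub>R x' t, r *\<^sub>R x''))) (at t)"
    using x(2) x' unfolding has_vector_derivative_def by (rule has_derivative_Pair)
  from has_derivative_compose[OF this has_derivative_N[OF xt]]
  have "?X differentiable (at t)" by (auto simp: differentiable_def)
  then have "(\<lambda>s. e' (?X s) v) differentiable (at t)" for v
    using differentiable_chain_at[of ?X t "\<lambda>X. e' X v", OF _ e'[OF nzt]] by (simp add: o_def)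
  then have m: "((\<lambda>s. e' (?X s) v) has_real_derivative m v) (at t)" for v
    unfolding m_def by (simp add: DERIV_deriv_iff_real_differentiable)
  have expand: "e' (?X s) v = (\<Sum>k\<in>Basis. (v \<bullet> k) * e' (?X s) k)" if "s \<in> I" for s v
    using linear_expand_Basis[OF lin_e'[OF nz[OF that]], of v] by simp
  have product: "((\<lambda>s. e' (?X s) (Y s)) has_real_derivative
      (\<Sum>k\<in>Basis. (Y t \<bullet> k) * m k) + e' (?X t) Y') (at t)"
    if "(Y has_vector_derivative Y') (at t)" for Y Y'
  proof -
    have "((\<lambda>s. Y s \<bullet> k) has_real_derivative Y' \<bullet> k) (at t)" for k
      using bounded_linear.has_vector_derivative[OF bounded_linear_inner_left that]
      by (simp add: has_real_derivative_iff_has_vector_derivative)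
    then have "((\<lambda>s. \<Sum>k\<in>Basis. (Y s \<bullet> k) * e' (?X s) k) has_real_derivative
        (\<Sum>k\<in>Basis. (Y' \<bullet> k) * e' (?X t) k + m k * (Y t \<bullet> k))) (at t)"
      by (intro DERIV_sum DERIV_mult m)
    moreover have "(\<Sum>k\<in>Basis. (Y' \<bullet> k) * e' (?X t) k + m k * (Y t \<bullet> k))
        = (\<Sum>k\<in>Basis. (Y t \<bullet> k) * m k) + e' (?X t) Y'"
      unfolding expand[OF I(2), of Y'] by (simp add: sum.distrib mult.commute)
    ultimately have *: "((\<lambda>s. \<Sum>k\<in>Basis. (Y s \<bullet> k) * e' (?X s) k) has_real_derivative
        (\<Sum>k\<in>Basis. (Y t \<bullet> k) * m k) + e' (?X t) Y') (at t)" by simp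
    show ?thesis
      by (rule has_field_derivative_transform_within_open[OF * I(1) I(2)]) (simp add: expand[symmetric])
  qed
  have m_sum: "(\<Sum>k\<in>Basis. (v \<bullet> k) * m k) = m v" for v
  proof -
    have "((\<lambda>s. e' (?X s) v) has_real_derivative (\<Sum>k\<in>Basis. (v \<bullet> k) * m k)) (at t)"
      using product[OF has_vector_derivative_const, of v] by (simp add: linear_0[OF lin_e'[OF nzt]])
    then show ?thesis using m by (rule DERIV_unique)
  qed
  have lin_m: "linear m"
  proof (rule linearI)
    show "m (v + w) = m v + m w" for v w
      using m_sum[of v] m_sum[of w] m_sum[of "v + w"]
      by (simp add: inner_add_left distrib_right sum.distrib)
    show "m (r *\<^sub>R v) = r *\<^sub>R m v" for r v
      using m_sum[of v] m_sum[of "r *\<^sub>R v"]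
      by (simp add: mult.assoc sum_distrib_left[symmetric])
  qed
  have momentum: "((\<lambda>s. partial_y i L (x s, x' s)) has_real_derivative
      m (N (x t, i)) + e' (?X t) (frechet_derivative N (at (x t, i)) (x' t, 0))) (at t)" for i
  proof -
    have "((\<lambda>s. N (x s, i)) has_vector_derivative frechet_derivative N (at (x t, i)) (x' t, 0)) (at t)"
      using has_derivative_compose[OF x(2)[unfolded has_vector_derivative_def]
          has_derivative_N_horizontal[OF xt, of i]]
      unfolding has_vector_derivative_def
      by (rule has_derivative_eq_rhs)
        (use linear_scale[OF linear_derivative_N_left[OF xt, of i], of _ "x' t"] in auto)
    from product[OF this]
    have *: "((\<lambda>s. e' (?X s) (N (x s, i))) has_real_derivative
      m (N (x t, i)) + e' (?X t) (frechet_derivative N (at (x t, i)) (x' t, 0))) (at t)"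
      by (simp add: m_sum)
    show ?thesis
      by (rule has_field_derivative_transform_within_open[OF * I(1) I(2)])
        (simp add: partial_y[OF x(1) nz])
  qed
  have deriv_iff: "(f has_real_derivative b) (at t) \<longleftrightarrow> a = b"
    if "(f has_real_derivative a) (at t)" for f a b
  proof
    show "a = b" if "(f has_real_derivative b) (at t)"
      using \<open>(f has_real_derivative a) (at t)\<close> that by (rule DERIV_unique)
    show "(f has_real_derivative b) (at t)" if "a = b"
      using \<open>(f has_real_derivative a) (at t)\<close> unfolding that .
  qed
  have lin_lhs: "linear (\<lambda>w. m (N (x t, w)))"
    using linear_compose[OF linear_N[OF xt] lin_m] by (simp add: o_def)
  have lin_rhs: "linear (\<lambda>w. e' (?X t) (exterior (x t) w (x' t)))"
    using linear_compose[OF linear_exterior_left[OF xt] lin_e'[OF nzt]] by (simp add: o_def)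
  have "(\<forall>i\<in>Basis. ((\<lambda>s. partial_y i L (x s, x' s)) has_real_derivative
            partial_x i L (x t, x' t)) (at t)) \<longleftrightarrow>
        (\<forall>i\<in>Basis. m (N (x t, i)) = e' (?X t) (exterior (x t) i (x' t)))"
  proof (rule ball_cong[OF refl])
    fix i :: 'e
    have "((\<lambda>s. partial_y i L (x s, x' s)) has_real_derivative partial_x i L (x t, x' t)) (at t)
        \<longleftrightarrow> m (N (x t, i)) + e' (?X t) (frechet_derivative N (at (x t, i)) (x' t, 0))
          = partial_x i L (x t, x' t)"
      by (rule deriv_iff[OF momentum])
    then show "((\<lambda>s. partial_y i L (x s, x' s)) has_real_derivative partial_x i L (x t, x' t)) (at t)
        \<longleftrightarrow> m (N (x t, i)) = e' (?X t) (exterior (x t) i (x' t))"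
      unfolding partial_x[OF xt nzt] exterior_def linear_diff[OF lin_e'[OF nzt]] by linarith
  qed
  also have "\<dots> \<longleftrightarrow> (\<forall>w. m (N (x t, w)) = e' (?X t) (exterior (x t) w (x' t)))"
    using linear_eq_stdbasis[OF lin_lhs lin_rhs] by (auto dest: fun_cong)
  also have "\<dots> \<longleftrightarrow> (\<forall>w. ((\<lambda>s. e' (?X s) (N (x t, w))) has_real_derivative
            e' (?X t) (exterior (x t) w (x' t))) (at t))"
  proof (rule all_cong1)
    fix w
    show "m (N (x t, w)) = e' (?X t) (exterior (x t) w (x' t)) \<longleftrightarrow>
      ((\<lambda>s. e' (?X s) (N (x t, w))) has_real_derivative e' (?X t) (exterior (x t) w (x' t))) (at t)"
      by (rule deriv_iff[OF m, symmetric])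
  qed
  finally show ?thesis .
qed

end

section \<open>Charts and Jacobians\<close>

definition jac ::
    "('p \<Rightarrow> 'q) \<Rightarrow> ('p, 'e::real_normed_vector) chart \<Rightarrow> ('q, 'f::real_normed_vector) chart \<Rightarrow> 'p \<Rightarrow> 'e \<Rightarrow> 'f" where
  "jac F c d p = frechet_derivative (snd d \<circ> F \<circ> chart_inv c) (at (snd c p))"

lemma chart_image_inverse:
  "x \<in> chart_image c \<Longrightarrow> chart_inv c x \<in> fst c \<and> snd c (chart_inv c x) = x"
  unfolding chart_image_def chart_inv_def by (simp add: f_inv_into_f inv_into_into)

lemma smooth_map_derivative:
  assumes "smooth_map X A Y B F" "c \<in> A" "d \<in> B" "p \<in> fst c" "F p \<in> fst d"
  shows "((snd d \<circ> F \<circ> chart_inv c) has_derivative jac F c d p) (at (snd c p))"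
  unfolding jac_def using assms
  by (intro smooth_on_has_derivative[of "snd c ` {p \<in> fst c. F p \<in> fst d}"]) (auto simp: smooth_map_def)

context smooth_manifold
begin

lemma chart_inv_eq [simp]: "c \<in> A \<Longrightarrow> p \<in> fst c \<Longrightarrow> chart_inv c (snd c p) = p"
  unfolding chart_inv_def
  using chart_homeomorphic[of c] chart_domain[of c] openin_subset[of X "fst c"]
  by (intro inv_into_f_f)
    (auto simp: homeomorphic_imp_injective_map topspace_subtopology inf_absorb2
      dest!: homeomorphic_imp_injective_map)

lemma chart_inv_in: "x \<in> chart_image c \<Longrightarrow> chart_inv c x \<in> fst c"
  by (simp add: chart_image_inverse)

lemma chart_of_inv: "x \<in> chart_image c \<Longrightarrow> snd c (chart_inv c x) = x"
  by (simp add: chart_image_inverse)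

lemma chart_in_image: "p \<in> fst c \<Longrightarrow> snd c p \<in> chart_image c"
  by (simp add: chart_image_def)

lemma chart_inj: "c \<in> A \<Longrightarrow> p \<in> fst c \<Longrightarrow> q \<in> fst c \<Longrightarrow> snd c p = snd c q \<Longrightarrow> p = q"
  by (metis chart_inv_eq)

lemma chart_subset: "c \<in> A \<Longrightarrow> fst c \<subseteq> topspace X"
  using chart_domain openin_subset by blast

lemma obtain_chart:
  assumes "p \<in> topspace X"
  obtains c where "c \<in> A" "p \<in> fst c"
  using assms covering that unfolding points_def by blast

lemma continuous_map_chart_inv:
  assumes "c \<in> A"
  shows "continuous_map (top_of_set (chart_image c)) X (chart_inv c)"
proof -
  obtain g where g: "homeomorphic_maps (subtopology X (fst c)) (top_of_set (chart_image c)) (snd c) g"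
    using chart_homeomorphic[OF assms] homeomorphic_map_maps by blast
  have "g x = chart_inv c x" if "x \<in> chart_image c" for x
    using g that chart_image_inverse[OF that] chart_subset[OF assms]
    by (auto simp: homeomorphic_maps_def topspace_subtopology) (metis Int_iff subsetD)
  then have "continuous_map (top_of_set (chart_image c)) (subtopology X (fst c)) (chart_inv c)"
    using g by (auto simp: homeomorphic_maps_def intro: continuous_map_eq)
  then show ?thesis by (simp add: continuous_map_in_subtopology)
qed

lemma open_chart_preimage:
  assumes "c \<in> A" "continuous_map X Y F" "openin Y W"
  shows "open {x \<in> chart_image c. F (chart_inv c x) \<in> W}"
proof -
  have "continuous_map (top_of_set (chart_image c)) Y (F \<circ> chart_inv c)"
    using continuous_map_chart_inv[OF assms(1)] assms(2) by (rule continuous_map_compose)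
  then have "openin (top_of_set (chart_image c)) {x \<in> chart_image c. F (chart_inv c x) \<in> W}"
    using assms(3) by (auto simp: continuous_map_def)
  then show ?thesis using openin_open_trans chart_image_open[OF assms(1)] by blast
qed

lemma chart_image_Collect:
  "c \<in> A \<Longrightarrow> snd c ` {p \<in> fst c. P p} = {x \<in> chart_image c. P (chart_inv c x)}"
  by (force simp: chart_image_def)

lemma smooth_map_local:
  assumes "smooth_map X A Y B F" "c \<in> A" "d \<in> B"
  shows "smooth_on {x \<in> chart_image c. F (chart_inv c x) \<in> fst d} (snd d \<circ> F \<circ> chart_inv c)"
  using assms unfolding chart_image_Collect[OF assms(2), of "\<lambda>p. F p \<in> fst d", symmetric]
  by (simp add: smooth_map_def)

lemma jac_chain:
  assumes F: "smooth_map X A X A F" and H: "smooth_map X A X A H"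
    and K: "\<And>q. q \<in> topspace X \<Longrightarrow> K q = H (F q)"
    and c: "c \<in> A" "p \<in> fst c" and d: "d \<in> A" "F p \<in> fst d" and e: "e \<in> A" "H (F p) \<in> fst e"
  shows "jac K c e p = jac H d e (F p) \<circ> jac F c d p"
proof -
  let ?S = "{x \<in> chart_image c. F (chart_inv c x) \<in> fst d}"
  have S: "open ?S"
    using F by (intro open_chart_preimage[OF c(1) _ chart_domain[OF d(1)]]) (simp add: smooth_map_def)
  have p: "snd c p \<in> ?S" using c d by (simp add: chart_in_image)
  have "((snd e \<circ> H \<circ> chart_inv d) has_derivative jac H d e (F p)) (at ((snd d \<circ> F \<circ> chart_inv c) (snd c p)))"
    using smooth_map_derivative[OF H d(1) e(1) d(2) e(2)] c by simp
  with smooth_map_derivative[OF F c(1) d(1) c(2) d(2)]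
  have chain: "((snd e \<circ> H \<circ> chart_inv d) \<circ> (snd d \<circ> F \<circ> chart_inv c) has_derivative
      jac H d e (F p) \<circ> jac F c d p) (at (snd c p))"
    by (rule diff_chain_at)
  have eq: "((snd e \<circ> H \<circ> chart_inv d) \<circ> (snd d \<circ> F \<circ> chart_inv c)) x = (snd e \<circ> K \<circ> chart_inv c) x"
    if x: "x \<in> ?S" for x
  proof -
    have "chart_inv c x \<in> topspace X" using x chart_inv_in[of x c] chart_subset[OF c(1)] by auto
    moreover have "chart_inv d (snd d (F (chart_inv c x))) = F (chart_inv c x)"
      using x d(1) by (intro chart_inv_eq) auto
    ultimately show ?thesis using K[of "chart_inv c x"] by simp
  qed
  have "((snd e \<circ> K \<circ> chart_inv c) has_derivative jac H d e (F p) \<circ> jac F c d p) (at (snd c p))"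
    by (rule has_derivative_transform_within_open[OF chain S p eq])
  from frechet_derivative_at[OF this] show ?thesis unfolding jac_def by (rule sym)
qed

lemma smooth_map_ident: "smooth_map X A X A (\<lambda>q. q)"
proof -
  have "smooth_on (snd c ` {p \<in> fst c. p \<in> fst d}) (snd d \<circ> (\<lambda>q. q) \<circ> chart_inv c)"
    if "c \<in> A" "d \<in> A" for c d
    using compatible[OF that] by (simp add: Int_def o_def)
  then show ?thesis by (simp add: smooth_map_def)
qed

lemma jac_ident:
  assumes "c \<in> A" "p \<in> fst c" "\<And>q. q \<in> topspace X \<Longrightarrow> F q = q"
  shows "jac F c c p = (\<lambda>y. y)"
proof -
  have "((\<lambda>x. x) has_derivative (\<lambda>y. y)) (at (snd c p))" by (rule has_derivative_ident)
  then have "((snd c \<circ> F \<circ> chart_inv c) has_derivative (\<lambda>y. y)) (at (snd c p))"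
  proof (rule has_derivative_transform_within_open)
    show "open (chart_image c)" using assms by (simp add: chart_image_open)
    show "snd c p \<in> chart_image c" using assms by (simp add: chart_in_image)
    show "x = (snd c \<circ> F \<circ> chart_inv c) x" if "x \<in> chart_image c" for x
      using chart_inv_in[OF that] chart_of_inv[OF that] assms(3) chart_subset[OF assms(1)] by auto
  qed
  from frechet_derivative_at[OF this] show ?thesis unfolding jac_def by (rule sym)
qed

lemma linear_jac:
  "smooth_map X A X A F \<Longrightarrow> c \<in> A \<Longrightarrow> d \<in> A \<Longrightarrow> p \<in> fst c \<Longrightarrow> F p \<in> fst d \<Longrightarrow> linear (jac F c d p)"
  by (rule has_derivative_linear[OF smooth_map_derivative])

definition tvec :: "('p, 'e) chart \<Rightarrow> 'p \<Rightarrow> 'e \<Rightarrow> ('p, 'e) tvec" where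
  "tvec c p y = (\<lambda>d. if d \<in> charts_at A p then jac (\<lambda>q. q) c d p y else 0)"

lemma tangent_space_iff:
  "v \<in> tangent_space A p \<longleftrightarrow>
     (\<forall>c\<in>charts_at A p. \<forall>d\<in>charts_at A p. v d = jac (\<lambda>q. q) c d p (v c)) \<and>
     (\<forall>c. c \<notin> charts_at A p \<longrightarrow> v c = 0)"
  by (simp add: tangent_space_def jac_def o_def)

lemma tangent_space_change:
  "v \<in> tangent_space A p \<Longrightarrow> c \<in> charts_at A p \<Longrightarrow> d \<in> charts_at A p \<Longrightarrow>
    v d = jac (\<lambda>q. q) c d p (v c)"
  unfolding tangent_space_iff by blast

lemma tvec_in:
  assumes "c \<in> charts_at A p"
  shows "tvec c p y \<in> tangent_space A p"
proof -
  have "tvec c p y e = jac (\<lambda>q. q) d e p (tvec c p y d)"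
    if "d \<in> charts_at A p" "e \<in> charts_at A p" for d e
    using jac_chain[OF smooth_map_ident smooth_map_ident, of "\<lambda>q. q" c p d e] assms that
    by (simp add: charts_at_def tvec_def)
  moreover have "tvec c p y d = 0" if "d \<notin> charts_at A p" for d
    using that by (simp add: tvec_def)
  ultimately show ?thesis unfolding tangent_space_iff by blast
qed

lemma tvec_coord: "c \<in> charts_at A p \<Longrightarrow> tvec c p y c = y"
  by (simp add: tvec_def jac_ident charts_at_def)

lemma tvec_eq: "v \<in> tangent_space A p \<Longrightarrow> c \<in> charts_at A p \<Longrightarrow> tvec c p (v c) = v"
  unfolding tangent_space_iff tvec_def by (rule ext) (metis (full_types))

lemma tangent_eqI:
  "v \<in> tangent_space A p \<Longrightarrow> w \<in> tangent_space A p \<Longrightarrow> c \<in> charts_at A p \<Longrightarrow> v c = w c \<Longrightarrow> v = w"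
  by (metis tvec_eq)

lemma zero_tvec_in: "zero_tvec \<in> tangent_space A p"
proof -
  have "jac (\<lambda>q. q) c d p 0 = 0" if "c \<in> charts_at A p" "d \<in> charts_at A p" for c d
    using that linear_0[OF linear_jac[OF smooth_map_ident]] by (simp add: charts_at_def)
  then show ?thesis by (simp add: tangent_space_iff zero_tvec_def)
qed

lemma tvec_nonzero: "c \<in> charts_at A p \<Longrightarrow> tvec c p y = zero_tvec \<longleftrightarrow> y = 0"
  by (metis tangent_eqI tvec_coord tvec_in zero_tvec_def zero_tvec_in)

lemma scale_tvec_in:
  assumes "v \<in> tangent_space A p"
  shows "scale_tvec r v \<in> tangent_space A p"
proof -
  have "v d = jac (\<lambda>q. q) c d p (v c)" "linear (jac (\<lambda>q. q) c d p)"
    if "c \<in> charts_at A p" "d \<in> charts_at A p" for c d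
    using tangent_space_change[OF assms that] that linear_jac[OF smooth_map_ident]
    by (auto simp: charts_at_def)
  then have "r *\<^sub>R v d = jac (\<lambda>q. q) c d p (r *\<^sub>R v c)"
    if "c \<in> charts_at A p" "d \<in> charts_at A p" for c d
    using that linear_scale by metis
  moreover have "r *\<^sub>R v c = 0" if "c \<notin> charts_at A p" for c
  proof -
    have "v c = 0" using assms that unfolding tangent_space_iff by blast
    then show ?thesis by simp
  qed
  ultimately show ?thesis unfolding tangent_space_iff scale_tvec_def by blast
qed

lemma differential_eq:
  assumes F: "smooth_map X A X A F" and v: "v \<in> tangent_space A p" and c: "c \<in> charts_at A p"
    and d: "d \<in> charts_at A (F p)"
  shows "differential A A F p v = tvec d (F p) (jac F c d p (v c))"
proof
  fix e
  define b where "b = (SOME c. c \<in> charts_at A p)"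
  have b: "b \<in> charts_at A p" using c unfolding b_def by (rule someI)
  have "jac F b e p (v b) = jac (\<lambda>q. q) d e (F p) (jac F c d p (v c))" if e: "e \<in> charts_at A (F p)"
  proof -
    have "jac F c e p (v c) = jac F b e p (jac (\<lambda>q. q) c b p (v c))"
      using jac_chain[OF smooth_map_ident F, of F c p b e] b c e by (simp add: charts_at_def)
    also have "jac (\<lambda>q. q) c b p (v c) = v b" using tangent_space_change[OF v c b] by simp
    finally have "jac F b e p (v b) = jac F c e p (v c)" by simp
    also have "\<dots> = jac (\<lambda>q. q) d e (F p) (jac F c d p (v c))"
      using jac_chain[OF F smooth_map_ident, of F c p d e] c d e by (simp add: charts_at_def)
    finally show ?thesis .
  qed
  then show "differential A A F p v e = tvec d (F p) (jac F c d p (v c)) e"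
    unfolding differential_def tvec_def b_def[symmetric] by (simp add: jac_def)
qed

lemma smooth_curve_chart:
  assumes "smooth_curve X A I \<gamma>" "open I" "c \<in> A"
  shows "open {t \<in> I. \<gamma> t \<in> fst c}" "smooth_on {t \<in> I. \<gamma> t \<in> fst c} (snd c \<circ> \<gamma>)"
proof -
  have "continuous_map (top_of_set I) X \<gamma>" using assms(1) unfolding smooth_curve_def smooth_map_def by blast
  then have "openin (top_of_set I) {t \<in> I. \<gamma> t \<in> fst c}"
    using openin_continuous_map_preimage[OF _ chart_domain[OF assms(3)]] by fastforce
  then show op: "open {t \<in> I. \<gamma> t \<in> fst c}" using assms(2) openin_open_trans by blast
  have "smooth_on {t \<in> I. \<gamma> t \<in> fst c} (snd c \<circ> \<gamma> \<circ> chart_inv (I, id))"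
    using assms by (simp add: smooth_curve_def smooth_map_def)
  then show "smooth_on {t \<in> I. \<gamma> t \<in> fst c} (snd c \<circ> \<gamma>)"
  proof (rule smooth_on_cong[OF op, rotated])
    fix t assume "t \<in> {t \<in> I. \<gamma> t \<in> fst c}"
    then show "(snd c \<circ> \<gamma> \<circ> chart_inv (I, id)) t = (snd c \<circ> \<gamma>) t"
      using f_inv_into_f[of t id I] by (simp add: chart_inv_def)
  qed
qed

lemma smooth_curve_has_derivative:
  assumes "smooth_curve X A I \<gamma>" "open I" "c \<in> A" "t \<in> I" "\<gamma> t \<in> fst c"
  shows "((snd c \<circ> \<gamma>) has_vector_derivative velocity A \<gamma> t c) (at t)"
proof -
  have "(snd c \<circ> \<gamma>) differentiable (at t)"
    using smooth_onD[OF smooth_curve_chart(2)[OF assms(1-3)]] assms by simp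
  then show ?thesis using assms by (simp add: velocity_def charts_at_def vector_derivative_works)
qed

lemma push_curve:
  assumes F: "smooth_map X A X A F" and c: "c \<in> A" "\<gamma> t \<in> fst c" and d: "d \<in> A" "F (\<gamma> t) \<in> fst d"
    and J: "open J" "t \<in> J" "\<And>s. s \<in> J \<Longrightarrow> \<gamma> s \<in> fst c"
    and y: "((snd c \<circ> \<gamma>) has_vector_derivative y) (at t)"
  shows "((snd d \<circ> (F \<circ> \<gamma>)) has_vector_derivative jac F c d (\<gamma> t) y) (at t)"
proof -
  have "((snd d \<circ> F \<circ> chart_inv c) \<circ> (snd c \<circ> \<gamma>) has_vector_derivative jac F c d (\<gamma> t) y) (at t)"
  proof -
    have D: "((snd d \<circ> F \<circ> chart_inv c) has_derivative jac F c d (\<gamma> t)) (at ((snd c \<circ> \<gamma>) t))"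
      using smooth_map_derivative[OF F c(1) d(1) c(2) d(2)] by simp
    have "jac F c d (\<gamma> t) (r *\<^sub>R y) = r *\<^sub>R jac F c d (\<gamma> t) y" for r
      using linear_scale[OF has_derivative_linear[OF D]] .
    then show ?thesis
      using diff_chain_at[OF y[unfolded has_vector_derivative_def] D]
      unfolding has_vector_derivative_def by (simp add: o_def)
  qed
  then show ?thesis
    by (rule has_vector_derivative_transform_within_open[OF _ J(1,2)]) (use J(3) c in auto)
qed

lemma velocity_in:
  assumes "smooth_curve X A I \<gamma>" "open I" "t \<in> I"
  shows "velocity A \<gamma> t \<in> tangent_space A (\<gamma> t)"
proof -
  have "velocity A \<gamma> t d = jac (\<lambda>q. q) c d (\<gamma> t) (velocity A \<gamma> t c)"
    if cd: "c \<in> charts_at A (\<gamma> t)" "d \<in> charts_at A (\<gamma> t)" for c d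
  proof -
    have *: "c \<in> A" "d \<in> A" "\<gamma> t \<in> fst c" "\<gamma> t \<in> fst d" using cd by (auto simp: charts_at_def)
    have "((snd d \<circ> ((\<lambda>q. q) \<circ> \<gamma>)) has_vector_derivative
        jac (\<lambda>q. q) c d (\<gamma> t) (velocity A \<gamma> t c)) (at t)"
      using * assms smooth_curve_chart(1)[OF assms(1,2)]
      by (intro push_curve[where J = "{t \<in> I. \<gamma> t \<in> fst c}"] smooth_map_ident
          smooth_curve_has_derivative[OF assms(1,2)]) auto
    then have "((snd d \<circ> \<gamma>) has_vector_derivative
        jac (\<lambda>q. q) c d (\<gamma> t) (velocity A \<gamma> t c)) (at t)" by (simp add: o_def)
    from vector_derivative_unique_at[OF smooth_curve_has_derivative[OF assms(1,2) *(2) assms(3) *(4)] this]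
    show ?thesis .
  qed
  moreover have "velocity A \<gamma> t c = 0" if "c \<notin> charts_at A (\<gamma> t)" for c
    using that by (simp add: velocity_def)
  ultimately show ?thesis unfolding tangent_space_iff by blast
qed

end

section \<open>Left trivialization of a Lie group\<close>

context lie_group
begin

definition local_mult :: "('g, 'e) chart \<Rightarrow> ('g, 'e) chart \<Rightarrow> ('g, 'e) chart \<Rightarrow> 'e \<times> 'e \<Rightarrow> 'e" where
  "local_mult b c d z = snd d (chart_inv b (fst z) \<otimes> chart_inv c (snd z))"

definition local_mult_dom :: "('g, 'e) chart \<Rightarrow> ('g, 'e) chart \<Rightarrow> ('g, 'e) chart \<Rightarrow> ('e \<times> 'e) set" where
  "local_mult_dom b c d =
     {z \<in> chart_image b \<times> chart_image c. chart_inv b (fst z) \<otimes> chart_inv c (snd z) \<in> fst d}"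

lemma chart_carrier: "c \<in> A \<Longrightarrow> p \<in> fst c \<Longrightarrow> p \<in> carrier G"
  using chart_subset topspace_carrier by blast

lemma chart_inv_carrier: "c \<in> A \<Longrightarrow> x \<in> chart_image c \<Longrightarrow> chart_inv c x \<in> carrier G"
  by (rule chart_carrier[OF _ chart_inv_in])

lemma continuous_map_mult:
  assumes "continuous_map T X f" "continuous_map T X g"
  shows "continuous_map T X (\<lambda>s. f s \<otimes> g s)"
proof -
  have "continuous_map (prod_topology X X) X (\<lambda>(g, h). g \<otimes> h)"
    using smooth_mult unfolding smooth_map_def by blast
  from continuous_map_compose[OF continuous_map_pairedI[OF assms] this] show ?thesis
    by (simp add: o_def)
qed

lemma open_local_mult_dom:
  assumes "b \<in> A" "c \<in> A" "d \<in> A"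
  shows "open (local_mult_dom b c d)"
proof -
  let ?T = "top_of_set (chart_image b \<times> chart_image c)"
  have "continuous_map ?T (top_of_set (chart_image b)) fst"
    "continuous_map ?T (top_of_set (chart_image c)) snd"
    by (auto intro!: continuous_intros)
  from continuous_map_mult[OF continuous_map_compose[OF this(1) continuous_map_chart_inv[OF assms(1)]]
      continuous_map_compose[OF this(2) continuous_map_chart_inv[OF assms(2)]]]
  have "continuous_map ?T X (\<lambda>z. chart_inv b (fst z) \<otimes> chart_inv c (snd z))" by simp
  from openin_continuous_map_preimage[OF this chart_domain[OF assms(3)]]
  have "openin ?T (local_mult_dom b c d)" by (simp add: local_mult_dom_def)
  then show ?thesis
    using openin_open_trans open_Times[OF chart_image_open chart_image_open] assms by blast
qed

lemma smooth_local_mult: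
  assumes "b \<in> A" "c \<in> A" "d \<in> A"
  shows "smooth_on (local_mult_dom b c d) (local_mult b c d)"
proof -
  let ?p = "(fst b \<times> fst c, map_prod (snd b) (snd c))"
  have inj: "inj_on (snd ?p) (fst ?p)"
    using chart_inj[OF assms(1)] chart_inj[OF assms(2)] by (auto simp: inj_on_def)
  have inv: "chart_inv ?p z = (chart_inv b (fst z), chart_inv c (snd z))"
    if "z \<in> chart_image b \<times> chart_image c" for z
    unfolding chart_inv_def[of ?p]
    using that by (intro inv_into_f_eq[OF inj]) (auto simp: chart_inv_in chart_of_inv)
  have image: "snd ?p ` {q \<in> fst ?p. (\<lambda>(g, h). g \<otimes> h) q \<in> fst d} = local_mult_dom b c d" (is "?l = ?r")
  proof
    show "?l \<subseteq> ?r" using assms by (auto simp: local_mult_dom_def chart_in_image)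
    show "?r \<subseteq> ?l"
    proof
      fix z assume z: "z \<in> ?r"
      then have "(chart_inv b (fst z), chart_inv c (snd z)) \<in> {q \<in> fst ?p. (\<lambda>(g, h). g \<otimes> h) q \<in> fst d}"
        by (auto simp: local_mult_dom_def chart_inv_in)
      moreover have "z = snd ?p (chart_inv b (fst z), chart_inv c (snd z))"
        using z by (auto simp: local_mult_dom_def chart_of_inv)
      ultimately show "z \<in> ?l" by (rule rev_image_eqI)
    qed
  qed
  have "?p \<in> prod_atlas A A" using assms by (force simp: prod_atlas_def)
  then have "smooth_on (snd ?p ` {q \<in> fst ?p. (\<lambda>(g, h). g \<otimes> h) q \<in> fst d})
      (snd d \<circ> (\<lambda>(g, h). g \<otimes> h) \<circ> chart_inv ?p)"
    using smooth_mult assms(3) unfolding smooth_map_def by blast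
  then have *: "smooth_on (local_mult_dom b c d) (snd d \<circ> (\<lambda>(g, h). g \<otimes> h) \<circ> chart_inv ?p)"
    by (simp only: image)
  show ?thesis
    by (rule smooth_on_cong[OF open_local_mult_dom[OF assms] _ *])
      (auto simp: local_mult_dom_def local_mult_def inv)
qed

lemma continuous_map_const_carrier: "g \<in> carrier G \<Longrightarrow> continuous_map T X (\<lambda>s. g)"
  using topspace_carrier by simp

lemma smooth_map_left:
  assumes g: "g \<in> carrier G"
  shows "smooth_map X A X A (\<lambda>k. g \<otimes> k)"
  unfolding smooth_map_def
proof (intro conjI ballI)
  show cont: "continuous_map X X (\<lambda>k. g \<otimes> k)"
    using continuous_map_mult[OF continuous_map_const_carrier[OF g] continuous_map_id[unfolded id_def]] .
  obtain b where b: "b \<in> A" "g \<in> fst b" using g obtain_chart topspace_carrier by blast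
  fix c d assume cd: "c \<in> A" "d \<in> A"
  let ?S = "{x \<in> chart_image c. g \<otimes> chart_inv c x \<in> fst d}"
  have op: "open ?S" using cont by (rule open_chart_preimage[OF cd(1) _ chart_domain[OF cd(2)]])
  have "smooth_on ?S (\<lambda>x. local_mult b c d (snd b g, x))"
    using b op cd
    by (intro smooth_on_compose[OF op open_local_mult_dom smooth_local_mult] smooth_on_Pair
        smooth_on_const smooth_on_id) (auto simp: local_mult_dom_def chart_in_image)
  then have "smooth_on ?S (snd d \<circ> (\<lambda>k. g \<otimes> k) \<circ> chart_inv c)"
    using b by (simp add: local_mult_def o_def)
  then show "smooth_on (snd c ` {p \<in> fst c. g \<otimes> p \<in> fst d}) (snd d \<circ> (\<lambda>k. g \<otimes> k) \<circ> chart_inv c)"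
    by (simp only: chart_image_Collect[OF cd(1)])
qed

lemma smooth_map_right:
  assumes g: "g \<in> carrier G"
  shows "smooth_map X A X A (\<lambda>k. k \<otimes> g)"
  unfolding smooth_map_def
proof (intro conjI ballI)
  show cont: "continuous_map X X (\<lambda>k. k \<otimes> g)"
    using continuous_map_mult[OF continuous_map_id[unfolded id_def] continuous_map_const_carrier[OF g]] .
  obtain b where b: "b \<in> A" "g \<in> fst b" using g obtain_chart topspace_carrier by blast
  fix c d assume cd: "c \<in> A" "d \<in> A"
  let ?S = "{x \<in> chart_image c. chart_inv c x \<otimes> g \<in> fst d}"
  have op: "open ?S" using cont by (rule open_chart_preimage[OF cd(1) _ chart_domain[OF cd(2)]])
  have "smooth_on ?S (\<lambda>x. local_mult c b d (x, snd b g))"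
    using b op cd
    by (intro smooth_on_compose[OF op open_local_mult_dom smooth_local_mult] smooth_on_Pair
        smooth_on_const smooth_on_id) (auto simp: local_mult_dom_def chart_in_image)
  then have "smooth_on ?S (snd d \<circ> (\<lambda>k. k \<otimes> g) \<circ> chart_inv c)"
    using b by (simp add: local_mult_def o_def)
  then show "smooth_on (snd c ` {p \<in> fst c. p \<otimes> g \<in> fst d}) (snd d \<circ> (\<lambda>k. k \<otimes> g) \<circ> chart_inv c)"
    by (simp only: chart_image_Collect[OF cd(1)])
qed

definition base :: "('g, 'e) chart" where
  "base = (SOME c. c \<in> charts_at A \<one>)"

lemma base_charts_at: "base \<in> charts_at A \<one>"
proof -
  obtain c where "c \<in> A" "\<one> \<in> fst c" using obtain_chart topspace_carrier by blast
  then have "c \<in> charts_at A \<one>" by (simp add: charts_at_def)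
  then show ?thesis unfolding base_def by (rule someI)
qed

lemma base [simp]: "base \<in> A" "\<one> \<in> fst base"
  using base_charts_at by (simp_all add: charts_at_def)

text \<open>The Maurer-Cartan form at \<open>p\<close>, from coordinates in \<open>c\<close> to coordinates in \<open>base\<close>, and its inverse.\<close>

definition mc :: "('g, 'e) chart \<Rightarrow> 'g \<Rightarrow> 'e \<Rightarrow> 'e" where
  "mc c p = jac (\<lambda>k. inv p \<otimes> k) c base p"

definition left_field :: "('g, 'e) chart \<Rightarrow> 'g \<Rightarrow> 'e \<Rightarrow> 'e" where
  "left_field c p = jac (\<lambda>k. p \<otimes> k) base c \<one>"

lemma linear_mc:
  assumes "c \<in> A" "p \<in> fst c"
  shows "linear (mc c p)"
  unfolding mc_def using assms chart_carrier[OF assms] by (intro linear_jac smooth_map_left) auto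

lemma mc_left_field:
  assumes "c \<in> A" "p \<in> fst c"
  shows "mc c p (left_field c p Y) = Y" "left_field c p (mc c p y) = y"
proof -
  have p: "p \<in> carrier G" using chart_carrier[OF assms] .
  have "jac (\<lambda>k. k) base base \<one> = jac (\<lambda>k. inv p \<otimes> k) c base (p \<otimes> \<one>) \<circ> jac (\<lambda>k. p \<otimes> k) base c \<one>"
    using p assms topspace_carrier
    by (intro jac_chain smooth_map_left) (auto simp: m_assoc[symmetric])
  then show "mc c p (left_field c p Y) = Y"
    using p by (simp add: jac_ident mc_def left_field_def o_def fun_eq_iff)
  have "jac (\<lambda>k. k) c c p = jac (\<lambda>k. p \<otimes> k) base c (inv p \<otimes> p) \<circ> jac (\<lambda>k. inv p \<otimes> k) c base p"
    using p assms topspace_carrier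
    by (intro jac_chain smooth_map_left) (auto simp: m_assoc[symmetric])
  then show "left_field c p (mc c p y) = y"
    using p assms by (simp add: jac_ident mc_def left_field_def o_def fun_eq_iff)
qed

lemma mc_left_translation:
  assumes g: "g \<in> carrier G" and c: "c \<in> A" "h \<in> fst c" and d: "d \<in> A" "g \<otimes> h \<in> fst d"
  shows "mc d (g \<otimes> h) (jac (\<lambda>k. g \<otimes> k) c d h y) = mc c h y"
proof -
  have h: "h \<in> carrier G" using chart_carrier[OF c] .
  have "jac (\<lambda>k. inv h \<otimes> k) c base h = jac (\<lambda>k. inv (g \<otimes> h) \<otimes> k) d base (g \<otimes> h) \<circ> jac (\<lambda>k. g \<otimes> k) c d h"
  proof (rule jac_chain[OF smooth_map_left smooth_map_left])
    show "inv h \<otimes> q = inv (g \<otimes> h) \<otimes> (g \<otimes> q)" if "q \<in> topspace X" for q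
      using that g h topspace_carrier
      by (simp add: inv_mult_group m_assoc) (simp add: m_assoc[symmetric])
  qed (use g h c d in auto)
  then show ?thesis by (simp add: mc_def)
qed

lemma mc_change:
  assumes "c \<in> charts_at A p" "d \<in> charts_at A p"
  shows "mc d p (jac (\<lambda>q. q) c d p y) = mc c p y"
proof -
  have cd: "c \<in> A" "p \<in> fst c" "d \<in> A" "p \<in> fst d" using assms by (auto simp: charts_at_def)
  then have p: "p \<in> carrier G" using chart_carrier by blast
  have "jac (\<lambda>k. inv p \<otimes> k) c base p = jac (\<lambda>k. inv p \<otimes> k) d base p \<circ> jac (\<lambda>q. q) c d p"
    using p cd by (intro jac_chain smooth_map_left smooth_map_ident) auto
  then show ?thesis by (simp add: mc_def)
qed

definition body :: "'g \<Rightarrow> ('g, 'e) tvec \<Rightarrow> 'e" where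
  "body p v = (let c = (SOME c. c \<in> charts_at A p) in mc c p (v c))"

lemma body_eq:
  assumes "v \<in> tangent_space A p" "c \<in> charts_at A p"
  shows "body p v = mc c p (v c)"
proof -
  have b: "(SOME c. c \<in> charts_at A p) \<in> charts_at A p" using assms(2) by (rule someI)
  show ?thesis
    unfolding body_def Let_def tangent_space_change[OF assms b] by (rule mc_change[OF assms(2) b])
qed

lemma body_differential:
  assumes g: "g \<in> carrier G" and h: "h \<in> carrier G" and v: "v \<in> tangent_space A h"
  shows "body (g \<otimes> h) (differential A A (\<lambda>k. g \<otimes> k) h v) = body h v"
proof -
  obtain c d where c: "c \<in> charts_at A h" and d: "d \<in> charts_at A (g \<otimes> h)"
    using g h obtain_chart topspace_carrier by (metis (no_types, lifting) charts_at_def m_closed mem_Collect_eq)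
  have "differential A A (\<lambda>k. g \<otimes> k) h v = tvec d (g \<otimes> h) (jac (\<lambda>k. g \<otimes> k) c d h (v c))"
    using differential_eq[OF smooth_map_left[OF g] v c d] .
  then have "body (g \<otimes> h) (differential A A (\<lambda>k. g \<otimes> k) h v)
      = mc d (g \<otimes> h) (jac (\<lambda>k. g \<otimes> k) c d h (v c))"
    using body_eq[OF tvec_in[OF d] d] by (simp add: tvec_coord[OF d])
  also have "\<dots> = mc c h (v c)" using c d g by (intro mc_left_translation) (auto simp: charts_at_def)
  also have "\<dots> = body h v" using body_eq[OF v c] by simp
  finally show ?thesis .
qed

definition maurer_cartan :: "('g, 'e) chart \<Rightarrow> 'e \<times> 'e \<Rightarrow> 'e" where
  "maurer_cartan c = (\<lambda>(x, y). mc c (chart_inv c x) y)"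

lemma smooth_maurer_cartan:
  assumes c: "c \<in> A"
  shows "smooth_on (chart_image c \<times> UNIV) (maurer_cartan c)"
proof (rule smooth_on_local)
  fix z :: "'e \<times> 'e" assume z: "z \<in> chart_image c \<times> UNIV"
  let ?p = "chart_inv c (fst z)"
  have fz: "fst z \<in> chart_image c" using z by (simp add: mem_Times_iff)
  then have "inv ?p \<in> topspace X" using chart_inv_carrier[OF c] by (simp add: topspace_carrier)
  then obtain d where d: "d \<in> A" "inv ?p \<in> fst d" by (rule obtain_chart)
  let ?V = "{x \<in> chart_image c. inv (chart_inv c x) \<in> fst d}"
  let ?\<iota> = "\<lambda>x. snd d (inv (chart_inv c x))"
  let ?m = "local_mult d c base"
  have V: "open ?V"
    using smooth_inv by (intro open_chart_preimage[OF c _ chart_domain[OF d(1)]]) (simp add: smooth_map_def)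
  have \<iota>: "smooth_on ?V ?\<iota>"
    using smooth_map_local[OF smooth_inv c d(1)] by (simp add: o_def)
  have dom: "(?\<iota> x, x) \<in> local_mult_dom d c base" if "x \<in> ?V" for x
    using that c d chart_inv_carrier[OF c, of x] by (auto simp: local_mult_dom_def chart_in_image)
  have eq: "maurer_cartan c (x, y) = (\<Sum>i\<in>Basis. (y \<bullet> i) *\<^sub>R frechet_derivative ?m (at (?\<iota> x, x)) (0, i))"
    if x: "x \<in> ?V" for x y
  proof -
    have D: "(?m has_derivative frechet_derivative ?m (at (?\<iota> x, x))) (at (?\<iota> x, x))"
      using smooth_on_has_derivative[OF smooth_local_mult[OF d(1) c base(1)] dom[OF x]] .
    have "((\<lambda>u. (?\<iota> x, u)) has_derivative (\<lambda>k. (0, k))) (at x)"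
      by (intro has_derivative_Pair has_derivative_const has_derivative_ident)
    from has_derivative_compose[OF this D]
    have "((\<lambda>u. ?m (?\<iota> x, u)) has_derivative (\<lambda>k. frechet_derivative ?m (at (?\<iota> x, x)) (0, k))) (at x)" .
    moreover have "(\<lambda>u. ?m (?\<iota> x, u)) = snd base \<circ> (\<lambda>k. inv (chart_inv c x) \<otimes> k) \<circ> chart_inv c"
      using x d by (auto simp: local_mult_def)
    ultimately have "mc c (chart_inv c x) = (\<lambda>k. frechet_derivative ?m (at (?\<iota> x, x)) (0, k))"
      using x unfolding mc_def jac_def by (simp add: chart_of_inv frechet_derivative_at[symmetric])
    moreover have "linear (mc c (chart_inv c x))" using x c by (intro linear_mc) (auto simp: chart_inv_in)
    ultimately show ?thesis
      using linear_expand_Basis[of "mc c (chart_inv c x)" y] by (simp add: maurer_cartan_def)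
  qed
  have VU: "open (?V \<times> (UNIV :: 'e set))" using V by (simp add: open_Times)
  have fstsnd: "smooth_on (?V \<times> UNIV) (fst :: 'e \<times> 'e \<Rightarrow> 'e)" "smooth_on (?V \<times> UNIV) (snd :: 'e \<times> 'e \<Rightarrow> 'e)"
    using VU by (auto intro: smooth_on_bounded_linear bounded_linear_fst bounded_linear_snd)
  have "smooth_on (?V \<times> UNIV) (\<lambda>z::'e \<times> 'e. ?\<iota> (fst z))"
    by (rule smooth_on_compose[OF VU V \<iota> fstsnd(1)]) auto
  from smooth_on_Pair[OF VU this fstsnd(1)]
  have "smooth_on (?V \<times> UNIV) (\<lambda>z::'e \<times> 'e. (?\<iota> (fst z), fst z))" .
  then have summand: "smooth_on (?V \<times> UNIV) (\<lambda>z::'e \<times> 'e. frechet_derivative ?m (at (?\<iota> (fst z), fst z)) (0, i))" for i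
    by (rule smooth_on_compose[OF VU open_local_mult_dom[OF d(1) c base(1)]
          smooth_on_frechet[OF smooth_local_mult[OF d(1) c base(1)]]]) (use dom in auto)
  have "smooth_on (?V \<times> UNIV) (\<lambda>z::'e \<times> 'e. \<Sum>i\<in>Basis. (snd z \<bullet> i) *\<^sub>R frechet_derivative ?m (at (?\<iota> (fst z), fst z)) (0, i))"
    by (rule smooth_on_sum[OF VU], rule smooth_on_bilinear[OF VU _ summand bounded_bilinear_scaleR],
        rule smooth_on_linear[OF VU fstsnd(2) bounded_linear_inner_left])
  then have "smooth_on (?V \<times> UNIV) (maurer_cartan c)"
    by (rule smooth_on_cong[OF VU, rotated]) (auto simp: eq)
  moreover have "z \<in> ?V \<times> UNIV" using fz d by (simp add: mem_Times_iff)
  ultimately show "\<exists>T. open T \<and> z \<in> T \<and> smooth_on T (maurer_cartan c)" using VU by blast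
qed

lemma coframe_maurer_cartan:
  assumes "c \<in> A"
  shows "coframe (chart_image c) (maurer_cartan c)"
proof (rule coframe.intro)
  show "open (chart_image c)" using assms by (rule chart_image_open)
  show "maurer_cartan c differentiable (at (x, y))" if "x \<in> chart_image c" for x y
    using smooth_onD[OF smooth_maurer_cartan[OF assms]] that by simp
  show "linear (\<lambda>y. maurer_cartan c (x, y))" if "x \<in> chart_image c" for x
    using linear_mc[OF assms chart_inv_in[OF that]] by (simp add: maurer_cartan_def)
qed

end

section \<open>One-parameter subgroups\<close>

lemma open_curve_preimage:
  fixes I :: "real set"
  assumes "continuous_map (top_of_set I) X \<gamma>" "open I" "openin X W"
  shows "open {t \<in> I. \<gamma> t \<in> W}"
  using openin_continuous_map_preimage[OF assms(1,3)] assms(2) openin_open_trans by fastforce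

context lie_group
begin

lemma smooth_curve_continuous: "smooth_curve X A I \<gamma> \<Longrightarrow> continuous_map (top_of_set I) X \<gamma>"
  unfolding smooth_curve_def smooth_map_def by blast

lemma continuous_map_carrier:
  "continuous_map (top_of_set I) X \<gamma> \<Longrightarrow> t \<in> I \<Longrightarrow> \<gamma> t \<in> carrier G"
  using continuous_map_image_subset_topspace[of "top_of_set I" X \<gamma>] topspace_carrier by auto

lemma smooth_curve_carrier: "smooth_curve X A I \<gamma> \<Longrightarrow> t \<in> I \<Longrightarrow> \<gamma> t \<in> carrier G"
  using continuous_map_carrier smooth_curve_continuous by blast

lemma body_velocity:
  assumes "smooth_curve X A I \<gamma>" "open I" "t \<in> I"
  shows "((\<lambda>s. snd base (inv (\<gamma> t) \<otimes> \<gamma> s)) has_vector_derivative body (\<gamma> t) (velocity A \<gamma> t)) (at t)"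
proof -
  have \<gamma>t: "\<gamma> t \<in> carrier G" using assms smooth_curve_carrier by blast
  then obtain c where c: "c \<in> A" "\<gamma> t \<in> fst c" using obtain_chart topspace_carrier by blast
  have "((snd base \<circ> ((\<lambda>k. inv (\<gamma> t) \<otimes> k) \<circ> \<gamma>)) has_vector_derivative
      jac (\<lambda>k. inv (\<gamma> t) \<otimes> k) c base (\<gamma> t) (velocity A \<gamma> t c)) (at t)"
    using \<gamma>t assms smooth_curve_chart(1)[OF assms(1,2) c(1)]
    by (intro push_curve[where J = "{s \<in> I. \<gamma> s \<in> fst c}"] smooth_map_left c
        smooth_curve_has_derivative[OF assms(1,2)]) (auto simp: c)
  moreover have "body (\<gamma> t) (velocity A \<gamma> t) = mc c (\<gamma> t) (velocity A \<gamma> t c)"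
    using c by (intro body_eq velocity_in[OF assms]) (simp add: charts_at_def)
  ultimately show ?thesis by (simp add: mc_def o_def)
qed

lemma one_parameter_subgroupD:
  assumes "one_parameter_subgroup G X A \<phi>"
  shows "smooth_curve X A UNIV \<phi>" "\<phi> t \<in> carrier G" "\<phi> (s + t) = \<phi> s \<otimes> \<phi> t" "\<phi> 0 = \<one>"
    "\<phi> (- t) = inv (\<phi> t)"
proof -
  show sm: "smooth_curve X A UNIV \<phi>" using assms by (simp add: one_parameter_subgroup_def)
  then show c: "\<phi> t \<in> carrier G" for t using smooth_curve_carrier by blast
  show add: "\<phi> (s + t) = \<phi> s \<otimes> \<phi> t" for s t using assms by (simp add: one_parameter_subgroup_def)
  show 0: "\<phi> 0 = \<one>" using add[of 0 0] c[of 0] by (metis add_0 r_cancel_one')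
  have "\<phi> (- t) \<otimes> \<phi> t = \<one>" using add[of "- t" t] 0 by simp
  then show "\<phi> (- t) = inv (\<phi> t)" using inv_equality c by metis
qed

lemma one_parameter_subgroup_diff:
  assumes "one_parameter_subgroup G X A \<phi>"
  shows "inv (\<phi> t) \<otimes> \<phi> s = \<phi> (s - t)"
  using one_parameter_subgroupD(3)[OF assms, of "- t" s] one_parameter_subgroupD(5)[OF assms, of t]
  by simp

lemma velocity_zero_in:
  "one_parameter_subgroup G X A \<phi> \<Longrightarrow> velocity A \<phi> 0 \<in> tangent_space A \<one>"
  using velocity_in[OF one_parameter_subgroupD(1), of \<phi> 0] one_parameter_subgroupD(4)[of \<phi>] by simp

lemma one_parameter_subgroup_derivative:
  assumes "one_parameter_subgroup G X A \<phi>"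
  shows "((snd base \<circ> \<phi>) has_vector_derivative velocity A \<phi> 0 base) (at 0)"
  using one_parameter_subgroupD[OF assms]
  by (intro smooth_curve_has_derivative[of UNIV]) auto

lemma body_translate:
  assumes \<phi>: "one_parameter_subgroup G X A \<phi>" and \<gamma>: "smooth_curve X A I \<gamma>" "open I" "t \<in> I"
    and eq: "\<And>s. s \<in> I \<Longrightarrow> \<gamma> s = g \<otimes> \<phi> s" and g: "g \<in> carrier G"
  shows "body (\<gamma> t) (velocity A \<gamma> t) = velocity A \<phi> 0 base"
proof -
  have "((snd base \<circ> \<phi>) has_vector_derivative velocity A \<phi> 0 base) (at (t - t))"
    using one_parameter_subgroup_derivative[OF \<phi>] by simp
  moreover have "((\<lambda>s. s - t) has_vector_derivative 1) (at t)"
    by (auto intro!: derivative_eq_intros)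
  ultimately have "((\<lambda>s. snd base (\<phi> (s - t))) has_vector_derivative velocity A \<phi> 0 base) (at t)"
    using vector_diff_chain_at[of "\<lambda>s. s - t" 1 t "snd base \<circ> \<phi>"] by (simp add: o_def)
  then have "((\<lambda>s. snd base (inv (\<gamma> t) \<otimes> \<gamma> s)) has_vector_derivative velocity A \<phi> 0 base) (at t)"
  proof (rule has_vector_derivative_transform_within_open[OF _ \<gamma>(2,3)])
    fix s assume "s \<in> I"
    have "\<phi> s \<in> carrier G" "\<phi> t \<in> carrier G" using one_parameter_subgroupD(2)[OF \<phi>] by auto
    then have "inv (g \<otimes> \<phi> t) \<otimes> (g \<otimes> \<phi> s) = inv (\<phi> t) \<otimes> \<phi> s"
      using g by (simp add: inv_mult_group m_assoc) (simp add: m_assoc[symmetric])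
    then show "snd base (\<phi> (s - t)) = snd base (inv (\<gamma> t) \<otimes> \<gamma> s)"
      using eq \<open>s \<in> I\<close> \<gamma>(3) one_parameter_subgroup_diff[OF \<phi>] by simp
  qed
  from vector_derivative_unique_at[OF body_velocity[OF \<gamma>] this] show ?thesis .
qed

lemma derivative_local_mult_one:
  "(local_mult base base base has_derivative (\<lambda>(a, b). a + b)) (at (snd base \<one>, snd base \<one>))"
proof -
  let ?u = "snd base \<one>" and ?m = "local_mult base base base"
  let ?D = "frechet_derivative ?m (at (?u, ?u))"
  have u: "?u \<in> chart_image base" by (simp add: chart_in_image)
  have "(?u, ?u) \<in> local_mult_dom base base base"
    using u by (simp add: local_mult_dom_def)
  then have D: "(?m has_derivative ?D) (at (?u, ?u))"
    by (rule smooth_on_has_derivative[OF smooth_local_mult[OF base(1) base(1) base(1)]])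
  have id: "((\<lambda>x. x) has_derivative (\<lambda>h. h)) (at ?u)" by (rule has_derivative_ident)
  have one: "chart_inv base x \<otimes> \<one> = chart_inv base x" "\<one> \<otimes> chart_inv base x = chart_inv base x"
    if "x \<in> chart_image base" for x
    using chart_inv_carrier[OF base(1) that] by simp_all
  have "((\<lambda>x. ?m (x, ?u)) has_derivative (\<lambda>h. h)) (at ?u)"
    by (rule has_derivative_transform_within_open[OF id chart_image_open[OF base(1)] u])
      (simp add: local_mult_def one chart_of_inv)
  moreover have "((\<lambda>x. (x, ?u)) has_derivative (\<lambda>h. (h, 0))) (at ?u)"
    by (intro has_derivative_Pair has_derivative_const has_derivative_ident)
  from has_derivative_compose[OF this D]
  have "((\<lambda>x. ?m (x, ?u)) has_derivative (\<lambda>h. ?D (h, 0))) (at ?u)" .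
  ultimately have 1: "?D (h, 0) = h" for h by (metis has_derivative_unique)
  have "((\<lambda>x. ?m (?u, x)) has_derivative (\<lambda>h. h)) (at ?u)"
    by (rule has_derivative_transform_within_open[OF id chart_image_open[OF base(1)] u])
      (simp add: local_mult_def one chart_of_inv)
  moreover have "((\<lambda>x. (?u, x)) has_derivative (\<lambda>h. (0, h))) (at ?u)"
    by (intro has_derivative_Pair has_derivative_const has_derivative_ident)
  from has_derivative_compose[OF this D]
  have "((\<lambda>x. ?m (?u, x)) has_derivative (\<lambda>h. ?D (0, h))) (at ?u)" .
  ultimately have 2: "?D (0, h) = h" for h by (metis has_derivative_unique)
  have "?D (a, b) = a + b" for a b
    using linear_add[OF has_derivative_linear[OF D], of "(a, 0)" "(0, b)"] by (simp add: 1 2)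
  then have "?D = (\<lambda>(a, b). a + b)" by auto
  with D show ?thesis by simp
qed

lemma constant_body_curve:
  assumes \<phi>: "one_parameter_subgroup G X A \<phi>" and \<gamma>: "smooth_curve X A I \<gamma>" "open_interval I"
    and body: "\<And>t. t \<in> I \<Longrightarrow> body (\<gamma> t) (velocity A \<gamma> t) = velocity A \<phi> 0 base"
    and "s \<in> I" "t \<in> I"
  shows "\<gamma> s \<otimes> inv (\<phi> s) = \<gamma> t \<otimes> inv (\<phi> t)"
proof -
  let ?h = "\<lambda>s. \<gamma> s \<otimes> inv (\<phi> s)" and ?Y = "velocity A \<phi> 0 base"
  have I: "open I" "connected I"
    using \<gamma>(2) by (auto simp: open_interval_def is_interval_connected)
  have cont_\<gamma>: "continuous_map (top_of_set I) X \<gamma>" using smooth_curve_continuous[OF \<gamma>(1)] .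
  have \<gamma>c: "\<gamma> s \<in> carrier G" if "s \<in> I" for s using continuous_map_carrier[OF cont_\<gamma> that] .
  have \<phi>c: "\<phi> s \<in> carrier G" for s using one_parameter_subgroupD(2)[OF \<phi>] .
  have cont_\<phi>: "continuous_map (top_of_set I) X (\<lambda>s. \<phi> (r - s))" for r
  proof -
    have "continuous_map (top_of_set I) (top_of_set UNIV) (\<lambda>s. r - s)"
      by (auto intro!: continuous_intros)
    from continuous_map_compose[OF this smooth_curve_continuous[OF one_parameter_subgroupD(1)[OF \<phi>]]]
    show ?thesis by (simp add: o_def)
  qed
  have cont_h: "continuous_map (top_of_set I) X ?h"
    using continuous_map_mult[OF cont_\<gamma> cont_\<phi>[of 0]] by (simp add: one_parameter_subgroupD(5)[OF \<phi>])
  have zero: "((snd d \<circ> ?h) has_vector_derivative 0) (at t)"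
    if t: "t \<in> I" and d: "d \<in> A" "?h t \<in> fst d" for t d
  proof -
    let ?a = "\<lambda>s. inv (\<gamma> t) \<otimes> \<gamma> s" and ?b = "\<lambda>s. \<phi> (t - s)"
    let ?k = "\<lambda>s. ?a s \<otimes> ?b s"
    have \<gamma>t: "\<gamma> t \<in> carrier G" "inv (\<gamma> t) \<in> carrier G" using \<gamma>c[OF t] by auto
    have cont_a: "continuous_map (top_of_set I) X ?a"
      by (rule continuous_map_mult[OF continuous_map_const_carrier[OF \<gamma>t(2)] cont_\<gamma>])
    have cont_k: "continuous_map (top_of_set I) X ?k"
      by (rule continuous_map_mult[OF cont_a cont_\<phi>])
    have kt: "?a t = \<one>" "?b t = \<one>" "?k t = \<one>" using \<gamma>t one_parameter_subgroupD(4)[OF \<phi>] by auto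
    let ?J = "{s \<in> I. ?a s \<in> fst base} \<inter> {s \<in> I. ?b s \<in> fst base}"
    have J: "open ?J" "t \<in> ?J"
      using open_curve_preimage[OF cont_a I(1) chart_domain[OF base(1)]]
        open_curve_preimage[OF cont_\<phi> I(1) chart_domain[OF base(1)]] t kt by auto
    have a': "((\<lambda>s. snd base (?a s)) has_vector_derivative ?Y) (at t)"
      using body_velocity[OF \<gamma>(1) I(1) t] body[OF t] by simp
    have b': "((\<lambda>s. snd base (?b s)) has_vector_derivative - ?Y) (at t)"
    proof -
      have "((snd base \<circ> \<phi>) has_vector_derivative ?Y) (at (t - t))"
        using one_parameter_subgroup_derivative[OF \<phi>] by simp
      moreover have "((\<lambda>s. t - s) has_vector_derivative - 1) (at t)"
        by (auto intro!: derivative_eq_intros)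
      ultimately show ?thesis
        using vector_diff_chain_at[of "\<lambda>s. t - s" "- 1" t "snd base \<circ> \<phi>"] by (simp add: o_def)
    qed
    have "((\<lambda>s. (snd base (?a s), snd base (?b s))) has_derivative (\<lambda>r. (r *\<^sub>R ?Y, r *\<^sub>R - ?Y))) (at t)"
      using a' b' unfolding has_vector_derivative_def by (rule has_derivative_Pair)
    moreover have "(local_mult base base base has_derivative (\<lambda>(a, b). a + b))
        (at (snd base (?a t), snd base (?b t)))"
      using derivative_local_mult_one by (simp only: kt)
    ultimately have "((\<lambda>s. local_mult base base base (snd base (?a s), snd base (?b s)))
        has_derivative (\<lambda>r. (\<lambda>(a, b). a + b) (r *\<^sub>R ?Y, r *\<^sub>R - ?Y))) (at t)"
      by (rule has_derivative_compose)
    then have "((\<lambda>s. local_mult base base base (snd base (?a s), snd base (?b s)))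
        has_vector_derivative 0) (at t)"
      by (simp add: has_vector_derivative_def)
    then have k': "((snd base \<circ> ?k) has_vector_derivative 0) (at t)"
      by (rule has_vector_derivative_transform_within_open[OF _ J]) (simp add: local_mult_def)
    have \<phi>t: "inv (\<phi> t) \<in> carrier G" using \<phi>c by simp
    obtain c where c: "c \<in> A" "?k t \<otimes> inv (\<phi> t) \<in> fst c"
      using obtain_chart topspace_carrier kt \<phi>t by (metis l_one)
    have "((snd c \<circ> ((\<lambda>k. k \<otimes> inv (\<phi> t)) \<circ> ?k)) has_vector_derivative
        jac (\<lambda>k. k \<otimes> inv (\<phi> t)) base c (?k t) 0) (at t)"
      using open_curve_preimage[OF cont_k I(1) chart_domain[OF base(1)]] t kt c
      by (intro push_curve[where J = "{s \<in> I. ?k s \<in> fst base}"] smooth_map_right[OF \<phi>t] k') auto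
    moreover have "jac (\<lambda>k. k \<otimes> inv (\<phi> t)) base c (?k t) 0 = 0"
      using c kt by (intro linear_0[OF linear_jac] smooth_map_right[OF \<phi>t]) auto
    ultimately have l': "((snd c \<circ> (\<lambda>s. ?k s \<otimes> inv (\<phi> t))) has_vector_derivative 0) (at t)"
      by (simp add: o_def)
    have eq: "\<gamma> t \<otimes> (?k s \<otimes> inv (\<phi> t)) = ?h s" if s: "s \<in> I" for s
    proof -
      have "\<gamma> t \<otimes> (?k s \<otimes> inv (\<phi> t)) = (\<gamma> t \<otimes> inv (\<gamma> t)) \<otimes> \<gamma> s \<otimes> (?b s \<otimes> inv (\<phi> t))"
        using \<gamma>t \<gamma>c[OF s] \<phi>c by (simp only: m_assoc m_closed inv_closed)
      also have "?b s \<otimes> inv (\<phi> t) = \<phi> (- s)"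
        using one_parameter_subgroupD(3)[OF \<phi>, of "t - s" "- t"]
          one_parameter_subgroupD(5)[OF \<phi>, of t] by simp
      finally show ?thesis
        using \<gamma>t \<gamma>c[OF s] one_parameter_subgroupD(5)[OF \<phi>, of s] by simp
    qed
    have cont_l: "continuous_map (top_of_set I) X (\<lambda>s. ?k s \<otimes> inv (\<phi> t))"
      by (rule continuous_map_mult[OF cont_k continuous_map_const_carrier[OF \<phi>t]])
    have "((snd d \<circ> ((\<lambda>k. \<gamma> t \<otimes> k) \<circ> (\<lambda>s. ?k s \<otimes> inv (\<phi> t)))) has_vector_derivative
        jac (\<lambda>k. \<gamma> t \<otimes> k) c d (?k t \<otimes> inv (\<phi> t)) 0) (at t)"
      using open_curve_preimage[OF cont_l I(1) chart_domain[OF c(1)]] t c d eq[OF t]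
      by (intro push_curve[where J = "{s \<in> I. ?k s \<otimes> inv (\<phi> t) \<in> fst c}"] smooth_map_left[OF \<gamma>t(1)] l') auto
    moreover have "jac (\<lambda>k. \<gamma> t \<otimes> k) c d (?k t \<otimes> inv (\<phi> t)) 0 = 0"
      using c d eq[OF t] by (intro linear_0[OF linear_jac] smooth_map_left[OF \<gamma>t(1)]) auto
    ultimately have "((snd d \<circ> ((\<lambda>k. \<gamma> t \<otimes> k) \<circ> (\<lambda>s. ?k s \<otimes> inv (\<phi> t)))) has_vector_derivative 0) (at t)"
      by simp
    then show ?thesis
      by (rule has_vector_derivative_transform_within_open[OF _ I(1) t]) (simp add: eq)
  qed
  have "?h constant_on I"
  proof (rule locally_constant_imp_constant[OF I(2)])
    fix t assume t: "t \<in> I"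
    then have "?h t \<in> topspace X" using continuous_map_carrier[OF cont_h] topspace_carrier by simp
    then obtain d where d: "d \<in> A" "?h t \<in> fst d" by (rule obtain_chart)
    let ?J = "{s \<in> I. ?h s \<in> fst d}"
    have "open ?J" by (rule open_curve_preimage[OF cont_h I(1) chart_domain[OF d(1)]])
    moreover have "t \<in> ?J" using t d by simp
    ultimately obtain \<epsilon> where \<epsilon>: "0 < \<epsilon>" "ball t \<epsilon> \<subseteq> ?J" by (meson openE)
    have "\<exists>y. \<forall>s\<in>ball t \<epsilon>. (snd d \<circ> ?h) s = y"
    proof (rule has_vector_derivative_zero_constant[OF convex_ball])
      fix s assume "s \<in> ball t \<epsilon>"
      then have s: "s \<in> I" "?h s \<in> fst d" using \<epsilon>(2) by auto
      show "((snd d \<circ> ?h) has_vector_derivative 0) (at s within ball t \<epsilon>)"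
        by (rule has_vector_derivative_at_within[OF zero[OF s(1) d(1) s(2)]])
    qed blast
    then obtain y where y: "\<And>s. s \<in> ball t \<epsilon> \<Longrightarrow> snd d (?h s) = y" by auto
    have "?h s = ?h t" if s: "s \<in> ball t \<epsilon>" for s
    proof (rule chart_inj[OF d(1)])
      show "?h s \<in> fst d" "?h t \<in> fst d" using s \<epsilon>(2) d by auto
      show "snd d (?h s) = snd d (?h t)" using y[OF s] y[of t] \<epsilon>(1) by simp
    qed
    moreover have "openin (top_of_set I) (ball t \<epsilon>)"
      using \<epsilon>(2) by (intro open_subset) auto
    moreover have "t \<in> ball t \<epsilon>" using \<epsilon>(1) by simp
    ultimately show "\<exists>T. openin (top_of_set I) T \<and> t \<in> T \<and> (\<forall>s\<in>T. ?h s = ?h t)"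
      by blast
  qed
  then show ?thesis using assms(5,6) by (auto simp: constant_on_def)
qed

lemma one_parameter_subgroup_unique:
  assumes "one_parameter_subgroup G X A \<phi>" "one_parameter_subgroup G X A \<psi>"
    and eq: "velocity A \<phi> 0 = velocity A \<psi> 0"
  shows "\<phi> = \<psi>"
proof
  fix t
  note \<phi> = one_parameter_subgroupD[OF assms(1)] and \<psi> = one_parameter_subgroupD[OF assms(2)]
  have "body (\<psi> s) (velocity A \<psi> s) = velocity A \<phi> 0 base" for s
    unfolding eq using \<psi> by (intro body_translate[OF assms(2) \<psi>(1), of _ \<one>]) auto
  from constant_body_curve[OF assms(1) \<psi>(1) _ this, of t 0]
  have "\<psi> t \<otimes> inv (\<phi> t) = \<one>"
    using \<phi>(4) \<psi>(4) by (simp add: open_interval_def is_interval_univ)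
  then show "\<phi> t = \<psi> t" using \<phi>(2) \<psi>(2) by (metis inv_closed inv_equality inv_inv)
qed

end

context lie_group
begin

lemma linear_left_field:
  assumes "c \<in> A" "p \<in> fst c"
  shows "linear (left_field c p)"
  unfolding left_field_def using assms chart_carrier[OF assms]
  by (intro linear_jac smooth_map_left) auto

lemma body_tvec:
  assumes "c \<in> charts_at A p"
  shows "body p (tvec c p y) = mc c p y"
  using body_eq[OF tvec_in[OF assms] assms] by (simp add: tvec_coord[OF assms])

lemma left_field_body:
  assumes "v \<in> tangent_space A p" "c \<in> charts_at A p"
  shows "v c = left_field c p (body p v)"
  using assms(2) by (simp add: body_eq[OF assms] mc_left_field charts_at_def)

lemma body_eq_0_iff:
  assumes "v \<in> tangent_space A p" "p \<in> carrier G"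
  shows "body p v = 0 \<longleftrightarrow> v = zero_tvec"
proof -
  obtain c where c: "c \<in> A" "p \<in> fst c" using assms(2) obtain_chart topspace_carrier by blast
  then have cp: "c \<in> charts_at A p" by (simp add: charts_at_def)
  have "v = zero_tvec" if "body p v = 0"
  proof (rule tangent_eqI[OF assms(1) zero_tvec_in cp])
    show "v c = zero_tvec c"
      using left_field_body[OF assms(1) cp] that linear_0[OF linear_left_field[OF c]]
      by (simp add: zero_tvec_def)
  qed
  moreover have "body p zero_tvec = 0"
    using body_eq[OF zero_tvec_in cp] linear_0[OF linear_mc[OF c]] by (simp add: zero_tvec_def)
  ultimately show ?thesis by blast
qed

lemma one_parameter_subgroup_scale:
  assumes \<phi>: "one_parameter_subgroup G X A \<phi>"
  shows "one_parameter_subgroup G X A (\<lambda>s. \<phi> (r * s))"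
    and "velocity A (\<lambda>s. \<phi> (r * s)) 0 = scale_tvec r (velocity A \<phi> 0)"
proof -
  note D = one_parameter_subgroupD[OF \<phi>]
  have cont: "continuous_map (top_of_set UNIV) X (\<lambda>s. \<phi> (r * s))"
  proof -
    have "continuous_map (top_of_set UNIV) (top_of_set UNIV) (\<lambda>s. r * s)"
      by (auto intro!: continuous_intros)
    from continuous_map_compose[OF this smooth_curve_continuous[OF D(1)]] show ?thesis
      by (simp add: o_def)
  qed
  have "smooth_on {s. \<phi> (r * s) \<in> fst d} (snd d \<circ> (\<lambda>s. \<phi> (r * s)))" if d: "d \<in> A" for d
  proof -
    have op: "open {s. \<phi> (r * s) \<in> fst d}"
      using open_curve_preimage[OF cont open_UNIV chart_domain[OF d]] by simp
    have "open {t. \<phi> t \<in> fst d}" "smooth_on {t. \<phi> t \<in> fst d} (snd d \<circ> \<phi>)"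
      using smooth_curve_chart[OF D(1) open_UNIV d] by simp_all
    from smooth_on_compose[OF op this smooth_on_bounded_linear[OF op bounded_linear_mult_right[of r]]]
    show ?thesis by (auto simp: o_def)
  qed
  moreover have "chart_inv (UNIV, id) = (id :: real \<Rightarrow> real)"
    by (simp add: chart_inv_def fun_eq_iff inv_id[unfolded id_def] id_def)
  ultimately have "smooth_curve X A UNIV (\<lambda>s. \<phi> (r * s))"
    using cont by (simp add: smooth_curve_def smooth_map_def)
  then show "one_parameter_subgroup G X A (\<lambda>s. \<phi> (r * s))"
    by (simp add: one_parameter_subgroup_def distrib_left D(3))
  show "velocity A (\<lambda>s. \<phi> (r * s)) 0 = scale_tvec r (velocity A \<phi> 0)"
  proof
    fix c
    show "velocity A (\<lambda>s. \<phi> (r * s)) 0 c = scale_tvec r (velocity A \<phi> 0) c"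
    proof (cases "c \<in> charts_at A (\<phi> 0)")
      case True
      then have "((snd c \<circ> \<phi>) has_vector_derivative velocity A \<phi> 0 c) (at (r * 0))"
        using smooth_curve_has_derivative[OF D(1) open_UNIV, of c 0] by (simp add: charts_at_def)
      moreover have "((\<lambda>s. r * s) has_vector_derivative r) (at 0)"
        by (auto intro!: derivative_eq_intros)
      ultimately have "((snd c \<circ> (\<lambda>s. \<phi> (r * s))) has_vector_derivative r *\<^sub>R velocity A \<phi> 0 c) (at 0)"
        using vector_diff_chain_at[of "\<lambda>s. r * s" r 0 "snd c \<circ> \<phi>"] by (simp add: o_def)
      then show ?thesis
        using True by (simp add: velocity_def scale_tvec_def vector_derivative_at)
    qed (simp add: velocity_def scale_tvec_def)
  qed
qed

lemma lie_exp_scale: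
  assumes "one_parameter_subgroup G X A \<phi>"
  shows "lie_exp G X A (scale_tvec t (velocity A \<phi> 0)) = \<phi> t"
proof -
  have "(THE \<psi>. one_parameter_subgroup G X A \<psi> \<and> velocity A \<psi> 0 = scale_tvec t (velocity A \<phi> 0))
      = (\<lambda>s. \<phi> (t * s))"
    using one_parameter_subgroup_scale[OF assms, of t] one_parameter_subgroup_unique
    by (intro the_equality) auto
  then show ?thesis by (simp add: lie_exp_def)
qed

text \<open>If no one-parameter subgroup had initial velocity \<open>v\<close>, none would have initial velocity
  \<open>scale_tvec t v\<close> for \<open>t \<noteq> 0\<close>, so \<open>lie_exp\<close> would take the same junk value at all these vectors
  and the corresponding geodesic would not be regular. Hence no existence theorem for differential
  equations is needed.\<close>

lemma one_parameter_subgroup_exists: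
  assumes S: "canonical_spray G X A S" and v: "v \<in> tangent_space A \<one>" "v \<noteq> zero_tvec"
  shows "\<exists>\<phi>. one_parameter_subgroup G X A \<phi> \<and> velocity A \<phi> 0 = v"
proof (rule ccontr)
  assume none: "\<not> ?thesis"
  let ?\<gamma> = "\<lambda>t. \<one> \<otimes> lie_exp G X A (scale_tvec t v)"
  have "(UNIV, ?\<gamma>) \<in> spray_geodesics X A S"
    using S v unfolding canonical_spray_def
    by (auto simp: open_interval_def is_interval_univ)
  then have reg: "(UNIV, ?\<gamma>) \<in> regular_curves X A" by (simp add: spray_geodesics_def)
  define junk where "junk = (THE \<phi> :: real \<Rightarrow> 'g. False) 1"
  have junk: "lie_exp G X A (scale_tvec t v) = junk" if "t \<noteq> 0" for t
  proof -
    have "\<not> (one_parameter_subgroup G X A \<phi> \<and> velocity A \<phi> 0 = scale_tvec t v)" for \<phi>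
    proof
      assume \<phi>: "one_parameter_subgroup G X A \<phi> \<and> velocity A \<phi> 0 = scale_tvec t v"
      have "scale_tvec (inverse t) (scale_tvec t v) = v"
        using that by (simp add: scale_tvec_def fun_eq_iff)
      then show False
        using one_parameter_subgroup_scale[of \<phi> "inverse t"] \<phi> none by metis
    qed
    then have "(\<lambda>\<phi>. one_parameter_subgroup G X A \<phi> \<and> velocity A \<phi> 0 = scale_tvec t v) = (\<lambda>\<phi>. False)"
      by blast
    then show ?thesis unfolding lie_exp_def junk_def by (rule arg_cong)
  qed
  have "velocity A ?\<gamma> 1 c = 0" for c
  proof (cases "c \<in> charts_at A (?\<gamma> 1)")
    case True
    have "((\<lambda>t. snd c (\<one> \<otimes> junk)) has_vector_derivative 0) (at (1::real))"
      by (rule has_vector_derivative_const)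
    then have "((snd c \<circ> ?\<gamma>) has_vector_derivative 0) (at 1)"
      by (rule has_vector_derivative_transform_within_open[of _ _ _ "{0<..}"]) (auto simp: junk)
    then show ?thesis using True by (simp add: velocity_def vector_derivative_at)
  qed (simp add: velocity_def)
  then have "velocity A ?\<gamma> 1 = zero_tvec" by (simp add: zero_tvec_def fun_eq_iff)
  then show False using reg by (auto simp: regular_curves_def)
qed

lemma one_parameter_subgroup_with_body:
  assumes S: "canonical_spray G X A S" and "Y \<noteq> 0"
  obtains \<phi> where "one_parameter_subgroup G X A \<phi>" "velocity A \<phi> 0 base = Y"
proof -
  have v: "tvec base \<one> Y \<in> tangent_space A \<one>" "tvec base \<one> Y \<noteq> zero_tvec"
    using tvec_in[OF base_charts_at] tvec_nonzero[OF base_charts_at] assms(2) by auto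
  obtain \<phi> where "one_parameter_subgroup G X A \<phi>" "velocity A \<phi> 0 = tvec base \<one> Y"
    using one_parameter_subgroup_exists[OF S v] by blast
  then show thesis using that tvec_coord[OF base_charts_at] by metis
qed

lemma spray_geodesics_translate:
  assumes S: "canonical_spray G X A S" and \<phi>: "one_parameter_subgroup G X A \<phi>"
    and nz: "velocity A \<phi> 0 base \<noteq> 0" and g: "g \<in> carrier G" and I: "open_interval I"
    and \<gamma>: "\<And>t. t \<in> I \<Longrightarrow> \<gamma> t = g \<otimes> \<phi> t"
  shows "(I, \<gamma>) \<in> spray_geodesics X A S"
proof -
  have "velocity A \<phi> 0 \<noteq> zero_tvec" using nz by (auto simp: zero_tvec_def)
  moreover have "\<forall>t\<in>I. \<gamma> t = g \<otimes> lie_exp G X A (scale_tvec t (velocity A \<phi> 0))"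
    using \<gamma> lie_exp_scale[OF \<phi>] by simp
  ultimately show ?thesis
    using S g I velocity_zero_in[OF \<phi>] unfolding canonical_spray_def by blast
qed

lemma spray_geodesics_iff:
  assumes S: "canonical_spray G X A S"
  shows "(I, \<gamma>) \<in> spray_geodesics X A S \<longleftrightarrow>
    (I, \<gamma>) \<in> regular_curves X A \<and> (\<exists>Y. \<forall>t\<in>I. body (\<gamma> t) (velocity A \<gamma> t) = Y)"
proof
  assume geo: "(I, \<gamma>) \<in> spray_geodesics X A S"
  then have reg: "(I, \<gamma>) \<in> regular_curves X A" by (simp add: spray_geodesics_def)
  from geo obtain g v where g: "g \<in> carrier G" and v: "v \<in> tangent_space A \<one>" "v \<noteq> zero_tvec"
    and \<gamma>: "\<And>t. t \<in> I \<Longrightarrow> \<gamma> t = g \<otimes> lie_exp G X A (scale_tvec t v)"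
    using S unfolding canonical_spray_def by auto
  obtain \<phi> where \<phi>: "one_parameter_subgroup G X A \<phi>" "velocity A \<phi> 0 = v"
    using one_parameter_subgroup_exists[OF S v] by blast
  have eq: "\<gamma> t = g \<otimes> \<phi> t" if "t \<in> I" for t
    using \<gamma>[OF that] lie_exp_scale[OF \<phi>(1), of t] \<phi>(2) by simp
  have "body (\<gamma> t) (velocity A \<gamma> t) = velocity A \<phi> 0 base" if "t \<in> I" for t
    using reg that g
    by (intro body_translate[OF \<phi>(1) _ _ _ eq]) (auto simp: regular_curves_def open_interval_def)
  then show "(I, \<gamma>) \<in> regular_curves X A \<and> (\<exists>Y. \<forall>t\<in>I. body (\<gamma> t) (velocity A \<gamma> t) = Y)"
    using reg by blast
next
  assume "(I, \<gamma>) \<in> regular_curves X A \<and> (\<exists>Y. \<forall>t\<in>I. body (\<gamma> t) (velocity A \<gamma> t) = Y)"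
  then obtain Y where reg: "(I, \<gamma>) \<in> regular_curves X A"
    and Y: "\<And>t. t \<in> I \<Longrightarrow> body (\<gamma> t) (velocity A \<gamma> t) = Y" by blast
  then have I: "open_interval I" "open I" and sm: "smooth_curve X A I \<gamma>"
    and nz: "\<And>t. t \<in> I \<Longrightarrow> velocity A \<gamma> t \<noteq> zero_tvec"
    by (auto simp: regular_curves_def open_interval_def)
  obtain t0 where t0: "t0 \<in> I" using I by (auto simp: open_interval_def)
  have \<gamma>c: "\<gamma> t \<in> carrier G" if "t \<in> I" for t using smooth_curve_carrier[OF sm that] .
  have "Y \<noteq> 0"
    using Y[OF t0] body_eq_0_iff[OF velocity_in[OF sm I(2) t0] \<gamma>c[OF t0]] nz[OF t0] by simp
  then obtain \<phi> where \<phi>: "one_parameter_subgroup G X A \<phi>" "velocity A \<phi> 0 base = Y"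
    using one_parameter_subgroup_with_body[OF S] by blast
  note \<phi>c = one_parameter_subgroupD(2)[OF \<phi>(1)]
  show "(I, \<gamma>) \<in> spray_geodesics X A S"
  proof (rule spray_geodesics_translate[OF S \<phi>(1) _ _ I(1)])
    show "velocity A \<phi> 0 base \<noteq> 0" using \<phi>(2) \<open>Y \<noteq> 0\<close> by simp
    show "\<gamma> t0 \<otimes> inv (\<phi> t0) \<in> carrier G" using \<gamma>c[OF t0] \<phi>c by simp
    fix t assume t: "t \<in> I"
    have "\<gamma> t \<otimes> inv (\<phi> t) = \<gamma> t0 \<otimes> inv (\<phi> t0)"
      using Y \<phi>(2) t t0 by (intro constant_body_curve[OF \<phi>(1) sm I(1)]) auto
    then show "\<gamma> t = \<gamma> t0 \<otimes> inv (\<phi> t0) \<otimes> \<phi> t"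
      using \<gamma>c[OF t] \<phi>c[of t] inv_solve_right'[of "\<gamma> t0 \<otimes> inv (\<phi> t0)" "\<gamma> t" "\<phi> t"] \<gamma>c[OF t0] \<phi>c[of t0]
      by (metis inv_closed inv_solve_right m_closed)
  qed
qed

lemma spray_geodesic_through:
  assumes S: "canonical_spray G X A S" and p: "p \<in> carrier G" and Y: "Y \<noteq> 0"
  obtains \<gamma> where "(UNIV, \<gamma>) \<in> spray_geodesics X A S" "\<gamma> 0 = p"
    "\<And>t. body (\<gamma> t) (velocity A \<gamma> t) = Y"
proof -
  obtain \<phi> where \<phi>: "one_parameter_subgroup G X A \<phi>" "velocity A \<phi> 0 base = Y"
    using one_parameter_subgroup_with_body[OF S Y] by blast
  let ?\<gamma> = "\<lambda>t. p \<otimes> \<phi> t"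
  have geo: "(UNIV, ?\<gamma>) \<in> spray_geodesics X A S"
    using \<phi> Y p by (intro spray_geodesics_translate[OF S \<phi>(1)])
      (auto simp: open_interval_def is_interval_univ)
  then have "smooth_curve X A UNIV ?\<gamma>" by (simp add: spray_geodesics_def regular_curves_def)
  then have "body (?\<gamma> t) (velocity A ?\<gamma> t) = Y" for t
    using body_translate[OF \<phi>(1) _ open_UNIV, of ?\<gamma> t p] p \<phi>(2) by simp
  moreover have "?\<gamma> 0 = p" using one_parameter_subgroupD(4)[OF \<phi>(1)] p by simp
  ultimately show thesis using geo that by blast
qed

end

section \<open>Left-invariant energies\<close>

lemma partial_y_slice:
  assumes "F differentiable (at (x, y))"
  shows "partial_y k F (x, y) = frechet_derivative (\<lambda>y. F (x, y)) (at y) k"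
proof -
  have "((\<lambda>y. (x, y)) has_derivative (\<lambda>k. (0, k))) (at y)"
    by (intro has_derivative_Pair has_derivative_const has_derivative_ident)
  from has_derivative_compose[OF this has_derivative_frechet[OF assms]]
  have "((\<lambda>y. F (x, y)) has_derivative (\<lambda>k. frechet_derivative F (at (x, y)) (0, k))) (at y)" .
  from frechet_derivative_at[OF this] show ?thesis unfolding partial_y_def by metis
qed

lemma open_nonzero: "open (- {0 :: 'a::real_normed_vector})"
  by (simp add: open_Compl)

lemma homogeneous_derivative:
  fixes e :: "'a::euclidean_space \<Rightarrow> real"
  assumes e: "smooth_on (- {0}) e" and hom: "\<And>t y. 0 < t \<Longrightarrow> e (t *\<^sub>R y) = t\<^sup>2 * e y"
    and t: "0 < t" and w: "w \<noteq> 0"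
  shows "frechet_derivative e (at (t *\<^sub>R w)) v = t * frechet_derivative e (at w) v"
proof -
  have De: "(e has_derivative frechet_derivative e (at y)) (at y)" if "y \<noteq> 0" for y
    using smooth_on_has_derivative[OF e] that by simp
  have "((\<lambda>y. t *\<^sub>R y) has_derivative (\<lambda>h. t *\<^sub>R h)) (at w)"
    by (intro has_derivative_scaleR_right has_derivative_ident)
  moreover have "(e has_derivative frechet_derivative e (at (t *\<^sub>R w))) (at (t *\<^sub>R w))"
    using t w by (intro De) simp
  ultimately have "((\<lambda>y. e (t *\<^sub>R y)) has_derivative (\<lambda>h. frechet_derivative e (at (t *\<^sub>R w)) (t *\<^sub>R h))) (at w)"
    by (rule has_derivative_compose)
  moreover have "((\<lambda>y. t\<^sup>2 * e y) has_derivative (\<lambda>h. t\<^sup>2 * frechet_derivative e (at w) h)) (at w)"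
    by (intro has_derivative_mult_right De w)
  ultimately have "frechet_derivative e (at (t *\<^sub>R w)) (t *\<^sub>R v) = t\<^sup>2 * frechet_derivative e (at w) v"
    unfolding hom[OF t] by (metis has_derivative_unique)
  moreover have "linear (frechet_derivative e (at (t *\<^sub>R w)))"
    using t w by (intro has_derivative_linear[OF De]) simp
  ultimately show ?thesis using t by (simp add: linear_scale power2_eq_square)
qed

lemma homogeneous_euler:
  fixes e :: "'a::euclidean_space \<Rightarrow> real"
  assumes e: "smooth_on (- {0}) e" and hom: "\<And>t y. 0 < t \<Longrightarrow> e (t *\<^sub>R y) = t\<^sup>2 * e y"
    and w: "w \<noteq> 0"
  shows "frechet_derivative e (at w) w = 2 * e w"
proof -
  have "((\<lambda>t. t *\<^sub>R w) has_derivative (\<lambda>r. r *\<^sub>R w)) (at (1::real))"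
    by (intro has_derivative_scaleR_left has_derivative_ident)
  moreover have "(e has_derivative frechet_derivative e (at w)) (at (1 *\<^sub>R w))"
    using smooth_on_has_derivative[OF e, of w] w by simp
  ultimately have 1: "((\<lambda>t. e (t *\<^sub>R w)) has_derivative (\<lambda>r. frechet_derivative e (at w) (r *\<^sub>R w))) (at 1)"
    by (rule has_derivative_compose)
  have "((\<lambda>t. t\<^sup>2 * e w) has_derivative (\<lambda>r. 2 * r * e w)) (at 1)"
    by (auto intro!: derivative_eq_intros)
  then have "((\<lambda>t. e (t *\<^sub>R w)) has_derivative (\<lambda>r. 2 * r * e w)) (at 1)"
    by (rule has_derivative_transform_within_open[of _ _ _ _ "{0<..}"]) (auto simp: hom)
  from fun_cong[OF has_derivative_unique[OF 1 this], of 1] show ?thesis by simp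
qed

lemma homogeneous_positive:
  fixes e :: "'a::euclidean_space \<Rightarrow> real"
  assumes e: "smooth_on (- {0}) e" and hom: "\<And>t y. 0 < t \<Longrightarrow> e (t *\<^sub>R y) = t\<^sup>2 * e y"
    and w: "w \<noteq> 0"
    and hess: "0 < (\<Sum>i\<in>Basis. \<Sum>j\<in>Basis.
      frechet_derivative (\<lambda>y. frechet_derivative e (at y) j) (at w) i * (w \<bullet> i) * (w \<bullet> j))"
  shows "0 < e w"
proof -
  let ?g = "\<lambda>j y. frechet_derivative e (at y) j"
  have Dg: "(?g j has_derivative frechet_derivative (?g j) (at w)) (at w)" for j
    using smooth_on_has_derivative[OF smooth_on_frechet[OF e], of w] w by simp
  have "((\<lambda>t. t *\<^sub>R w) has_derivative (\<lambda>r. r *\<^sub>R w)) (at (1::real))"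
    by (intro has_derivative_scaleR_left has_derivative_ident)
  moreover have "(?g w has_derivative frechet_derivative (?g w) (at w)) (at (1 *\<^sub>R w))"
    using Dg by simp
  ultimately have 1: "((\<lambda>t. ?g w (t *\<^sub>R w)) has_derivative (\<lambda>r. frechet_derivative (?g w) (at w) (r *\<^sub>R w))) (at 1)"
    by (rule has_derivative_compose)
  have "((\<lambda>t. t * (2 * e w)) has_derivative (\<lambda>r. r * (2 * e w))) (at 1)"
    by (auto intro!: derivative_eq_intros)
  then have "((\<lambda>t. ?g w (t *\<^sub>R w)) has_derivative (\<lambda>r. r * (2 * e w))) (at 1)"
    by (rule has_derivative_transform_within_open[of _ _ _ _ "{0<..}"])
      (auto simp: homogeneous_derivative[OF e hom _ w] homogeneous_euler[OF e hom w])
  from fun_cong[OF has_derivative_unique[OF 1 this], of 1]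
  have euler: "frechet_derivative (?g w) (at w) w = 2 * e w" by simp
  have "((\<lambda>y. \<Sum>j\<in>Basis. (w \<bullet> j) * ?g j y) has_derivative
      (\<lambda>h. \<Sum>j\<in>Basis. (w \<bullet> j) * frechet_derivative (?g j) (at w) h)) (at w)"
    by (intro has_derivative_sum has_derivative_mult_right Dg)
  then have "(?g w has_derivative (\<lambda>h. \<Sum>j\<in>Basis. (w \<bullet> j) * frechet_derivative (?g j) (at w) h)) (at w)"
  proof (rule has_derivative_transform_within_open[OF _ open_nonzero])
    show "w \<in> - {0}" using w by simp
    fix y :: 'a assume "y \<in> - {0}"
    then have "linear (frechet_derivative e (at y))"
      using smooth_on_has_derivative[OF e] by (intro has_derivative_linear) auto
    from linear_expand_Basis[OF this, of w]
    show "(\<Sum>j\<in>Basis. (w \<bullet> j) * ?g j y) = ?g w y" by simp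
  qed
  from fun_cong[OF has_derivative_unique[OF Dg this], of w]
  have "frechet_derivative (?g w) (at w) w = (\<Sum>j\<in>Basis. (w \<bullet> j) * frechet_derivative (?g j) (at w) w)" .
  also have "\<dots> = (\<Sum>j\<in>Basis. \<Sum>i\<in>Basis. frechet_derivative (?g j) (at w) i * (w \<bullet> i) * (w \<bullet> j))"
  proof (rule sum.cong[OF refl])
    fix j :: 'a
    have "frechet_derivative (?g j) (at w) w = (\<Sum>i\<in>Basis. (w \<bullet> i) *\<^sub>R frechet_derivative (?g j) (at w) i)"
      by (rule linear_expand_Basis[OF has_derivative_linear[OF Dg]])
    then show "(w \<bullet> j) * frechet_derivative (?g j) (at w) w
        = (\<Sum>i\<in>Basis. frechet_derivative (?g j) (at w) i * (w \<bullet> i) * (w \<bullet> j))"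
      by (simp add: sum_distrib_left mult_ac)
  qed
  also have "\<dots> = (\<Sum>i\<in>Basis. \<Sum>j\<in>Basis. frechet_derivative (?g j) (at w) i * (w \<bullet> i) * (w \<bullet> j))"
    by (rule sum.swap)
  finally show ?thesis using hess euler by simp
qed

lemma homogeneous_bounds:
  fixes e :: "'a::euclidean_space \<Rightarrow> real"
  assumes e: "continuous_on (- {0}) e" and hom: "\<And>t y. 0 < t \<Longrightarrow> e (t *\<^sub>R y) = t\<^sup>2 * e y"
    and pos: "\<And>y. y \<noteq> 0 \<Longrightarrow> 0 < e y"
  shows "\<exists>c C. 0 < c \<and> (\<forall>y. c * (norm y)\<^sup>2 \<le> e y) \<and> (\<forall>y. e y \<le> C * (norm y)\<^sup>2)"
proof -
  let ?S = "sphere (0::'a) 1"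
  obtain i :: 'a where "i \<in> Basis" using nonempty_Basis by blast
  then have ne: "?S \<noteq> {}" by (auto intro: exI[of _ i] simp: norm_Basis)
  have cont: "continuous_on ?S e" by (rule continuous_on_subset[OF e]) auto
  obtain u where u: "u \<in> ?S" "\<And>y. y \<in> ?S \<Longrightarrow> e u \<le> e y"
    using continuous_attains_inf[OF compact_sphere ne cont] by blast
  obtain v where v: "\<And>y. y \<in> ?S \<Longrightarrow> e y \<le> e v"
    using continuous_attains_sup[OF compact_sphere ne cont] by blast
  have "e 0 = 0" using hom[of 2 0] by simp
  have "e u * (norm y)\<^sup>2 \<le> e y \<and> e y \<le> e v * (norm y)\<^sup>2" for y
  proof (cases "y = 0")
    case False
    then have "e y = (norm y)\<^sup>2 * e (y /\<^sub>R norm y)"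
      using hom[of "norm y" "y /\<^sub>R norm y"] by simp
    moreover have "e u \<le> e (y /\<^sub>R norm y)" "e (y /\<^sub>R norm y) \<le> e v"
      using u v False by simp_all
    ultimately show ?thesis by (metis mult.commute mult_left_mono zero_le_power2)
  qed (simp add: \<open>e 0 = 0\<close>)
  moreover have "0 < e u" using u(1) by (intro pos) auto
  ultimately show ?thesis by blast
qed

context smooth_manifold
begin

lemma tangent_chart_inv:
  assumes c: "c \<in> A" and x: "x \<in> chart_image c"
  shows "chart_inv (tangent_chart A c) (x, y) = (chart_inv c x, tvec c (chart_inv c x) y)"
proof -
  let ?p = "chart_inv c x"
  have p: "?p \<in> fst c" "c \<in> charts_at A ?p" using chart_inv_in[OF x] c by (auto simp: charts_at_def)
  have "inj_on (snd (tangent_chart A c)) (fst (tangent_chart A c))"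
  proof (rule inj_onI)
    fix z z' assume z: "z \<in> fst (tangent_chart A c)" "z' \<in> fst (tangent_chart A c)"
      and eq: "snd (tangent_chart A c) z = snd (tangent_chart A c) z'"
    obtain q v q' v' where zv: "z = (q, v)" "z' = (q', v')" by fastforce
    have "q = q'" using z eq c unfolding zv by (auto simp: tangent_chart_def intro: chart_inj)
    moreover have "v = v'"
      by (rule tangent_eqI[of _ q _ c])
        (use z eq c \<open>q = q'\<close> in \<open>auto simp: zv tangent_chart_def tangent_bundle_def charts_at_def\<close>)
    ultimately show "z = z'" by (simp add: zv)
  qed
  moreover have "(?p, tvec c ?p y) \<in> fst (tangent_chart A c)"
    using p tvec_in[OF p(2)] c by (auto simp: tangent_chart_def tangent_bundle_def points_def)
  moreover have "snd (tangent_chart A c) (?p, tvec c ?p y) = (x, y)"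
    using tvec_coord[OF p(2)] chart_of_inv[OF x] by (simp add: tangent_chart_def)
  ultimately show ?thesis unfolding chart_inv_def by (intro inv_into_f_eq)
qed

lemma slit_chart_image:
  assumes c: "c \<in> A"
  shows "chart_image (slit_chart A c) = chart_image c \<times> - {0}"
proof
  show "chart_image (slit_chart A c) \<subseteq> chart_image c \<times> - {0}"
  proof
    fix z assume "z \<in> chart_image (slit_chart A c)"
    then obtain p v where p: "p \<in> fst c" "v \<in> tangent_space A p" "v \<noteq> zero_tvec" and z: "z = (snd c p, v c)"
      by (auto simp: chart_image_def slit_chart_def slit_tangent_bundle_def tangent_bundle_def)
    have "c \<in> charts_at A p" using p c by (simp add: charts_at_def)
    then have "v c \<noteq> 0" using p tvec_eq tvec_nonzero by metis
    then show "z \<in> chart_image c \<times> - {0}" using p z by (simp add: chart_in_image)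
  qed
  show "chart_image c \<times> - {0} \<subseteq> chart_image (slit_chart A c)"
  proof
    fix z :: "'e \<times> 'e" assume "z \<in> chart_image c \<times> - {0}"
    then obtain x y where z: "z = (x, y)" "x \<in> chart_image c" "y \<noteq> 0" by auto
    let ?p = "chart_inv c x"
    have p: "?p \<in> fst c" "c \<in> charts_at A ?p" using chart_inv_in[OF z(2)] c by (auto simp: charts_at_def)
    then have "(?p, tvec c ?p y) \<in> fst (slit_chart A c)"
      using tvec_in[OF p(2)] tvec_nonzero[OF p(2), of y] z(3) c
      by (auto simp: slit_chart_def slit_tangent_bundle_def tangent_bundle_def points_def)
    moreover have "z = snd (slit_chart A c) (?p, tvec c ?p y)"
      using tvec_coord[OF p(2)] chart_of_inv[OF z(2)] z(1) by (simp add: slit_chart_def)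
    ultimately show "z \<in> chart_image (slit_chart A c)"
      unfolding chart_image_def[of "slit_chart A c"] by (rule rev_image_eqI)
  qed
qed

lemma coord_expr_eq:
  "c \<in> A \<Longrightarrow> x \<in> chart_image c \<Longrightarrow>
    coord_expr A E c (x, y) = E (chart_inv c x, tvec c (chart_inv c x) y)"
  by (simp add: coord_expr_def tangent_chart_inv)

end

context lie_group
begin

lemma coord_expr_body:
  assumes c: "c \<in> A" and x: "x \<in> chart_image c"
    and E: "\<And>p v. p \<in> carrier G \<Longrightarrow> v \<in> tangent_space A p \<Longrightarrow> E (p, v) = e (body p v)"
  shows "coord_expr A E c (x, y) = e (maurer_cartan c (x, y))"
proof -
  have p: "c \<in> charts_at A (chart_inv c x)" using chart_inv_in[OF x] c by (simp add: charts_at_def)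
  then show ?thesis
    using E[OF chart_inv_carrier[OF c x] tvec_in[OF p]] body_tvec[OF p]
    by (simp add: coord_expr_eq[OF c x] maurer_cartan_def)
qed

lemma left_invariant_energy:
  assumes E: "left_invariant G A E" and p: "p \<in> carrier G" and v: "v \<in> tangent_space A p"
  shows "E (p, v) = E (\<one>, tvec base \<one> (body p v))"
proof -
  obtain c where c: "c \<in> charts_at A p"
    using p obtain_chart topspace_carrier by (metis (no_types, lifting) charts_at_def mem_Collect_eq)
  have b: "base \<in> charts_at A (inv p \<otimes> p)" using base_charts_at p by simp
  have "(p, v) \<in> tangent_bundle A"
    using p v covering topspace_carrier by (simp add: tangent_bundle_def)
  then have "E (inv p \<otimes> p, differential A A (\<lambda>k. inv p \<otimes> k) p v) = E (p, v)"
    using E inv_closed[OF p] unfolding left_invariant_def by blast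
  moreover have "differential A A (\<lambda>k. inv p \<otimes> k) p v = tvec base \<one> (body p v)"
    using differential_eq[OF smooth_map_left v c b] p body_eq[OF v c] by (simp add: mc_def)
  ultimately show ?thesis using p by simp
qed

lemma euler_lagrange_body:
  assumes e: "\<And>Y. Y \<noteq> 0 \<Longrightarrow> (e has_derivative e' Y) (at Y)"
    and e': "\<And>Y v. Y \<noteq> 0 \<Longrightarrow> (\<lambda>Y. e' Y v) differentiable (at Y)"
    and E: "\<And>p v. p \<in> carrier G \<Longrightarrow> v \<in> tangent_space A p \<Longrightarrow> E (p, v) = e (body p v)"
    and reg: "(I, \<gamma>) \<in> regular_curves X A" and t: "t \<in> I" and c: "c \<in> charts_at A (\<gamma> t)"
  shows "(\<forall>i\<in>Basis.
       let lift = (\<lambda>s. (snd c (\<gamma> s), vector_derivative (snd c \<circ> \<gamma>) (at s)))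
       in ((\<lambda>s. partial_y i (coord_expr A E c) (lift s)) has_real_derivative
             partial_x i (coord_expr A E c) (lift t)) (at t)) \<longleftrightarrow>
    (\<forall>w. ((\<lambda>s. e' (body (\<gamma> s) (velocity A \<gamma> s)) (mc c (\<gamma> t) w)) has_real_derivative
        e' (body (\<gamma> t) (velocity A \<gamma> t))
          (coframe.exterior (maurer_cartan c) (snd c (\<gamma> t)) w (velocity A \<gamma> t c))) (at t))"
proof -
  have I: "open I" and sm: "smooth_curve X A I \<gamma>"
    and nz: "\<And>s. s \<in> I \<Longrightarrow> velocity A \<gamma> s \<noteq> zero_tvec"
    using reg by (auto simp: regular_curves_def open_interval_def)
  have cA: "c \<in> A" "\<gamma> t \<in> fst c" using c by (auto simp: charts_at_def)
  let ?J = "{s \<in> I. \<gamma> s \<in> fst c}" and ?x = "snd c \<circ> \<gamma>"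
  let ?x' = "\<lambda>s. vector_derivative ?x (at s)"
  have J: "open ?J" "t \<in> ?J" and smx: "smooth_on ?J ?x"
    using smooth_curve_chart[OF sm I cA(1)] t cA(2) by auto
  have vel: "?x' s = velocity A \<gamma> s c" if "s \<in> ?J" for s
    using that cA(1) by (simp add: velocity_def charts_at_def)
  have body: "maurer_cartan c (?x s, ?x' s) = body (\<gamma> s) (velocity A \<gamma> s)" if s: "s \<in> ?J" for s
    using body_eq[OF velocity_in[OF sm I], of s c] s cA(1)
    by (simp add: vel[OF s] maurer_cartan_def charts_at_def)
  have x': "\<exists>x''. (?x' has_vector_derivative x'') (at t)"
  proof -
    have "(\<lambda>s. frechet_derivative ?x (at s) 1) differentiable (at t)"
      by (rule smooth_onD[OF smooth_on_frechet[OF smx] J(2)])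
    then obtain x'' where "((\<lambda>s. frechet_derivative ?x (at s) 1) has_vector_derivative x'') (at t)"
      using vector_derivative_works by blast
    then have "(?x' has_vector_derivative x'') (at t)"
    proof (rule has_vector_derivative_transform_within_open[OF _ J])
      fix s assume "s \<in> ?J"
      then have "?x differentiable (at s)" by (rule smooth_onD[OF smx])
      from frechet_derivative_eq_vector_derivative[OF this]
      show "frechet_derivative ?x (at s) 1 = ?x' s" by simp
    qed
    then show ?thesis by blast
  qed
  then obtain x'' where x'': "(?x' has_vector_derivative x'') (at t)" by blast
  interpret coframe "chart_image c" "maurer_cartan c" by (rule coframe_maurer_cartan[OF cA(1)])
  have bnz: "maurer_cartan c (?x s, ?x' s) \<noteq> 0" if s: "s \<in> ?J" for s
    unfolding body[OF s]
    using body_eq_0_iff[OF velocity_in[OF sm I] smooth_curve_carrier[OF sm], of s] nz[of s] s by auto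
  have "(\<forall>i\<in>Basis. ((\<lambda>s. partial_y i (coord_expr A E c) (?x s, ?x' s)) has_real_derivative
            partial_x i (coord_expr A E c) (?x t, ?x' t)) (at t)) \<longleftrightarrow>
         (\<forall>w. ((\<lambda>s. e' (maurer_cartan c (?x s, ?x' s)) (maurer_cartan c (?x t, w))) has_real_derivative
            e' (maurer_cartan c (?x t, ?x' t)) (exterior (?x t) w (?x' t))) (at t))"
  proof (rule euler_lagrange_iff[OF e e' _ J _ _ x'' bnz])
    show "coord_expr A E c (x, y) = e (maurer_cartan c (x, y))" if "x \<in> chart_image c" for x y
      using cA(1) that E by (rule coord_expr_body)
    show "?x s \<in> chart_image c" if "s \<in> ?J" for s using that by (simp add: chart_in_image)
    show "(?x has_vector_derivative ?x' t) (at t)"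
      using smooth_onD[OF smx J(2)] by (simp add: vector_derivative_works)
  qed
  also have "\<dots> \<longleftrightarrow> (\<forall>w. ((\<lambda>s. e' (body (\<gamma> s) (velocity A \<gamma> s)) (mc c (\<gamma> t) w)) has_real_derivative
        e' (body (\<gamma> t) (velocity A \<gamma> t)) (exterior (snd c (\<gamma> t)) w (velocity A \<gamma> t c))) (at t))"
  proof (rule all_cong1)
    fix w
    have mc: "maurer_cartan c (?x t, w) = mc c (\<gamma> t) w" using cA by (simp add: maurer_cartan_def)
    have "((\<lambda>s. e' (maurer_cartan c (?x s, ?x' s)) (mc c (\<gamma> t) w)) has_real_derivative r) (at t) \<longleftrightarrow>
        ((\<lambda>s. e' (body (\<gamma> s) (velocity A \<gamma> s)) (mc c (\<gamma> t) w)) has_real_derivative r) (at t)" for r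
    proof
      assume "((\<lambda>s. e' (maurer_cartan c (?x s, ?x' s)) (mc c (\<gamma> t) w)) has_real_derivative r) (at t)"
      then show "((\<lambda>s. e' (body (\<gamma> s) (velocity A \<gamma> s)) (mc c (\<gamma> t) w)) has_real_derivative r) (at t)"
        by (rule has_field_derivative_transform_within_open[OF _ J]) (simp only: body)
    next
      assume "((\<lambda>s. e' (body (\<gamma> s) (velocity A \<gamma> s)) (mc c (\<gamma> t) w)) has_real_derivative r) (at t)"
      then show "((\<lambda>s. e' (maurer_cartan c (?x s, ?x' s)) (mc c (\<gamma> t) w)) has_real_derivative r) (at t)"
        by (rule has_field_derivative_transform_within_open[OF _ J]) (simp only: body)
    qed
    then show "((\<lambda>s. e' (maurer_cartan c (?x s, ?x' s)) (maurer_cartan c (?x t, w))) has_real_derivative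
            e' (maurer_cartan c (?x t, ?x' t)) (exterior (?x t) w (?x' t))) (at t) \<longleftrightarrow>
        ((\<lambda>s. e' (body (\<gamma> s) (velocity A \<gamma> s)) (mc c (\<gamma> t) w)) has_real_derivative
        e' (body (\<gamma> t) (velocity A \<gamma> t)) (exterior (snd c (\<gamma> t)) w (velocity A \<gamma> t c))) (at t)"
      unfolding mc vel[OF J(2)] using body[OF J(2), unfolded vel[OF J(2)]] by (simp only: o_apply)
  qed
  finally show ?thesis by (simp only: Let_def o_apply)
qed

end

section \<open>Left-invariant metrizability\<close>

context lie_group
begin

lemma body_scale:
  assumes "v \<in> tangent_space A p" "p \<in> carrier G"
  shows "body p (scale_tvec r v) = r *\<^sub>R body p v"
proof -
  obtain c where c: "c \<in> A" "p \<in> fst c" using assms(2) obtain_chart topspace_carrier by blast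
  then have cp: "c \<in> charts_at A p" by (simp add: charts_at_def)
  show ?thesis
    unfolding body_eq[OF assms(1) cp] body_eq[OF scale_tvec_in[OF assms(1)] cp]
    by (simp add: linear_scale[OF linear_mc[OF c]] scale_tvec_def)
qed

lemma velocity_reparam:
  assumes \<gamma>: "smooth_curve X A I \<gamma>" "open I" "\<theta> s \<in> I" and \<theta>: "(\<theta> has_real_derivative r) (at s)"
  shows "velocity A (\<gamma> \<circ> \<theta>) s = scale_tvec r (velocity A \<gamma> (\<theta> s))"
proof
  fix c
  show "velocity A (\<gamma> \<circ> \<theta>) s c = scale_tvec r (velocity A \<gamma> (\<theta> s)) c"
  proof (cases "c \<in> charts_at A (\<gamma> (\<theta> s))")
    case True
    then have "((snd c \<circ> \<gamma>) has_vector_derivative velocity A \<gamma> (\<theta> s) c) (at (\<theta> s))"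
      using smooth_curve_has_derivative[OF \<gamma>(1,2), of c "\<theta> s"] \<gamma>(3) by (simp add: charts_at_def)
    moreover have "(\<theta> has_vector_derivative r) (at s)"
      using \<theta> by (simp add: has_real_derivative_iff_has_vector_derivative)
    ultimately have "((snd c \<circ> (\<gamma> \<circ> \<theta>)) has_vector_derivative r *\<^sub>R velocity A \<gamma> (\<theta> s) c) (at s)"
      using vector_diff_chain_at[of \<theta> r s "snd c \<circ> \<gamma>"] by (simp add: o_assoc)
    then show ?thesis
      using True by (simp add: velocity_def[of A "\<gamma> \<circ> \<theta>"] scale_tvec_def vector_derivative_at)
  qed (simp add: velocity_def scale_tvec_def)
qed

lemma finsler_restriction:
  assumes E: "finsler_metric A E"
  defines "e \<equiv> \<lambda>y. E (\<one>, tvec base \<one> y)"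
  shows "smooth_on (- {0}) e"
    and "0 < t \<Longrightarrow> e (t *\<^sub>R y) = t\<^sup>2 * e y"
    and "w \<noteq> 0 \<Longrightarrow> 0 < e w"
proof -
  let ?u = "snd base \<one>" and ?L = "coord_expr A E base"
  have u: "?u \<in> chart_image base" by (simp add: chart_in_image)
  have L: "?L (?u, y) = e y" for y
    using coord_expr_eq[OF base(1) u, of E y] by (simp add: e_def)
  have slit: "chart_image (slit_chart A base) = chart_image base \<times> - {0}"
    by (rule slit_chart_image[OF base(1)])
  have op: "open (chart_image base \<times> - {0 :: 'e})"
    by (intro open_Times open_nonzero chart_image_open base(1))
  have smL: "smooth_on (chart_image base \<times> - {0}) ?L"
    using E base(1) slit unfolding finsler_metric_def by metis
  have "smooth_on (- {0}) (\<lambda>y::'e. ?L (?u, y))"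
    using u by (intro smooth_on_compose[OF open_nonzero op smL] smooth_on_Pair open_nonzero
        smooth_on_const smooth_on_id) auto
  then show sme: "smooth_on (- {0}) e" by (simp add: L)
  show hom: "e (t *\<^sub>R y) = t\<^sup>2 * e y" if "0 < t" for t y
  proof -
    have "tvec base \<one> (t *\<^sub>R y) = scale_tvec t (tvec base \<one> y)"
      by (rule tangent_eqI[OF tvec_in[OF base_charts_at] scale_tvec_in[OF tvec_in[OF base_charts_at]]
            base_charts_at])
        (simp add: tvec_coord[OF base_charts_at] scale_tvec_def)
    moreover have "(\<one>, tvec base \<one> y) \<in> tangent_bundle A"
      using tvec_in[OF base_charts_at] covering topspace_carrier by (simp add: tangent_bundle_def)
    ultimately show ?thesis
      using E that unfolding finsler_metric_def e_def by fastforce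
  qed
  show "0 < e w" if w: "w \<noteq> 0" for w
  proof (rule homogeneous_positive[OF sme hom w])
    have uw: "(?u, w) \<in> chart_image base \<times> - {0}" using u w by simp
    have "partial_y i (partial_y j ?L) (?u, w)
        = frechet_derivative (\<lambda>y. frechet_derivative e (at y) j) (at w) i" for i j
    proof -
      have smp: "smooth_on (chart_image base \<times> - {0}) (partial_y j ?L)"
        unfolding partial_y_def[abs_def] by (rule smooth_on_frechet[OF smL])
      have "partial_y i (partial_y j ?L) (?u, w) = frechet_derivative (\<lambda>y. partial_y j ?L (?u, y)) (at w) i"
        by (rule partial_y_slice[OF smooth_onD[OF smp uw]])
      also have "frechet_derivative (\<lambda>y. partial_y j ?L (?u, y)) (at w)
          = frechet_derivative (\<lambda>y. frechet_derivative e (at y) j) (at w)"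
      proof (rule sym, rule frechet_derivative_transform_within_open[OF _ open_nonzero])
        show "(\<lambda>y. frechet_derivative e (at y) j) differentiable (at w)"
          using smooth_onD[OF smooth_on_frechet[OF sme]] w by simp
        show "w \<in> - {0}" using w by simp
        fix y :: 'e assume y: "y \<in> - {0}"
        have "partial_y j ?L (?u, y) = frechet_derivative (\<lambda>y. ?L (?u, y)) (at y) j"
          using y u by (intro partial_y_slice smooth_onD[OF smL]) auto
        then show "frechet_derivative e (at y) j = partial_y j ?L (?u, y)" by (simp add: L)
      qed
      finally show ?thesis .
    qed
    moreover have "0 < (\<Sum>i\<in>Basis. \<Sum>j\<in>Basis. partial_y i (partial_y j ?L) (?u, w) * (w \<bullet> i) * (w \<bullet> j))"
      using E base(1) uw w unfolding finsler_metric_def slit[symmetric] by blast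
    ultimately show "0 < (\<Sum>i\<in>Basis. \<Sum>j\<in>Basis.
        frechet_derivative (\<lambda>y. frechet_derivative e (at y) j) (at w) i * (w \<bullet> i) * (w \<bullet> j))"
      by simp
  qed
qed

text \<open>Along a reparameterized geodesic of the spray the trivialized velocity is \<open>\<theta>' Y\<close>. The
  Euler-Lagrange equation in the direction of the velocity itself forces \<open>\<theta>'' = 0\<close>; the remaining
  directions then give the infinitesimal invariance of \<open>e\<close>.\<close>

lemma energy_infinitesimally_invariant:
  assumes S: "canonical_spray G X A S" and fin: "finsler_metric A E" and left: "left_invariant G A E"
    and geo: "contained_up_to_reparameterization (spray_geodesics X A S) (metric_geodesics X A E)"
    and c: "c \<in> A" "p \<in> fst c" and Y: "Y \<noteq> 0"
  shows "frechet_derivative (\<lambda>y. E (\<one>, tvec base \<one> y)) (at Y)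
    (coframe.exterior (maurer_cartan c) (snd c p) w (left_field c p Y)) = 0"
proof -
  define e where "e = (\<lambda>y. E (\<one>, tvec base \<one> y))"
  let ?e' = "\<lambda>Y. frechet_derivative e (at Y)"
  have sme: "smooth_on (- {0}) e" and hom: "\<And>t y. 0 < t \<Longrightarrow> e (t *\<^sub>R y) = t\<^sup>2 * e y" and pos: "0 < e Y"
    using finsler_restriction[OF fin] Y unfolding e_def by blast+
  interpret coframe "chart_image c" "maurer_cartan c" by (rule coframe_maurer_cartan[OF c(1)])
  have x: "snd c p \<in> chart_image c" using c by (simp add: chart_in_image)
  obtain \<gamma> where \<gamma>: "(UNIV, \<gamma>) \<in> spray_geodesics X A S" "\<gamma> 0 = p"
    and body: "\<And>t. body (\<gamma> t) (velocity A \<gamma> t) = Y"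
    using spray_geodesic_through[OF S chart_carrier[OF c] Y] by blast
  have sm: "smooth_curve X A UNIV \<gamma>" using \<gamma>(1) by (simp add: spray_geodesics_def regular_curves_def)
  from geo \<gamma>(1) obtain J \<theta> where J: "open_interval J"
    and \<theta>: "orientation_preserving_reparameterization J UNIV \<theta>" and m: "(J, \<gamma> \<circ> \<theta>) \<in> metric_geodesics X A E"
    unfolding contained_up_to_reparameterization_def by blast
  have opJ: "open J" using J by (simp add: open_interval_def)
  have sm\<theta>: "smooth_on J \<theta>" and \<theta>pos: "\<And>s. s \<in> J \<Longrightarrow> 0 < deriv \<theta> s" and "0 \<in> \<theta> ` J"
    using \<theta> by (auto simp: orientation_preserving_reparameterization_def bij_betw_def)
  then obtain t where t: "t \<in> J" "\<theta> t = 0" by auto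
  have \<theta>': "(\<theta> has_real_derivative deriv \<theta> s) (at s)" if "s \<in> J" for s
    using smooth_onD[OF sm\<theta> that] by (simp add: DERIV_deriv_iff_real_differentiable)
  have "(deriv \<theta>) differentiable (at t)"
  proof -
    obtain D where "((\<lambda>s. frechet_derivative \<theta> (at s) 1) has_derivative D) (at t)"
      using smooth_onD[OF smooth_on_frechet[OF sm\<theta>] t(1)] unfolding differentiable_def by blast
    then have "(deriv \<theta> has_derivative D) (at t)"
    proof (rule has_derivative_transform_within_open[OF _ opJ t(1)])
      fix s assume "s \<in> J"
      from frechet_derivative_at[OF \<theta>'[OF this, unfolded has_field_derivative_def]]
      show "frechet_derivative \<theta> (at s) 1 = deriv \<theta> s" by (metis mult.right_neutral)
    qed
    then show ?thesis by (auto simp: differentiable_def)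
  qed
  then obtain \<theta>'' where \<theta>'': "(deriv \<theta> has_real_derivative \<theta>'') (at t)"
    by (auto simp: real_differentiable_def)
  have vel: "velocity A (\<gamma> \<circ> \<theta>) s = scale_tvec (deriv \<theta> s) (velocity A \<gamma> (\<theta> s))" if "s \<in> J" for s
    by (rule velocity_reparam[OF sm open_UNIV UNIV_I \<theta>'[OF that]])
  have body_\<theta>: "body ((\<gamma> \<circ> \<theta>) s) (velocity A (\<gamma> \<circ> \<theta>) s) = deriv \<theta> s *\<^sub>R Y" if "s \<in> J" for s
    using body_scale[OF velocity_in[OF sm open_UNIV UNIV_I] smooth_curve_carrier[OF sm UNIV_I], of "\<theta> s" "deriv \<theta> s"]
    by (simp add: vel[OF that] body)
  have \<gamma>t: "(\<gamma> \<circ> \<theta>) t = p" using t \<gamma> by simp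
  then have cp: "c \<in> charts_at A ((\<gamma> \<circ> \<theta>) t)" using c by (simp add: charts_at_def)
  have reg: "(J, \<gamma> \<circ> \<theta>) \<in> regular_curves X A" using m by (simp add: metric_geodesics_def)
  have De: "(e has_derivative ?e' y) (at y)" if "y \<noteq> 0" for y
    using smooth_on_has_derivative[OF sme] that by simp
  have De': "(\<lambda>y. ?e' y v) differentiable (at y)" if "y \<noteq> 0" for y v
    using smooth_onD[OF smooth_on_frechet[OF sme]] that by simp
  have inv: "E (q, v) = e (body q v)" if "q \<in> carrier G" "v \<in> tangent_space A q" for q v
    using left_invariant_energy[OF left that] by (simp add: e_def)
  let ?v = "velocity A (\<gamma> \<circ> \<theta>) t c"
  let ?r = "deriv \<theta> t"
  have scale: "?e' (deriv \<theta> s *\<^sub>R Y) z = deriv \<theta> s * ?e' Y z" if "s \<in> J" for s z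
    using homogeneous_derivative[OF sme hom \<theta>pos[OF that] Y] .
  have "((\<lambda>s. ?e' (body ((\<gamma> \<circ> \<theta>) s) (velocity A (\<gamma> \<circ> \<theta>) s)) (mc c ((\<gamma> \<circ> \<theta>) t) w)) has_real_derivative
      ?e' (body ((\<gamma> \<circ> \<theta>) t) (velocity A (\<gamma> \<circ> \<theta>) t)) (exterior (snd c ((\<gamma> \<circ> \<theta>) t)) w ?v)) (at t)" for w
    by (rule euler_lagrange_body[OF De De' inv reg t(1) cp, THEN iffD1, rule_format])
      (use m t(1) cp in \<open>auto simp: metric_geodesics_def\<close>)
  then have "((\<lambda>s. ?e' (body ((\<gamma> \<circ> \<theta>) s) (velocity A (\<gamma> \<circ> \<theta>) s)) (mc c p w)) has_real_derivative
      ?r * ?e' Y (exterior (snd c p) w ?v)) (at t)" for w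
    unfolding \<gamma>t body_\<theta>[OF t(1), unfolded \<gamma>t] scale[OF t(1)] .
  then have "((\<lambda>s. deriv \<theta> s * ?e' Y (mc c p w)) has_real_derivative
      ?r * ?e' Y (exterior (snd c p) w ?v)) (at t)" for w
    by (rule has_field_derivative_transform_within_open[OF _ opJ t(1)]) (simp only: body_\<theta> scale)
  moreover have "((\<lambda>s. deriv \<theta> s * ?e' Y (mc c p w)) has_real_derivative \<theta>'' * ?e' Y (mc c p w)) (at t)" for w
    by (rule DERIV_cmult_right[OF \<theta>''])
  ultimately have el: "?r * ?e' Y (exterior (snd c p) w ?v) = \<theta>'' * ?e' Y (mc c p w)" for w
    by (rule DERIV_unique)
  have linY: "linear (?e' Y)" by (rule has_derivative_linear[OF De[OF Y]])
  have bt: "body p (velocity A (\<gamma> \<circ> \<theta>) t) = ?r *\<^sub>R Y" using body_\<theta>[OF t(1)] \<gamma>t by simp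
  have vT: "velocity A (\<gamma> \<circ> \<theta>) t \<in> tangent_space A p"
    using velocity_in[of J "\<gamma> \<circ> \<theta>" t] reg opJ t(1) \<gamma>t by (simp add: regular_curves_def)
  have mcv: "mc c p ?v = ?r *\<^sub>R Y"
    using body_eq[OF vT cp[unfolded \<gamma>t]] bt by simp
  have v: "?v = ?r *\<^sub>R left_field c p Y"
    using left_field_body[OF vT cp[unfolded \<gamma>t]] bt linear_scale[OF linear_left_field[OF c]] by simp
  have "\<theta>'' * (?r * (2 * e Y)) = 0"
    using el[of ?v] by (simp add: exterior_self linear_0[OF linY] mcv linear_scale[OF linY]
        homogeneous_euler[OF sme hom Y])
  then have "\<theta>'' = 0" using pos \<theta>pos[OF t(1)] by simp
  then have "?r * (?r * ?e' Y (exterior (snd c p) w (left_field c p Y))) = 0"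
    using el[of w] by (simp add: v linear_scale[OF linear_exterior_right[OF x]] linear_scale[OF linY])
  then show ?thesis using \<theta>pos[OF t(1)] by (simp add: e_def)
qed

lemma riemann_metrizable_of_invariant_form:
  fixes b :: "'e \<Rightarrow> 'e \<Rightarrow> real"
  assumes S: "canonical_spray G X A S"
    and bil: "bilinear b" and sym: "\<And>x y. b x y = b y x" and pos: "\<And>x. x \<noteq> 0 \<Longrightarrow> 0 < b x x"
    and inv: "\<And>c p w Y. c \<in> A \<Longrightarrow> p \<in> fst c \<Longrightarrow>
      b Y (coframe.exterior (maurer_cartan c) (snd c p) w (left_field c p Y)) = 0"
  shows "left_invariant_riemann_metrizable G X A S"
proof -
  define E where "E = (\<lambda>(p, v). b (body p v) (body p v))"
  have E: "E (p, v) = b (body p v) (body p v)" for p v by (simp add: E_def)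
  have bb: "bounded_bilinear b" using bil by (simp add: bilinear_conv_bounded_bilinear)
  interpret b: bounded_bilinear b by (rule bb)
  let ?N = "maurer_cartan"
  have L: "coord_expr A E c (x, y) = b (?N c (x, y)) (?N c (x, y))" if "c \<in> A" "x \<in> chart_image c" for c x y
    using coord_expr_body[OF that, of E "\<lambda>Y. b Y Y"] E by blast
  have op: "open (chart_image c \<times> (UNIV :: 'e set))" if "c \<in> A" for c
    using chart_image_open[OF that] by (simp add: open_Times)
  have smL: "smooth_on (chart_image c \<times> UNIV) (coord_expr A E c)" if c: "c \<in> A" for c
  proof (rule smooth_on_cong[OF op[OF c]])
    show "smooth_on (chart_image c \<times> UNIV) (\<lambda>z. b (?N c z) (?N c z))"
      by (intro smooth_on_bilinear[OF op[OF c] _ _ bb] smooth_maurer_cartan c)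
    show "b (?N c z) (?N c z) = coord_expr A E c z" if "z \<in> chart_image c \<times> UNIV" for z
      using that L[OF c] by (metis mem_Times_iff prod.collapse)
  qed
  have linN: "linear (\<lambda>y. ?N c (x, y))" if "c \<in> A" "x \<in> chart_image c" for c x
    using coframe.linear_N[OF coframe_maurer_cartan] that by blast
  have hess: "partial_y i (partial_y j (coord_expr A E c)) (x, y) = 2 * b (?N c (x, i)) (?N c (x, j))"
    if c: "c \<in> A" and x: "x \<in> chart_image c" for c x y i j
  proof -
    have N': "((\<lambda>y. ?N c (x, y)) has_derivative (\<lambda>k. ?N c (x, k))) (at y)" for y
      using linN[OF c x] by (simp add: linear_conv_bounded_linear bounded_linear_imp_has_derivative)
    have py: "partial_y j (coord_expr A E c) (x, y) = 2 * b (?N c (x, y)) (?N c (x, j))" for y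
    proof -
      have "((\<lambda>y. coord_expr A E c (x, y)) has_derivative
          (\<lambda>k. b (?N c (x, y)) (?N c (x, k)) + b (?N c (x, k)) (?N c (x, y)))) (at y)"
        unfolding L[OF c x] by (rule b.FDERIV[OF N' N'])
      from fun_cong[OF frechet_derivative_at[OF this], of j] show ?thesis
        using x by (subst partial_y_slice[OF smooth_onD[OF smL[OF c]]])
          (simp_all add: sym[of "?N c (x, j)"])
    qed
    have "((\<lambda>y. partial_y j (coord_expr A E c) (x, y)) has_derivative
        (\<lambda>k. 2 * b (?N c (x, k)) (?N c (x, j)))) (at y)"
      unfolding py by (intro has_derivative_mult_right bounded_linear.has_derivative[OF b.bounded_linear_left N'])
    from fun_cong[OF frechet_derivative_at[OF this], of i] show ?thesis
      using x smooth_onD[OF smooth_on_frechet[OF smL[OF c]], of "(x, y)" "(0, j)"]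
      by (subst partial_y_slice) (simp_all add: partial_y_def[abs_def])
  qed
  have finsler: "finsler_metric A E"
    unfolding finsler_metric_def
  proof (intro conjI ballI allI impI)
    show "smooth_on (chart_image (slit_chart A c)) (coord_expr A E c)" if "c \<in> A" for c
      unfolding slit_chart_image[OF that] by (rule smooth_on_subset[OF smL[OF that]]) auto
    show "case z of (p, v) \<Rightarrow> \<forall>t>0. E (p, scale_tvec t v) = t\<^sup>2 * E (p, v)"
      if "z \<in> tangent_bundle A" for z
      using that covering topspace_carrier
      by (auto simp: tangent_bundle_def E body_scale b.scaleR_left b.scaleR_right power2_eq_square)
    fix c :: "('g, 'e) chart" and z :: "'e \<times> 'e" and w :: 'e
    assume c: "c \<in> A" and z: "z \<in> chart_image (slit_chart A c)" and w: "w \<noteq> 0"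
    obtain x y where zx: "z = (x, y)" "x \<in> chart_image c" using z slit_chart_image[OF c] by auto
    have bilN: "bilinear (\<lambda>u v. b (?N c (x, u)) (?N c (x, v)))"
      using linear_compose[OF linN[OF c zx(2)]] bil by (auto simp: bilinear_def o_def)
    have "?N c (x, w) \<noteq> 0"
    proof
      assume "?N c (x, w) = 0"
      then have "left_field c (chart_inv c x) 0 = w"
        using mc_left_field(2)[OF c chart_inv_in[OF zx(2)], of w] by (simp add: maurer_cartan_def)
      then show False using w linear_0[OF linear_left_field[OF c chart_inv_in[OF zx(2)]]] by simp
    qed
    then have "0 < 2 * b (?N c (x, w)) (?N c (x, w))" using pos by simp
    also have "\<dots> = (\<Sum>i\<in>Basis. \<Sum>j\<in>Basis. 2 * b (?N c (x, i)) (?N c (x, j)) * (w \<bullet> i) * (w \<bullet> j))"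
      using bilinear_expand_Basis[OF bilN, of w w] by (simp add: sum_distrib_left mult_ac)
    finally show "0 < (\<Sum>i\<in>Basis. \<Sum>j\<in>Basis. partial_y i (partial_y j (coord_expr A E c)) z * (w \<bullet> i) * (w \<bullet> j))"
      unfolding zx(1) hess[OF c zx(2)] .
  qed
  have riemannian: "riemannian_metric A E"
    unfolding riemannian_metric_def
  proof (intro conjI ballI)
    show "finsler_metric A E" by (rule finsler)
    fix c x assume c: "c \<in> A" "x \<in> chart_image c"
    have "bilinear (\<lambda>u v. b (?N c (x, u)) (?N c (x, v)))"
      using linear_compose[OF linN[OF c]] bil by (auto simp: bilinear_def o_def)
    then show "\<exists>b. bilinear b \<and> (\<forall>y. coord_expr A E c (x, y) = b y y)"
      using L[OF c] by blast
  qed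
  have left: "left_invariant G A E"
    unfolding left_invariant_def
    using covering topspace_carrier by (auto simp: tangent_bundle_def E body_differential)
  have d_form: "((\<lambda>Y. b Y Y) has_derivative (\<lambda>v. 2 * b Y v)) (at Y)" for Y
    using b.FDERIV[OF has_derivative_ident has_derivative_ident, of Y UNIV] by (simp add: sym)
  have d_form': "(\<lambda>Y. 2 * b Y v) differentiable (at Y)" for Y v
    by (intro differentiableI[OF has_derivative_mult_right[OF
          bounded_linear.has_derivative[OF b.bounded_linear_left has_derivative_ident]]])
  have el: "(\<forall>i\<in>Basis.
       let lift = (\<lambda>s. (snd c (\<gamma> s), vector_derivative (snd c \<circ> \<gamma>) (at s)))
       in ((\<lambda>s. partial_y i (coord_expr A E c) (lift s)) has_real_derivative
             partial_x i (coord_expr A E c) (lift t)) (at t)) \<longleftrightarrow>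
      (\<forall>Z. ((\<lambda>s. 2 * b (body (\<gamma> s) (velocity A \<gamma> s)) Z) has_real_derivative 0) (at t))"
    if reg: "(I, \<gamma>) \<in> regular_curves X A" and t: "t \<in> I" and c: "c \<in> charts_at A (\<gamma> t)" for I \<gamma> t c
  proof -
    have cA: "c \<in> A" "\<gamma> t \<in> fst c" using c by (auto simp: charts_at_def)
    have "velocity A \<gamma> t \<in> tangent_space A (\<gamma> t)"
      using reg t by (intro velocity_in) (auto simp: regular_curves_def open_interval_def)
    from left_field_body[OF this c]
    have zero: "b (body (\<gamma> t) (velocity A \<gamma> t))
        (coframe.exterior (?N c) (snd c (\<gamma> t)) w (velocity A \<gamma> t c)) = 0" for w
      using inv[OF cA] by simp
    show ?thesis
      unfolding euler_lagrange_body[OF d_form d_form' E reg t c] zero mult_zero_right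
    proof (intro iffI allI)
      fix Z
      assume "\<forall>w. ((\<lambda>s. 2 * b (body (\<gamma> s) (velocity A \<gamma> s)) (mc c (\<gamma> t) w)) has_real_derivative 0) (at t)"
      from spec[OF this, of "left_field c (\<gamma> t) Z"]
      show "((\<lambda>s. 2 * b (body (\<gamma> s) (velocity A \<gamma> s)) Z) has_real_derivative 0) (at t)"
        by (simp only: mc_left_field(1)[OF cA])
    qed (rule spec)
  qed
  have "(I, \<gamma>) \<in> metric_geodesics X A E \<longleftrightarrow> (I, \<gamma>) \<in> spray_geodesics X A S" for I \<gamma>
  proof
    assume "(I, \<gamma>) \<in> metric_geodesics X A E"
    then have reg: "(I, \<gamma>) \<in> regular_curves X A"
      and eq: "\<And>t c. t \<in> I \<Longrightarrow> c \<in> charts_at A (\<gamma> t) \<Longrightarrow> \<forall>i\<in>Basis.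
       let lift = (\<lambda>s. (snd c (\<gamma> s), vector_derivative (snd c \<circ> \<gamma>) (at s)))
       in ((\<lambda>s. partial_y i (coord_expr A E c) (lift s)) has_real_derivative
             partial_x i (coord_expr A E c) (lift t)) (at t)"
      unfolding metric_geodesics_def by auto
    have I: "open_interval I" and sm: "smooth_curve X A I \<gamma>" using reg by (auto simp: regular_curves_def)
    let ?B = "\<lambda>s. body (\<gamma> s) (velocity A \<gamma> s)"
    have deriv0: "((\<lambda>s. 2 * b (?B s) Z) has_real_derivative 0) (at t)" if t: "t \<in> I" for t Z
    proof -
      have "\<gamma> t \<in> topspace X" using smooth_curve_carrier[OF sm t] topspace_carrier by simp
      then obtain c where "c \<in> A" "\<gamma> t \<in> fst c" by (rule obtain_chart)
      then have c: "c \<in> charts_at A (\<gamma> t)" by (simp add: charts_at_def)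
      show ?thesis using el[OF reg t c] eq[OF t c] by blast
    qed
    have "\<exists>k. \<forall>s\<in>I. 2 * b (?B s) Z = k" for Z
      using I deriv0 by (intro has_field_derivative_zero_constant)
        (auto simp: open_interval_def is_interval_convex intro: has_field_derivative_at_within)
    then have const: "b (?B s) Z = b (?B t) Z" if "s \<in> I" "t \<in> I" for s t Z
      using that by (metis mult_cancel_left zero_neq_numeral)
    have "?B s = ?B t" if "s \<in> I" "t \<in> I" for s t
    proof -
      have "b (?B s - ?B t) (?B s - ?B t) = 0"
        using const[OF that] by (simp add: b.diff_left)
      then show ?thesis using pos[of "?B s - ?B t"] by fastforce
    qed
    then show "(I, \<gamma>) \<in> spray_geodesics X A S"
      unfolding spray_geodesics_iff[OF S] using reg by blast
  next
    assume "(I, \<gamma>) \<in> spray_geodesics X A S"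
    then obtain Y where reg: "(I, \<gamma>) \<in> regular_curves X A"
      and Y: "\<And>t. t \<in> I \<Longrightarrow> body (\<gamma> t) (velocity A \<gamma> t) = Y"
      unfolding spray_geodesics_iff[OF S] by blast
    have I: "open I" using reg by (auto simp: regular_curves_def open_interval_def)
    have "((\<lambda>s. 2 * b (body (\<gamma> s) (velocity A \<gamma> s)) Z) has_real_derivative 0) (at t)" if t: "t \<in> I" for t Z
    proof -
      have "((\<lambda>s. 2 * b Y Z) has_real_derivative 0) (at t)" by (rule DERIV_const)
      then show ?thesis
        by (rule has_field_derivative_transform_within_open[OF _ I t]) (simp add: Y)
    qed
    then have "\<forall>t\<in>I. \<forall>c\<in>charts_at A (\<gamma> t). \<forall>i\<in>Basis.
       let lift = (\<lambda>s. (snd c (\<gamma> s), vector_derivative (snd c \<circ> \<gamma>) (at s)))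
       in ((\<lambda>s. partial_y i (coord_expr A E c) (lift s)) has_real_derivative
             partial_x i (coord_expr A E c) (lift t)) (at t)"
      using el[OF reg] by blast
    then show "(I, \<gamma>) \<in> metric_geodesics X A E"
      unfolding metric_geodesics_def using reg by blast
  qed
  then have "metric_geodesics X A E = spray_geodesics X A S" by auto
  then show ?thesis
    unfolding left_invariant_riemann_metrizable_def using riemannian left by blast
qed

lemma riemann_metrizable_of_projectively_finsler_metrizable:
  assumes S: "canonical_spray G X A S" and "left_invariant_projectively_finsler_metrizable G X A S"
  shows "left_invariant_riemann_metrizable G X A S"
proof -
  obtain E where fin: "finsler_metric A E" and left: "left_invariant G A E"
    and geo: "contained_up_to_reparameterization (spray_geodesics X A S) (metric_geodesics X A E)"
    using assms(2) unfolding left_invariant_projectively_finsler_metrizable_def projectively_equivalent_def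
    by blast
  let ?e = "\<lambda>y. E (\<one>, tvec base \<one> y)"
  note e = finsler_restriction[OF fin]
  have De: "(?e has_derivative frechet_derivative ?e (at y)) (at y)" if "y \<noteq> 0" for y
    using smooth_on_has_derivative[OF e(1)] that by simp
  have "continuous_on (- {0}) ?e"
    using smooth_onD[OF e(1)] by (meson continuous_at_imp_continuous_on differentiable_imp_continuous_within)
  then obtain k K where k: "0 < k" "\<And>y. k * (norm y)\<^sup>2 \<le> ?e y" "\<And>y. ?e y \<le> K * (norm y)\<^sup>2"
    using homogeneous_bounds[of ?e] e(2,3) by blast
  from infinitesimally_invariant_inner_product[OF k De]
  obtain b :: "'e \<Rightarrow> 'e \<Rightarrow> real" where b: "bilinear b \<and> (\<forall>x y. b x y = b y x) \<and> (\<forall>x. x \<noteq> 0 \<longrightarrow> 0 < b x x) \<and>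
    (\<forall>D. linear D \<longrightarrow> (\<forall>x. x \<noteq> 0 \<longrightarrow> frechet_derivative ?e (at x) (D x) = 0) \<longrightarrow> (\<forall>x. b x (D x) = 0))"
    by (rule exE)
  show ?thesis
  proof (rule riemann_metrizable_of_invariant_form[OF S])
    show "bilinear b" "b x y = b y x" "x \<noteq> 0 \<Longrightarrow> 0 < b x x" for x y using b by blast+
    fix c p w Y assume c: "c \<in> A" "p \<in> fst c"
    have "linear (\<lambda>Y. coframe.exterior (maurer_cartan c) (snd c p) w (left_field c p Y))"
      using linear_compose[OF linear_left_field[OF c]
          coframe.linear_exterior_right[OF coframe_maurer_cartan[OF c(1)] chart_in_image[OF c(2)]]]
      by (simp add: o_def)
    moreover have "\<forall>x. x \<noteq> 0 \<longrightarrow> frechet_derivative ?e (at x)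
        (coframe.exterior (maurer_cartan c) (snd c p) w (left_field c p x)) = 0"
      using energy_infinitesimally_invariant[OF S fin left geo c] by blast
    ultimately show "b Y (coframe.exterior (maurer_cartan c) (snd c p) w (left_field c p Y)) = 0"
      using b by blast
  qed
qed

end

lemma projectively_equivalent_refl: "projectively_equivalent (spray_geodesics X A S) (spray_geodesics X A S)"
proof -
  have "contained_up_to_reparameterization (spray_geodesics X A S) (spray_geodesics X A S)"
    unfolding contained_up_to_reparameterization_def
  proof (clarify, intro exI conjI)
    fix I \<gamma> assume geo: "(I, \<gamma>) \<in> spray_geodesics X A S"
    then show "open_interval I" by (simp add: spray_geodesics_def regular_curves_def)
    show "orientation_preserving_reparameterization I I (\<lambda>t. t)"
      by (simp add: orientation_preserving_reparameterization_def smooth_on_id bij_betw_def)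
    show "(I, \<gamma> \<circ> (\<lambda>t. t)) \<in> spray_geodesics X A S" using geo by (simp add: o_def)
  qed
  then show ?thesis by (simp add: projectively_equivalent_def)
qed

theorem theorem4p5:
  fixes G :: "('g, 'b) monoid_scheme"
    and X :: "'g topology"
    and A :: "('g, 'e::euclidean_space) atlas"
    and S :: "('g \<times> ('g, 'e) tvec, 'e \<times> 'e) vfield"
  assumes "lie_group G X A"
    and "canonical_spray G X A S"
  shows "left_invariant_projectively_finsler_metrizable G X A S \<longleftrightarrow>
         left_invariant_riemann_metrizable G X A S"
proof
  show "left_invariant_riemann_metrizable G X A S"
    if "left_invariant_projectively_finsler_metrizable G X A S"
    using lie_group.riemann_metrizable_of_projectively_finsler_metrizable[OF assms that] .
  show "left_invariant_projectively_finsler_metrizable G X A S"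
    if "left_invariant_riemann_metrizable G X A S"
    using that projectively_equivalent_refl[of X A S]
    unfolding left_invariant_riemann_metrizable_def left_invariant_projectively_finsler_metrizable_def
      riemannian_metric_def by metis
qed

end
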